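(* Let a general-form Heun equation of the canonical type $$\frac{d^2u}{ds^2}+\left(\frac\gamma{s-d_1}+\frac\delta{s-d_2}+\frac\epsilon{s-d_3}+\frac{1-\alpha-\beta}{s-d_4}\right)\frac{du}{ds}+\frac{\alpha\beta\left[\prod_{i=1}^3(d_4-d_i)\right]\big/(s-d_4)-q''}{(s-d_1)(s-d_2)(s-d_3)(s-d_4)}\,u=0$$ be given, with $d_1,d_2,d_3,d_4\in\mathbb C$ distinct and $\alpha+\beta-\gamma-\delta-\epsilon+1=0$, which has four singular points and is nontrivial (i.e. $\alpha\beta\neq0$ or $q''\neq0$). It can be reduced to a hypergeometric equation $(\mathfrak h)$ by a rational substitution $z=R(s)$ if and only if $\alpha\beta\neq0$ and the equation satisfies the following conditions. (i) The cross-ratio orbit of $\{d_1,d_2,d_3,d_4\}$ must be that of $\{0,1,D,\infty\}$, where $D$ is one of the five values $2$, $\frac12+\mathrm i\frac{\sqrt3}2$, $4$, $\frac12+\mathrm i\frac{5\sqrt2}4$, $\frac12+\mathrm i\frac{11\sqrt{15}}{90}$. That is, it must be the harmonic orbit, the equianharmonic orbit, or one of three specified generic orbits, one real and two non-real. (ii) The exponent parameters $\gamma,\delta,\epsilon$ must satisfy the conditions that follow from a corresponding subcase (one with this value of $D$) among the subcases (1a)–(2d) listed in the context, for some Möbius transformation $M$ as described there. (iii) The parameter $q''$ must take a value that can be computed uniquely from the parameters $\gamma,\delta,\epsilon$ and the choice of subcase.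
   Context: The hypergeometric equation $(\mathfrak h)$ with parameters $a,b,c\in\mathbb C$ is $$\frac{d^2y}{dz^2}+\left(\frac cz+\frac{a+b-c+1}{z-1}\right)\frac{dy}{dz}+\frac{ab}{z(z-1)}\,y=0 .$$ A second-order equation in $s$ is reduced to a hypergeometric equation by $z=R(s)$, with $R$ a nonconstant rational function, if substituting $z=R(s)$ in $(\mathfrak h)$ for some $a,b,c$, without change of the dependent variable, yields exactly the given equation. The equation of the claim has characteristic exponents $0,1-\gamma$ at $d_1$; $0,1-\delta$ at $d_2$; $0,1-\epsilon$ at $d_3$; $\alpha,\beta$ at $d_4$; $q''$ is its accessory parameter. It has four singular points if each of $d_1,d_2,d_3,d_4$ is genuinely a singular point. The cross-ratio of distinct $A,B,C,E\in\mathbb{CP}^1$ is $(A,B;C,E)=\frac{(C-A)(E-B)}{(E-A)(C-B)}$; if it equals $\sigma$, the cross-ratio orbit of the unordered set $\{A,B,C,E\}$ is $\{\sigma,1-\sigma,1/\sigma,1/(1-\sigma),\sigma/(\sigma-1),(\sigma-1)/\sigma\}$. Two four-point sets have the same orbit iff some Möbius transformation maps one onto the other. The harmonic orbit is $\{-1,\frac12,2\}$; the equianharmonic orbit is $\{\frac12\pm\mathrm i\frac{\sqrt3}2\}$. Let $M$ be a Möbius transformation with $M(d_4)=\infty$ and $M(\{d_1,d_2,d_3\})=\{0,1,D\}$. The exponent parameters $\gamma,\delta,\epsilon$ belong to $d_1,d_2,d_3$ respectively; for $x\in\{0,1,D\}$, $\kappa_x$ denotes the exponent parameter belonging to $M^{-1}(x)$.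 The change of variable $t=M(s)$ turns the equation of the claim into a Heun equation $$\frac{d^2u}{dt^2}+\left(\frac{\kappa_0}{t}+\frac{\kappa_1}{t-1}+\frac{\kappa_D}{t-D}\right)\frac{du}{dt}+\frac{\alpha\beta t-q}{t(t-1)(t-D)}\,u=0$$ with some accessory parameter $q$. Each subcase specifies $D$, conditions on the exponent parameters, and the mandatory value of the normalized accessory parameter $q/\alpha\beta$ of this Heun equation: (1a) $D=2$; $\kappa_0=\kappa_2$; $q/\alpha\beta=1$. (1b) $D=4$; $1-\kappa_1=2(1-\kappa_4)$ and $\kappa_0=\frac12$; $q/\alpha\beta=1$. (1c) $D=2$; $\kappa_0=\kappa_2$ and $1-\kappa_1=2(1-\kappa_0)=2(1-\kappa_2)$; $q/\alpha\beta=1$. (2a) $D=\frac12+\mathrm i\frac{\sqrt3}2$; $\gamma=\delta=\epsilon$; $q/\alpha\beta=\frac12+\mathrm i\frac{\sqrt3}6$. (2b) $D=\frac12+\mathrm i\frac{5\sqrt2}4$; $\kappa_D=\frac23$ and $\kappa_0=\kappa_1=\frac12$; $q/\alpha\beta=\frac12+\mathrm i\frac{\sqrt2}4$. (2c) $D=\frac12+\mathrm i\frac{11\sqrt{15}}{90}$; $\kappa_D=\frac12$ and $\kappa_0=\kappa_1=\frac23$; $q/\alpha\beta=\frac12+\mathrm i\frac{\sqrt{15}}{18}$. (2d) $D=\frac12+\mathrm i\frac{\sqrt3}2$; $\gamma=\delta=\epsilon=\frac23$; $q/\alpha\beta=\frac12+\mathrm i\frac{\sqrt3}6$.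
   Formalization: In (iii) the value of q'' is unique given d_1,…,d_4 and α, β as well as γ, δ, ε and the subcase; it does not follow from γ, δ, ε and the subcase alone, since it is proportional to αβ, which they leave free. *)

theory Defs
  imports
    "HOL-Complex_Analysis.Complex_Analysis"
    "HOL-Computational_Algebra.Polynomial"
begin

section \<open>Second-order linear equations and rational substitutions\<close>

text \<open>
  The pair \<open>(P, Q)\<close> stands for the normalized equation \<open>y'' + P y' + Q y = 0\<close> on the complex plane.
\<close>

type_synonym ode = "(complex \<Rightarrow> complex) \<times> (complex \<Rightarrow> complex)"

definition ode_lhs :: "ode \<Rightarrow> (complex \<Rightarrow> complex) \<Rightarrow> complex \<Rightarrow> complex" where
  "ode_lhs E y s = deriv (deriv y) s + fst E s * deriv y s + snd E s * y s"

text \<open>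
  All coefficients below are rational, so agreement off a finite set is equality as rational
  functions; the finite set absorbs the conventional values \<open>x / 0 = 0\<close> at poles.
\<close>

definition same_ode :: "ode \<Rightarrow> ode \<Rightarrow> bool" where
  "same_ode E E' \<longleftrightarrow>
     (\<exists>F. finite F \<and> (\<forall>s. s \<notin> F \<longrightarrow> fst E s = fst E' s \<and> snd E s = snd E' s))"

text \<open>
  Substituting \<open>z = R s\<close> means replacing \<open>d/dz\<close> by \<open>(1 / R') d/ds\<close>. After multiplication by \<open>R'\<^sup>2\<close>
  to restore the leading coefficient \<open>1\<close>, the result has the coefficients below.
\<close>

definition subst_ode :: "ode \<Rightarrow> (complex \<Rightarrow> complex) \<Rightarrow> ode" where
  "subst_ode E R =
     (\<lambda>s. fst E (R s) * deriv R s - deriv (deriv R) s / deriv R s,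
      \<lambda>s. snd E (R s) * (deriv R s)\<^sup>2)"

lemma ode_lhs_subst_ode:
  assumes R: "R analytic_on {s}" and y: "y analytic_on {R s}" and nz: "deriv R s \<noteq> 0"
  shows "ode_lhs (subst_ode E R) (y \<circ> R) s = (deriv R s)\<^sup>2 * ode_lhs E y (R s)"
proof -
  have dR: "R field_differentiable at s" and dy: "y field_differentiable at (R s)"
    using R y analytic_on_imp_differentiable_at by blast+
  have ddR: "deriv R field_differentiable at s"
    and ddy: "deriv y field_differentiable at (R s)"
    using analytic_deriv[OF R] analytic_deriv[OF y] analytic_on_imp_differentiable_at by blast+
  have near: "eventually (\<lambda>x. f field_differentiable at x) (nhds a)"
    if "f analytic_on {a}" for f :: "complex \<Rightarrow> complex" and a
  proof -
    from that obtain S where S: "open S" "a \<in> S" "f holomorphic_on S"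
      unfolding analytic_at by blast
    then have "\<And>x. x \<in> S \<Longrightarrow> f field_differentiable at x"
      using holomorphic_on_imp_differentiable_at by blast
    with S show ?thesis unfolding eventually_nhds by blast
  qed
  have evR: "eventually (\<lambda>x. R field_differentiable at x) (nhds s)"
    by (rule near[OF R])
  have "filterlim R (nhds (R s)) (nhds s)"
    using field_differentiable_imp_continuous_at[OF dR] by (simp add: continuous_within tendsto_nhds_iff)
  then have evy: "eventually (\<lambda>x. y field_differentiable at (R x)) (nhds s)"
    using near[OF y] unfolding filterlim_iff by blast
  have "eventually (\<lambda>x. deriv (y \<circ> R) x = deriv y (R x) * deriv R x) (nhds s)"
    using evR evy by eventually_elim (rule deriv_chain)
  then have "deriv (deriv (y \<circ> R)) s = deriv (\<lambda>x. deriv y (R x) * deriv R x) s"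
    by (rule deriv_cong_ev) simp
  also have "\<dots> = (deriv y \<circ> R) s * deriv (deriv R) s + deriv (deriv y \<circ> R) s * deriv R s"
    using deriv_mult[of "deriv y \<circ> R" s "deriv R"] field_differentiable_compose[OF dR ddy] ddR
    by (simp add: o_def)
  also have "deriv (deriv y \<circ> R) s = deriv (deriv y) (R s) * deriv R s"
    by (rule deriv_chain[OF dR ddy])
  finally show ?thesis
    using nz deriv_chain[OF dR dy] unfolding o_def
    by (simp add: ode_lhs_def subst_ode_def field_simps power2_eq_square)
qed

definition nonconstant_rational :: "(complex \<Rightarrow> complex) \<Rightarrow> bool" where
  "nonconstant_rational R \<longleftrightarrow>
     (\<exists>p q. q \<noteq> 0 \<and> (\<nexists>k. p = smult k q) \<and> R = (\<lambda>s. poly p s / poly q s))"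

definition hypergeometric_ode :: "complex \<Rightarrow> complex \<Rightarrow> complex \<Rightarrow> ode" where
  "hypergeometric_ode a b c =
     (\<lambda>z. c / z + (a + b - c + 1) / (z - 1), \<lambda>z. a * b / (z * (z - 1)))"

definition reducible_to_hypergeometric :: "ode \<Rightarrow> bool" where
  "reducible_to_hypergeometric E \<longleftrightarrow>
     (\<exists>R a b c. nonconstant_rational R \<and> same_ode (subst_ode (hypergeometric_ode a b c) R) E)"

definition ordinary_point :: "ode \<Rightarrow> complex \<Rightarrow> bool" where
  "ordinary_point E d \<longleftrightarrow>
     (\<exists>f g. f analytic_on {d} \<and> g analytic_on {d} \<and>
        eventually (\<lambda>s. fst E s = f s \<and> snd E s = g s) (at d))"

abbreviation singular_point :: "ode \<Rightarrow> complex \<Rightarrow> bool" where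
  "singular_point E d \<equiv> \<not> ordinary_point E d"

section \<open>Heun equations\<close>

definition heun_ode ::
    "complex \<Rightarrow> complex \<Rightarrow> complex \<Rightarrow> complex \<Rightarrow> complex \<Rightarrow> complex \<Rightarrow> complex \<Rightarrow> ode" where
  "heun_ode D \<kappa>0 \<kappa>1 \<kappa>D \<alpha> \<beta> q =
     (\<lambda>t. \<kappa>0 / t + \<kappa>1 / (t - 1) + \<kappa>D / (t - D),
      \<lambda>t. (\<alpha> * \<beta> * t - q) / (t * (t - 1) * (t - D)))"

definition general_heun_ode ::
    "complex \<Rightarrow> complex \<Rightarrow> complex \<Rightarrow> complex \<Rightarrow>
     complex \<Rightarrow> complex \<Rightarrow> complex \<Rightarrow> complex \<Rightarrow> complex \<Rightarrow> complex \<Rightarrow> ode" where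
  "general_heun_ode d1 d2 d3 d4 \<gamma> \<delta> \<epsilon> \<alpha> \<beta> q'' =
     (\<lambda>s. \<gamma> / (s - d1) + \<delta> / (s - d2) + \<epsilon> / (s - d3) + (1 - \<alpha> - \<beta>) / (s - d4),
      \<lambda>s. (\<alpha> * \<beta> * ((d4 - d1) * (d4 - d2) * (d4 - d3)) / (s - d4) - q'')
            / ((s - d1) * (s - d2) * (s - d3) * (s - d4)))"

section \<open>The Riemann sphere, Moebius transformations and cross-ratios\<close>

datatype riemann_sphere = Fin (coord: complex) | Infty

definition sphere_moebius ::
    "complex \<Rightarrow> complex \<Rightarrow> complex \<Rightarrow> complex \<Rightarrow> riemann_sphere \<Rightarrow> riemann_sphere" where
  "sphere_moebius a b c d x =
     (case x of
        Fin s \<Rightarrow> if c * s + d = 0 then Infty else Fin (moebius a b c d s)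
      | Infty \<Rightarrow> if c = 0 then Infty else Fin (a / c))"

definition is_moebius :: "(riemann_sphere \<Rightarrow> riemann_sphere) \<Rightarrow> bool" where
  "is_moebius M \<longleftrightarrow> (\<exists>a b c d. a * d - b * c \<noteq> 0 \<and> M = sphere_moebius a b c d)"

text \<open>
  The determinant of homogeneous coordinates, with \<open>Fin x = (x : 1)\<close> and \<open>Infty = (1 : 0)\<close>. For
  finite points it is their difference, and the cross-ratio formed with it takes the usual limiting
  value when one of the points is infinite.
\<close>

fun sphere_diff :: "riemann_sphere \<Rightarrow> riemann_sphere \<Rightarrow> complex" where
  "sphere_diff (Fin x) (Fin y) = x - y"
| "sphere_diff Infty (Fin y) = 1"
| "sphere_diff (Fin x) Infty = - 1"
| "sphere_diff Infty Infty = 0"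

definition cross_ratio ::
    "riemann_sphere \<Rightarrow> riemann_sphere \<Rightarrow> riemann_sphere \<Rightarrow> riemann_sphere \<Rightarrow> complex" where
  "cross_ratio A B C E =
     (sphere_diff C A * sphere_diff E B) / (sphere_diff E A * sphere_diff C B)"

definition cross_ratio_orbit ::
    "riemann_sphere \<Rightarrow> riemann_sphere \<Rightarrow> riemann_sphere \<Rightarrow> riemann_sphere \<Rightarrow> complex set" where
  "cross_ratio_orbit A B C E =
     (let \<sigma> = cross_ratio A B C E
      in {\<sigma>, 1 - \<sigma>, 1 / \<sigma>, 1 / (1 - \<sigma>), \<sigma> / (\<sigma> - 1), (\<sigma> - 1) / \<sigma>})"

abbreviation standard_orbit :: "complex \<Rightarrow> complex set" where
  "standard_orbit D \<equiv> cross_ratio_orbit (Fin 0) (Fin 1) (Fin D) Infty"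

definition harmonic_orbit :: "complex set" where
  "harmonic_orbit = {-1, 1/2, 2}"

definition equianharmonic_orbit :: "complex set" where
  "equianharmonic_orbit = {1/2 + \<i> * (sqrt 3 / 2), 1/2 - \<i> * (sqrt 3 / 2)}"

section \<open>The subcases\<close>

datatype subcase = Case1a | Case1b | Case1c | Case2a | Case2b | Case2c | Case2d

fun subcase_D :: "subcase \<Rightarrow> complex" where
  "subcase_D Case1a = 2"
| "subcase_D Case1b = 4"
| "subcase_D Case1c = 2"
| "subcase_D Case2a = 1/2 + \<i> * (sqrt 3 / 2)"
| "subcase_D Case2b = 1/2 + \<i> * (5 * sqrt 2 / 4)"
| "subcase_D Case2c = 1/2 + \<i> * (11 * sqrt 15 / 90)"
| "subcase_D Case2d = 1/2 + \<i> * (sqrt 3 / 2)"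

fun subcase_ratio :: "subcase \<Rightarrow> complex" where
  "subcase_ratio Case1a = 1"
| "subcase_ratio Case1b = 1"
| "subcase_ratio Case1c = 1"
| "subcase_ratio Case2a = 1/2 + \<i> * (sqrt 3 / 6)"
| "subcase_ratio Case2b = 1/2 + \<i> * (sqrt 2 / 4)"
| "subcase_ratio Case2c = 1/2 + \<i> * (sqrt 15 / 18)"
| "subcase_ratio Case2d = 1/2 + \<i> * (sqrt 3 / 6)"

text \<open>Here \<open>\<kappa> x\<close> is the exponent parameter belonging to the singular point \<open>x\<close> of the Heun equation.\<close>

fun subcase_exponents ::
    "subcase \<Rightarrow> (complex \<Rightarrow> complex) \<Rightarrow> complex \<Rightarrow> complex \<Rightarrow> complex \<Rightarrow> bool" where
  "subcase_exponents Case1a \<kappa> \<gamma> \<delta> \<epsilon> \<longleftrightarrow> \<kappa> 0 = \<kappa> 2"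
| "subcase_exponents Case1b \<kappa> \<gamma> \<delta> \<epsilon> \<longleftrightarrow> 1 - \<kappa> 1 = 2 * (1 - \<kappa> 4) \<and> \<kappa> 0 = 1/2"
| "subcase_exponents Case1c \<kappa> \<gamma> \<delta> \<epsilon> \<longleftrightarrow>
     \<kappa> 0 = \<kappa> 2 \<and> 1 - \<kappa> 1 = 2 * (1 - \<kappa> 0) \<and> 2 * (1 - \<kappa> 0) = 2 * (1 - \<kappa> 2)"
| "subcase_exponents Case2a \<kappa> \<gamma> \<delta> \<epsilon> \<longleftrightarrow> \<gamma> = \<delta> \<and> \<delta> = \<epsilon>"
| "subcase_exponents Case2b \<kappa> \<gamma> \<delta> \<epsilon> \<longleftrightarrow>
     \<kappa> (subcase_D Case2b) = 2/3 \<and> \<kappa> 0 = 1/2 \<and> \<kappa> 1 = 1/2"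
| "subcase_exponents Case2c \<kappa> \<gamma> \<delta> \<epsilon> \<longleftrightarrow>
     \<kappa> (subcase_D Case2c) = 1/2 \<and> \<kappa> 0 = 2/3 \<and> \<kappa> 1 = 2/3"
| "subcase_exponents Case2d \<kappa> \<gamma> \<delta> \<epsilon> \<longleftrightarrow> \<gamma> = 2/3 \<and> \<delta> = 2/3 \<and> \<epsilon> = 2/3"

definition normalizing_moebius ::
    "complex \<Rightarrow> complex \<Rightarrow> complex \<Rightarrow> complex \<Rightarrow> complex \<Rightarrow>
     (riemann_sphere \<Rightarrow> riemann_sphere) \<Rightarrow> bool" where
  "normalizing_moebius d1 d2 d3 d4 D M \<longleftrightarrow>
     is_moebius M \<and> M (Fin d4) = Infty \<and> M ` {Fin d1, Fin d2, Fin d3} = {Fin 0, Fin 1, Fin D}"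

text \<open>Meaningful only for \<open>x\<close> in the image of the finite points \<open>d1\<close>, \<open>d2\<close>, \<open>d3\<close>.\<close>

definition exponent_param ::
    "complex \<Rightarrow> complex \<Rightarrow> complex \<Rightarrow> complex \<Rightarrow> complex \<Rightarrow> complex \<Rightarrow>
     (riemann_sphere \<Rightarrow> riemann_sphere) \<Rightarrow> complex \<Rightarrow> complex" where
  "exponent_param d1 d2 d3 \<gamma> \<delta> \<epsilon> M x =
     (if inv M (Fin x) = Fin d1 then \<gamma> else if inv M (Fin x) = Fin d2 then \<delta> else \<epsilon>)"

definition exponents_satisfy ::
    "subcase \<Rightarrow> complex \<Rightarrow> complex \<Rightarrow> complex \<Rightarrow> complex \<Rightarrow>
     complex \<Rightarrow> complex \<Rightarrow> complex \<Rightarrow> (riemann_sphere \<Rightarrow> riemann_sphere) \<Rightarrow> bool" where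
  "exponents_satisfy k d1 d2 d3 d4 \<gamma> \<delta> \<epsilon> M \<longleftrightarrow>
     normalizing_moebius d1 d2 d3 d4 (subcase_D k) M \<and>
     subcase_exponents k (exponent_param d1 d2 d3 \<gamma> \<delta> \<epsilon> M) \<gamma> \<delta> \<epsilon>"

text \<open>
  The accessory parameter \<open>q\<close> of the Heun equation in \<open>t = M s\<close> is recovered from the requirement
  that substituting \<open>t = M s\<close> in that equation gives back the equation in \<open>s\<close>.
\<close>

definition accessory_satisfies ::
    "subcase \<Rightarrow> complex \<Rightarrow> complex \<Rightarrow> complex \<Rightarrow> complex \<Rightarrow>
     complex \<Rightarrow> complex \<Rightarrow> complex \<Rightarrow> complex \<Rightarrow> complex \<Rightarrow>
     (riemann_sphere \<Rightarrow> riemann_sphere) \<Rightarrow> complex \<Rightarrow> bool" where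
  "accessory_satisfies k d1 d2 d3 d4 \<gamma> \<delta> \<epsilon> \<alpha> \<beta> M q'' \<longleftrightarrow>
     (let D = subcase_D k; \<kappa> = exponent_param d1 d2 d3 \<gamma> \<delta> \<epsilon> M in
      \<exists>q. same_ode (subst_ode (heun_ode D (\<kappa> 0) (\<kappa> 1) (\<kappa> D) \<alpha> \<beta> q) (\<lambda>s. coord (M (Fin s))))
                    (general_heun_ode d1 d2 d3 d4 \<gamma> \<delta> \<epsilon> \<alpha> \<beta> q'')
          \<and> q / (\<alpha> * \<beta>) = subcase_ratio k)"

end

theory Submission
  imports Defs "HOL-Computational_Algebra.Fundamental_Theorem_Algebra"
begin

text \<open>
  In the coordinate \<open>w = 1 / (s - d4)\<close> every finite point has an exponent \<open>0\<close>. Since the zeroth-order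
  coefficient of a nontrivial pullback forces \<open>a * b \<noteq> 0\<close>, a finite pole of \<open>R\<close> would have two nonzero
  exponents; hence \<open>R\<close> is a polynomial in \<open>w\<close>. Comparing zeroth-order coefficients then gives
  \<open>n\<^sup>2 (w - t0) R (R - 1) = R'\<^sup>2 L\<close>, where \<open>L\<close> is the monic cubic with the three finite singular points
  as roots. So all ramification lies over \<open>0\<close> and \<open>1\<close>: the singular points other than \<open>t0\<close> are simple,
  \<open>t0\<close> has order \<open>2\<close> or \<open>3\<close> according as it is singular or not, and every other point has order \<open>2\<close>.
  The residues of the first-order coefficient show that over \<open>R t0\<close> there is no point of the last kind.
  With \<open>R t0 = 0\<close> this leaves \<open>R = C (w - t0)\<^sup>\<mu> P\<close>, where \<open>P\<close> divides \<open>L\<close>, and \<open>n\<^sup>2 (R - 1)\<close> is \<open>C\<close> times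
  a square times the remaining factor of \<open>L\<close>; comparing coefficients in the seven possible cases
  gives the seven subcases, and the same polynomials prove the converse.
\<close>

section \<open>Change of variable\<close>

text \<open>The hypergeometric parameters cancel from the comparison of zeroth-order coefficients,
  which fixes \<open>a * b\<close> and otherwise constrains only \<open>R\<close>, \<open>L\<close>
  and \<open>t0\<close>. They return through residues alone: in the fibre of \<open>t0\<close> a
  simple singular point has parameter \<open>c\<close>, in the other fibre \<open>c'\<close>, and a
  singular \<open>t0\<close> has \<open>2 * c - 1\<close>. A nonsingular \<open>t0\<close> forces
  \<open>c = 2/3\<close>, a nonsingular double point forces \<open>c' = 1/2\<close>. This is the
  origin of the values 2/3 and 1/2 and of the relation that doubles \<open>1 - c\<close>. The seven
  cases are counted by the simple points in the fibre of \<open>t0\<close>: 0, 1, 2 of them for a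
  singular \<open>t0\<close> (1a, 1b, 1c) and 0, 1, 2, 3 otherwise (2a to 2d). In each case the
  position of the singular points relative to \<open>t0\<close> is rigid up to affine maps, so
  \<open>D\<close> and the normalized accessory parameter come out together. That parameter does not
  depend on the choice of \<open>M\<close>: an affine permutation of 0, 1, \<open>D\<close> fixes
  their centroid, and whenever a nontrivial one exists the ratio in the table is this
  centroid.\<close>

lemma same_ode_sym: "same_ode E E' \<Longrightarrow> same_ode E' E"
  unfolding same_ode_def by metis

lemma same_ode_trans [trans]:
  assumes "same_ode E E'" "same_ode E' E''"
  shows "same_ode E E''"
proof -
  obtain F G where "finite F" "\<And>s. s \<notin> F \<Longrightarrow> fst E s = fst E' s \<and> snd E s = snd E' s"
    "finite G" "\<And>s. s \<notin> G \<Longrightarrow> fst E' s = fst E'' s \<and> snd E' s = snd E'' s"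
    using assms unfolding same_ode_def by blast
  then show ?thesis
    unfolding same_ode_def by (intro exI[of _ "F \<union> G"]) auto
qed

lemma poly_eq_cofinite:
  fixes p q :: "complex poly"
  assumes "finite F" "\<And>x. x \<notin> F \<Longrightarrow> poly p x = poly q x"
  shows "p = q"
proof (rule ccontr)
  assume "p \<noteq> q"
  then have "finite {x. poly (p - q) x = 0}"
    by (intro poly_roots_finite) simp
  moreover have "- F \<subseteq> {x. poly (p - q) x = 0}"
    using assms(2) by auto
  ultimately have "finite (- F)"
    using finite_subset by blast
  with \<open>finite F\<close> show False
    using infinite_UNIV_char_0[where 'a = complex] by (metis finite_compl)
qed

lemma deriv_eq_off_finite:
  fixes f g :: "complex \<Rightarrow> complex"
  assumes "finite F" "\<And>s. s \<notin> F \<Longrightarrow> f s = g s" "s \<notin> F"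
  shows "deriv f s = deriv g s"
proof (rule deriv_cong_ev)
  have "open (- F)" using assms(1) by (simp add: finite_imp_closed open_Compl)
  then have "eventually (\<lambda>x. x \<in> - F) (nhds s)"
    using assms(3) eventually_nhds_in_open by blast
  then show "eventually (\<lambda>x. f x = g x) (nhds s)"
    by eventually_elim (use assms(2) in auto)
qed simp

text \<open>The complement of a finite set is open, so the same exceptional set serves for both
  derivatives.\<close>

lemma subst_ode_cong_off_finite:
  assumes "finite F" "\<And>s. s \<notin> F \<Longrightarrow> f s = g s"
  shows "same_ode (subst_ode E f) (subst_ode E g)"
  unfolding same_ode_def
proof (intro exI[of _ F] conjI allI impI)
  fix s assume s: "s \<notin> F"
  have 1: "deriv f s = deriv g s" if "s \<notin> F" for s
    using deriv_eq_off_finite[OF assms that] .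
  have 2: "deriv (deriv f) s = deriv (deriv g) s"
    using deriv_eq_off_finite[OF assms(1) 1 s] .
  show "fst (subst_ode E f) s = fst (subst_ode E g) s"
       "snd (subst_ode E f) s = snd (subst_ode E g) s"
    using 1[OF s] 2 assms(2)[OF s] by (simp_all add: subst_ode_def)
qed fact

text \<open>Injectivity of \<open>f\<close> keeps the preimage of the exceptional set
  finite.\<close>

lemma same_ode_subst_ode:
  assumes "same_ode E E'" "inj f"
  shows "same_ode (subst_ode E f) (subst_ode E' f)"
proof -
  obtain F where F: "finite F" "\<And>s. s \<notin> F \<Longrightarrow> fst E s = fst E' s \<and> snd E s = snd E' s"
    using assms(1) unfolding same_ode_def by blast
  have "finite (f -` F)" using F(1) assms(2) by (rule finite_vimageI)
  then show ?thesis unfolding same_ode_def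
    by (intro exI[of _ "f -` F"]) (auto simp: subst_ode_def F(2))
qed

text \<open>This is the chain rule to second order; both derivatives must be nonzero for the
  quotient of second by first derivative to split.\<close>

lemma subst_ode_compose_at:
  assumes f: "f analytic_on {s}" and R: "R analytic_on {f s}"
    and "deriv f s \<noteq> 0" "deriv R (f s) \<noteq> 0"
  shows "fst (subst_ode E (R \<circ> f)) s = fst (subst_ode (subst_ode E R) f) s"
    and "snd (subst_ode E (R \<circ> f)) s = snd (subst_ode (subst_ode E R) f) s"
proof -
  have df: "f field_differentiable at s" and dR: "R field_differentiable at (f s)"
    and ddf: "deriv f field_differentiable at s"
    and ddR: "deriv R field_differentiable at (f s)"
    using f R analytic_deriv analytic_on_imp_differentiable_at by blast+
  have near: "eventually (\<lambda>x. g field_differentiable at x) (nhds a)"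
    if "g analytic_on {a}" for g :: "complex \<Rightarrow> complex" and a
    using that unfolding analytic_at eventually_nhds
    using holomorphic_on_imp_differentiable_at by metis
  have "filterlim f (nhds (f s)) (nhds s)"
    using field_differentiable_imp_continuous_at[OF df]
    by (simp add: continuous_within tendsto_nhds_iff)
  then have "eventually (\<lambda>x. R field_differentiable at (f x)) (nhds s)"
    using near[OF R] unfolding filterlim_iff by blast
  with near[OF f] have "eventually (\<lambda>x. deriv (R \<circ> f) x = deriv R (f x) * deriv f x) (nhds s)"
    by eventually_elim (rule deriv_chain)
  then have "deriv (deriv (R \<circ> f)) s = deriv (\<lambda>x. (deriv R \<circ> f) x * deriv f x) s"
    by (intro deriv_cong_ev) simp_all
  also have "\<dots> = (deriv R \<circ> f) s * deriv (deriv f) s + deriv (deriv R \<circ> f) s * deriv f s"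
    using field_differentiable_compose[OF df ddR] ddf by (simp add: deriv_mult o_def)
  also have "deriv (deriv R \<circ> f) s = deriv (deriv R) (f s) * deriv f s"
    by (rule deriv_chain[OF df ddR])
  finally have 2: "deriv (deriv (R \<circ> f)) s
      = deriv R (f s) * deriv (deriv f) s + deriv (deriv R) (f s) * deriv f s * deriv f s"
    unfolding o_def by simp
  have 1: "deriv (R \<circ> f) s = deriv R (f s) * deriv f s"
    by (rule deriv_chain[OF df dR])
  show "fst (subst_ode E (R \<circ> f)) s = fst (subst_ode (subst_ode E R) f) s"
    and "snd (subst_ode E (R \<circ> f)) s = snd (subst_ode (subst_ode E R) f) s"
    using assms(3,4) unfolding subst_ode_def fst_conv snd_conv 1 2
    by (simp_all add: field_simps power2_eq_square)
qed

lemma subst_ode_compose: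
  assumes "finite F" "\<And>s. s \<notin> F \<Longrightarrow> f analytic_on {s} \<and> deriv f s \<noteq> 0" "inj f"
    and "finite G" "\<And>z. z \<notin> G \<Longrightarrow> R analytic_on {z} \<and> deriv R z \<noteq> 0"
  shows "same_ode (subst_ode E (R \<circ> f)) (subst_ode (subst_ode E R) f)"
  unfolding same_ode_def
proof (intro exI[of _ "F \<union> f -` G"] conjI allI impI)
  show "finite (F \<union> f -` G)"
    using assms finite_vimageI by blast
  fix s assume "s \<notin> F \<union> f -` G"
  then have "f analytic_on {s}" "deriv f s \<noteq> 0" "R analytic_on {f s}" "deriv R (f s) \<noteq> 0"
    using assms by auto
  then show "fst (subst_ode E (R \<circ> f)) s = fst (subst_ode (subst_ode E R) f) s"
    "snd (subst_ode E (R \<circ> f)) s = snd (subst_ode (subst_ode E R) f) s"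
    by (simp_all add: subst_ode_compose_at)
qed

section \<open>Coordinates with a pole at a prescribed point\<close>

text \<open>Every Moebius transformation with pole \<open>d\<close> has this form with
  \<open>A\<close> nonzero, see \<open>moebius_with_pole\<close>.\<close>

definition recip_coord :: "complex \<Rightarrow> complex \<Rightarrow> complex \<Rightarrow> complex \<Rightarrow> complex" where
  "recip_coord d A B s = A / (s - d) + B"

text \<open>The conventional value \<open>B\<close> at \<open>s = d\<close> is not taken elsewhere, so injectivity holds on the whole plane.\<close>

lemma inj_recip_coord: "A \<noteq> 0 \<Longrightarrow> inj (recip_coord d A B)"
  by (rule injI) (auto simp: recip_coord_def field_simps split: if_splits)

lemma recip_coord_deriv:
  assumes "s \<noteq> d"
  shows "recip_coord d A B analytic_on {s}"
    and "deriv (recip_coord d A B) s = - A / (s - d)^2"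
    and "deriv (deriv (recip_coord d A B)) s = 2 * A / (s - d)^3"
proof -
  show "recip_coord d A B analytic_on {s}"
    unfolding recip_coord_def using assms by (intro analytic_intros) auto
  have 1: "deriv (recip_coord d A B) s = - A / (s - d)^2" if "s \<noteq> d" for s
  proof (rule DERIV_imp_deriv)
    show "(recip_coord d A B has_field_derivative - A / (s - d)^2) (at s)"
      unfolding recip_coord_def using that
      by (auto intro!: derivative_eq_intros simp: power2_eq_square)
  qed
  show "deriv (recip_coord d A B) s = - A / (s - d)^2" by (rule 1[OF assms])
  have "deriv (deriv (recip_coord d A B)) s = deriv (\<lambda>s. - A / (s - d)^2) s"
    by (rule deriv_eq_off_finite[where F = "{d}"]) (use 1 assms in auto)
  also have "\<dots> = 2 * A / (s - d)^3"
  proof (rule DERIV_imp_deriv)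
    have "(2 * s - 2 * d) * (s - d) ^ 3 = 2 * (s - d) ^ 4"
      by algebra
    then show "((\<lambda>s. - A / (s - d)^2) has_field_derivative 2 * A / (s - d)^3) (at s)"
      using assms by (auto intro!: derivative_eq_intros simp: divide_simps)
  qed
  finally show "deriv (deriv (recip_coord d A B)) s = 2 * A / (s - d)^3" .
qed

text \<open>An unordered set of points absorbs the permutations of the singular points, and
  arbitrary points instead of 0, 1, \<open>D\<close> leave room for affine changes of coordinate.
  The role of \<alpha>\<beta> is played by \<open>m\<close>.\<close>

definition heun_on :: "complex set \<Rightarrow> (complex \<Rightarrow> complex) \<Rightarrow> complex \<Rightarrow> complex \<Rightarrow> ode" where
  "heun_on S \<kappa> m q =
     (\<lambda>w. \<Sum>e\<in>S. \<kappa> e / (w - e), \<lambda>w. (m * w - q) / (\<Prod>e\<in>S. w - e))"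

lemma heun_ode_eq_heun_on:
  assumes "D \<noteq> 0" "D \<noteq> 1"
  shows "heun_ode D (\<kappa> 0) (\<kappa> 1) (\<kappa> D) \<alpha> \<beta> q = heun_on {0, 1, D} \<kappa> (\<alpha> * \<beta>) q"
  using assms by (simp add: heun_ode_def heun_on_def add_ac mult_ac)

text \<open>Here \<sigma> stands for \<open>s - d4\<close>, the letters \<open>a\<close>,
  \<open>b\<close>, \<open>c\<close> for \<open>d1 - s\<close>, \<open>d2 - s\<close>,
  \<open>d3 - s\<close>, and \<open>D1\<close>, \<open>D2\<close>, \<open>D3\<close> for
  \<open>d1 - d4\<close>, \<open>d2 - d4\<close>, \<open>d3 - d4\<close>. Each factor in the
  denominator is then a difference of coordinate values, and the square is that of the derivative of
  the coordinate.\<close>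

lemma heun_numerator:
  fixes A \<sigma> a b c D1 D2 D3 m B q :: complex
  assumes "A \<noteq> 0" "\<sigma> \<noteq> 0" "a \<noteq> 0" "b \<noteq> 0" "c \<noteq> 0" "D1 \<noteq> 0" "D2 \<noteq> 0" "D3 \<noteq> 0"
  shows "(m * (A / \<sigma> + B) - q) / ((A * a / (\<sigma> * D1)) * (A * b / (\<sigma> * D2)) * (A * c / (\<sigma> * D3)))
      * (- A / \<sigma>^2)^2
    = (m * ((- D1) * (- D2) * (- D3)) / \<sigma> - (q - m * B) / A * ((- D1) * (- D2) * (- D3)))
      / ((- a) * (- b) * (- c) * \<sigma>)"
proof -
  have "(- A / \<sigma>^2)^2 / ((A * a / (\<sigma> * D1)) * (A * b / (\<sigma> * D2)) * (A * c / (\<sigma> * D3)))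
      = D1 * D2 * D3 / (A * \<sigma> * (a * b * c))"
    using assms by (simp add: field_simps power2_eq_square)
  then have "(m * (A / \<sigma> + B) - q) / ((A * a / (\<sigma> * D1)) * (A * b / (\<sigma> * D2)) * (A * c / (\<sigma> * D3)))
      * (- A / \<sigma>^2)^2 = (m * (A / \<sigma> + B) - q) * (D1 * D2 * D3 / (A * \<sigma> * (a * b * c)))"
    by (simp only: times_divide_eq_left times_divide_eq_right flip: times_divide_eq_right)
  also have "\<dots> = (m * ((- D1) * (- D2) * (- D3)) / \<sigma> - (q - m * B) / A * ((- D1) * (- D2) * (- D3)))
      / ((- a) * (- b) * (- c) * \<sigma>)"
    using assms by (simp add: divide_simps) (simp add: algebra_simps)
  finally show ?thesis .
qed

text \<open>A simple pole at the image of \<open>d1\<close> pulls back to simple poles at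
  \<open>d1\<close> and \<open>d4\<close> with opposite residues. The second derivative of the
  coordinate adds residue 2 at \<open>d4\<close>, and the Fuchs relation turns the total there into
  \<open>1 - \<alpha> - \<beta>\<close>.\<close>

lemma heun_on_coefficients_at:
  fixes x1 x2 x3 :: complex
  defines "S \<equiv> {x1, x2, x3}"
  assumes x: "x1 = recip_coord d4 A B d1" "x2 = recip_coord d4 A B d2" "x3 = recip_coord d4 A B d3"
    and A: "A \<noteq> 0" and d: "distinct [d1, d2, d3, d4]" and s: "s \<notin> {d1, d2, d3, d4}"
    and fuchs: "\<alpha> + \<beta> - \<kappa> x1 - \<kappa> x2 - \<kappa> x3 + 1 = 0"
    and q'': "q'' = (q - \<alpha> * \<beta> * B) / A * ((d4 - d1) * (d4 - d2) * (d4 - d3))"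
  shows "fst (subst_ode (heun_on S \<kappa> (\<alpha> * \<beta>) q) (recip_coord d4 A B)) s
       = fst (general_heun_ode d1 d2 d3 d4 (\<kappa> x1) (\<kappa> x2) (\<kappa> x3) \<alpha> \<beta> q'') s"
    and "snd (subst_ode (heun_on S \<kappa> (\<alpha> * \<beta>) q) (recip_coord d4 A B)) s
       = snd (general_heun_ode d1 d2 d3 d4 (\<kappa> x1) (\<kappa> x2) (\<kappa> x3) \<alpha> \<beta> q'') s"
proof -
  let ?w = "recip_coord d4 A B s"
  have ne: "s \<noteq> d4" "d1 \<noteq> d4" "d2 \<noteq> d4" "d3 \<noteq> d4" "s \<noteq> d1" "s \<noteq> d2" "s \<noteq> d3" using s d by auto
  have dist: "x1 \<noteq> x2" "x1 \<noteq> x3" "x2 \<noteq> x3"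
    using d inj_recip_coord[OF A, of d4 B] unfolding x by (auto dest: injD)
  note der = recip_coord_deriv(2,3)[OF ne(1), of A B]
  have diff: "?w - recip_coord d4 A B e = A * (e - s) / ((s - d4) * (e - d4))" if "e \<noteq> d4" for e
    using that ne(1) by (simp add: recip_coord_def field_simps)
  have pole: "k / (?w - recip_coord d4 A B e) * (- A / (s - d4)^2) = k * (1 / (s - e) - 1 / (s - d4))"
    if "e \<noteq> d4" "s \<noteq> e" for e k
    unfolding diff[OF that(1)] using A ne(1) that by (simp add: divide_simps) algebra
  have "fst (subst_ode (heun_on S \<kappa> (\<alpha> * \<beta>) q) (recip_coord d4 A B)) s
      = (\<kappa> x1 / (?w - x1) + \<kappa> x2 / (?w - x2) + \<kappa> x3 / (?w - x3)) * (- A / (s - d4)^2)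
        - (2 * A / (s - d4)^3) / (- A / (s - d4)^2)"
    using dist by (simp add: subst_ode_def heun_on_def S_def der add_ac)
  also have "(2 * A / (s - d4)^3) / (- A / (s - d4)^2) = - 2 / (s - d4)"
    using A ne(1) by (simp add: divide_simps) algebra
  also have "(\<kappa> x1 / (?w - x1) + \<kappa> x2 / (?w - x2) + \<kappa> x3 / (?w - x3)) * (- A / (s - d4)^2)
      = \<kappa> x1 * (1 / (s - d1) - 1 / (s - d4)) + \<kappa> x2 * (1 / (s - d2) - 1 / (s - d4))
        + \<kappa> x3 * (1 / (s - d3) - 1 / (s - d4))"
    unfolding distrib_right using pole[of d1] pole[of d2] pole[of d3] ne by (simp add: x)
  also have "\<dots> - - 2 / (s - d4) = \<kappa> x1 / (s - d1) + \<kappa> x2 / (s - d2) + \<kappa> x3 / (s - d3)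
        + (2 - \<kappa> x1 - \<kappa> x2 - \<kappa> x3) / (s - d4)"
    by (simp add: right_diff_distrib diff_divide_distrib)
  also have "2 - \<kappa> x1 - \<kappa> x2 - \<kappa> x3 = 1 - \<alpha> - \<beta>" using fuchs by algebra
  finally show "fst (subst_ode (heun_on S \<kappa> (\<alpha> * \<beta>) q) (recip_coord d4 A B)) s
       = fst (general_heun_ode d1 d2 d3 d4 (\<kappa> x1) (\<kappa> x2) (\<kappa> x3) \<alpha> \<beta> q'') s"
    by (simp add: general_heun_ode_def)
  have "snd (subst_ode (heun_on S \<kappa> (\<alpha> * \<beta>) q) (recip_coord d4 A B)) s
     = (\<alpha> * \<beta> * ?w - q) / ((?w - x1) * (?w - x2) * (?w - x3)) * (- A / (s - d4)^2)^2"
    using dist by (simp add: subst_ode_def heun_on_def S_def der mult_ac)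
  also have "\<dots> = (\<alpha> * \<beta> * (A / (s - d4) + B) - q) / ((A * (d1 - s) / ((s - d4) * (d1 - d4)))
      * (A * (d2 - s) / ((s - d4) * (d2 - d4))) * (A * (d3 - s) / ((s - d4) * (d3 - d4))))
      * (- A / (s - d4)^2)^2"
    unfolding x diff[OF ne(2)] diff[OF ne(3)] diff[OF ne(4)] by (simp add: recip_coord_def)
  also have "\<dots> = (\<alpha> * \<beta> * ((d4 - d1) * (d4 - d2) * (d4 - d3)) / (s - d4) - q'')
            / ((s - d1) * (s - d2) * (s - d3) * (s - d4))"
    using heun_numerator[of A "s - d4" "d1 - s" "d2 - s" "d3 - s" "d1 - d4" "d2 - d4" "d3 - d4" "\<alpha> * \<beta>" B q] A ne
    unfolding q'' by simp
  finally show "snd (subst_ode (heun_on S \<kappa> (\<alpha> * \<beta>) q) (recip_coord d4 A B)) s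
       = snd (general_heun_ode d1 d2 d3 d4 (\<kappa> x1) (\<kappa> x2) (\<kappa> x3) \<alpha> \<beta> q'') s"
    by (simp add: general_heun_ode_def)
qed

section \<open>Orders of roots\<close>

text \<open>A common root is a common linear factor, and removing it lowers the degree of
  \<open>q\<close>.\<close>

lemma cancel_common_roots:
  fixes p q :: "complex poly"
  assumes "q \<noteq> 0"
  shows "\<exists>p1 q1 g. p = p1 * g \<and> q = q1 * g \<and> (\<forall>r. \<not> (poly p1 r = 0 \<and> poly q1 r = 0))"
  using assms
proof (induction "degree q" arbitrary: p q rule: less_induct)
  case less
  show ?case
  proof (cases "\<exists>r. poly p r = 0 \<and> poly q r = 0")
    case False
    then show ?thesis by (intro exI[of _ p] exI[of _ q] exI[of _ 1]) auto
  next
    case True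
    then obtain r p' q' where p': "p = [:-r, 1:] * p'" and q': "q = [:-r, 1:] * q'"
      unfolding poly_eq_0_iff_dvd dvd_def by blast
    have "q' \<noteq> 0" using less.prems q' by auto
    then have "degree q = Suc (degree q')"
      unfolding q' by (subst degree_mult_eq) auto
    then obtain p1 q1 g where "p' = p1 * g" "q' = q1 * g" "\<forall>r. \<not> (poly p1 r = 0 \<and> poly q1 r = 0)"
      using less.hyps[of q' p'] \<open>q' \<noteq> 0\<close> by auto
    then have "p = p1 * ([:-r, 1:] * g)" "q = q1 * ([:-r, 1:] * g)"
      unfolding p' q' by (simp_all only: mult_ac)
    with \<open>\<forall>r. \<not> (poly p1 r = 0 \<and> poly q1 r = 0)\<close> show ?thesis
      by blast
  qed
qed

lemma no_roots_imp_degree_0: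
  fixes p :: "complex poly"
  assumes "\<And>r. poly p r \<noteq> 0"
  shows "degree p = 0"
  using fundamental_theorem_of_algebra[of p] assms constant_degree by blast

text \<open>The sign is chosen so that this is the numerator of the derivative of
  \<open>p / q\<close> over \<open>q^2\<close>.\<close>

definition wronskian :: "complex poly \<Rightarrow> complex poly \<Rightarrow> complex poly" where
  "wronskian p q = pderiv p * q - p * pderiv q"

text \<open>At a pole of order k the derivative of \<open>p / q\<close> has a pole of order k + 1,
  while \<open>q^2\<close> has a root of order 2k; the difference is k - 1.\<close>

lemma order_wronskian:
  assumes "q \<noteq> 0" "poly q r = 0" "poly p r \<noteq> 0"
  shows "wronskian p q \<noteq> 0" "Suc (order r (wronskian p q)) = order r q"
proof -
  obtain h where h: "q = [:- r, 1:] ^ order r q * h" "\<not> [:- r, 1:] dvd h"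
    using order_decomp[OF assms(1)] by blast
  obtain \<mu> where \<mu>: "order r q = Suc \<mu>"
    using assms(1,2) order_root[of q r] by (cases "order r q") auto
  have hr: "poly h r \<noteq> 0" using h(2) by (simp add: poly_eq_0_iff_dvd)
  have q: "q = [:- r, 1:] ^ Suc \<mu> * h" using h(1) \<mu> by simp
  \<comment> \<open>The cofactor of the wronskian after removing the root \<open>r\<close>, where
    \<mu> is one less than the order of \<open>q\<close>. At \<open>r\<close> only the last summand
    survives.\<close>
  define V where "V = [:- r, 1:] * (pderiv p * h - p * pderiv h) - smult (of_nat (Suc \<mu>)) (p * h)"
  have "poly V r = - (of_nat (Suc \<mu>) * (poly p r * poly h r))"
    by (simp add: V_def)
  then have Vr: "poly V r \<noteq> 0"
    using hr assms(3) by (simp del: of_nat_Suc)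
  have W: "wronskian p q = [:- r, 1:] ^ \<mu> * V"
    unfolding wronskian_def q lemma_order_pderiv1 V_def by (simp add: algebra_simps smult_add_right)
  have "V \<noteq> 0" using Vr by auto
  then show nz: "wronskian p q \<noteq> 0"
    unfolding W by simp
  show "Suc (order r (wronskian p q)) = order r q"
    unfolding \<mu> using nz unfolding W
    by (simp add: order_mult order_power_n_n order_0I[OF Vr])
qed

lemma rational_deriv:
  assumes "poly q s \<noteq> 0"
  shows "(\<lambda>s. poly p s / poly q s) analytic_on {s}"
    and "deriv (\<lambda>s. poly p s / poly q s) s = poly (wronskian p q) s / (poly q s)^2"
proof -
  have an: "poly f analytic_on {s}" for f :: "complex poly"
    unfolding analytic_at by (intro exI[of _ UNIV]) (auto intro: holomorphic_intros)
  show "(\<lambda>s. poly p s / poly q s) analytic_on {s}"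
    using assms by (intro analytic_on_divide an) auto
  show "deriv (\<lambda>s. poly p s / poly q s) s = poly (wronskian p q) s / (poly q s)^2"
    by (rule DERIV_imp_deriv)
      (use assms in \<open>auto intro!: derivative_eq_intros simp: wronskian_def power2_eq_square\<close>)
qed

lemma order_prod_linear:
  fixes S :: "complex set"
  assumes "finite S"
  shows "order r (\<Prod>e\<in>S. [:-e, 1:]) = (if r \<in> S then 1 else 0)"
  using assms
proof (induction S)
  case (insert e S)
  have nz: "[:-e, 1:] * (\<Prod>e\<in>S. [:-e, 1:]) \<noteq> 0"
    unfolding mult_eq_0_iff using insert.hyps(1) by (auto simp: prod_zero_iff)
  have "order r [:-e, 1:] = (if r = e then 1 else 0)"
    using order_power_n_n[of e 1] by (auto intro: order_0I)
  then show ?case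
    unfolding prod.insert[OF insert.hyps(1,2)] order_mult[OF nz] using insert by auto
qed auto

lemma eventually_not_in_finite:
  fixes r :: complex
  assumes "finite F"
  shows "eventually (\<lambda>w. w \<notin> F) (at r)"
proof -
  have "open (- (F - {r}))"
    using assms by (intro open_Compl finite_imp_closed) auto
  then show ?thesis
    unfolding eventually_at_topological by (intro exI[of _ "- (F - {r})"]) auto
qed

text \<open>The residue of the logarithmic derivative is the order. As a limit it covers roots and
  other points alike.\<close>

lemma tendsto_log_deriv_poly:
  fixes F :: "complex poly"
  assumes "F \<noteq> 0"
  shows "((\<lambda>w. (w - r) * (poly (pderiv F) w / poly F w)) \<longlongrightarrow> of_nat (order r F)) (at r)"
proof -
  obtain h where h: "F = [:- r, 1:] ^ order r F * h" "\<not> [:- r, 1:] dvd h"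
    using order_decomp[OF assms] by blast
  define \<mu> where "\<mu> = order r F"
  have hr: "poly h r \<noteq> 0" using h(2) by (simp add: poly_eq_0_iff_dvd)
  have F: "F = [:- r, 1:] ^ \<mu> * h" using h(1) \<mu>_def by simp
  have "((\<lambda>w. of_nat \<mu> + (w - r) * (poly (pderiv h) w / poly h w)) \<longlongrightarrow> of_nat \<mu> + (r - r) * (poly (pderiv h) r / poly h r)) (at r)"
    using hr by (intro tendsto_intros) auto
  moreover have "eventually (\<lambda>w. of_nat \<mu> + (w - r) * (poly (pderiv h) w / poly h w)
      = (w - r) * (poly (pderiv F) w / poly F w)) (at r)"
  proof -
    have "eventually (\<lambda>w. poly h w \<noteq> 0) (at r)"
      using hr by (intro tendsto_imp_eventually_ne[of _ "poly h r"] tendsto_intros)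
    moreover have "eventually (\<lambda>w. w \<noteq> r) (at r)"
      by (simp add: eventually_at_filter)
    ultimately show ?thesis
    proof eventually_elim
      case (elim w)
      have 1: "(w - r) * poly (pderiv F) w
          = (w - r) ^ \<mu> * (of_nat \<mu> * poly h w + (w - r) * poly (pderiv h) w)"
      proof (cases \<mu>)
        case (Suc k)
        show ?thesis
          unfolding F Suc lemma_order_pderiv1 by (simp add: algebra_simps)
      qed (simp add: F)
      have 2: "poly F w = (w - r) ^ \<mu> * poly h w"
        unfolding F by simp
      have "(w - r) * (poly (pderiv F) w / poly F w)
          = (of_nat \<mu> * poly h w + (w - r) * poly (pderiv h) w) / poly h w"
        unfolding times_divide_eq_right 1 unfolding 2 using elim by simp
      then show ?case
        using elim by (simp add: add_divide_distrib)
    qed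
  qed
  ultimately show ?thesis
    unfolding \<mu>_def[symmetric] by (simp add: tendsto_cong)
qed

section \<open>Pullbacks of the hypergeometric equation\<close>

text \<open>The substitution is \<open>p / d\<close> in lowest terms, coprimality over the complex
  numbers being the absence of common roots.\<close>

locale hypergeometric_pullback =
  fixes S :: "complex set" and \<kappa> :: "complex \<Rightarrow> complex" and m q a b c :: complex and p d :: "complex poly"
  assumes finite_S: "finite S"
    and d_nonzero: "d \<noteq> 0"
    and no_common_root: "\<And>r. \<not> (poly p r = 0 \<and> poly d r = 0)"
    and not_both_constant: "degree p \<noteq> 0 \<or> degree d \<noteq> 0"
    and nontrivial: "m \<noteq> 0 \<or> q \<noteq> 0"
    and reduction: "same_ode (subst_ode (hypergeometric_ode a b c) (\<lambda>s. poly p s / poly d s)) (heun_on S \<kappa> m q)"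
begin

definition L :: "complex poly" where "L = (\<Prod>e\<in>S. [:-e, 1:])"

lemma poly_L: "poly L w = (\<Prod>e\<in>S. w - e)"
  by (simp add: L_def poly_prod)

lemma L_nonzero: "L \<noteq> 0"
  using finite_S by (simp add: L_def prod_zero_iff)

lemma order_L: "order r L = (if r \<in> S then 1 else 0)"
  unfolding L_def by (rule order_prod_linear[OF finite_S])

lemma p_nonzero: "p \<noteq> 0"
  using no_common_root not_both_constant no_roots_imp_degree_0[of d] by (metis degree_0 poly_0)

lemma p_minus_d_nonzero: "p - d \<noteq> 0"
  using no_common_root not_both_constant no_roots_imp_degree_0[of d] by auto

text \<open>For R = p/d the derivative is the wronskian over \<open>d^2\<close>, and R (R - 1) = p
  (p - d) / d^2. Clearing denominators leaves a surplus \<open>d^2\<close> on the right, which is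
  what excludes poles below.\<close>

lemma second_coefficient:
  "smult (a * b) ((wronskian p d)^2 * L) = [:-q, m:] * (d^2 * (p * (p - d)))"
proof -
  obtain F where F: "finite F"
    "\<And>s. s \<notin> F \<Longrightarrow> snd (subst_ode (hypergeometric_ode a b c) (\<lambda>s. poly p s / poly d s)) s
      = snd (heun_on S \<kappa> m q) s"
    using reduction unfolding same_ode_def by blast
  let ?G = "F \<union> S \<union> {s. poly d s = 0} \<union> {s. poly p s = 0} \<union> {s. poly (p - d) s = 0}"
  show ?thesis
  proof (rule poly_eq_cofinite)
    show "finite ?G"
      using F(1) finite_S d_nonzero p_nonzero p_minus_d_nonzero by (simp add: poly_roots_finite del: poly_diff)
    fix s assume s: "s \<notin> ?G"
    then have nz: "poly d s \<noteq> 0" "poly p s \<noteq> 0" "poly p s - poly d s \<noteq> 0" "poly L s \<noteq> 0" 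
      using finite_S by (auto simp: poly_L prod_zero_iff)
    have "a * b / (poly p s / poly d s * (poly p s / poly d s - 1)) * (poly (wronskian p d) s / (poly d s)^2)^2
      = (m * s - q) / poly L s"
      using F(2)[of s] s rational_deriv(2)[OF nz(1), of p]
      by (simp add: subst_ode_def hypergeometric_ode_def heun_on_def poly_L)
    moreover have "a * b / (poly p s / poly d s * (poly p s / poly d s - 1)) * (poly (wronskian p d) s / (poly d s)^2)^2
      = a * b * (poly (wronskian p d) s)^2 / (poly p s * (poly p s - poly d s) * (poly d s)^2)"
      using nz by (simp add: divide_simps power2_eq_square)
    ultimately have "a * b * (poly (wronskian p d) s)^2 * poly L s
        = (m * s - q) * (poly p s * (poly p s - poly d s) * (poly d s)^2)"
      using nz by (simp add: frac_eq_eq)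
    then show "poly (smult (a * b) ((wronskian p d)^2 * L)) s = poly ([:-q, m:] * (d^2 * (p * (p - d)))) s"
      by (simp add: algebra_simps)
  qed
qed

lemma rhs_nonzero: "[:-q, m:] * (d^2 * (p * (p - d))) \<noteq> 0"
  using nontrivial d_nonzero p_nonzero p_minus_d_nonzero unfolding mult_eq_0_iff by auto

lemma ab_nonzero: "a * b \<noteq> 0"
  using second_coefficient rhs_nonzero by (metis smult_0_left)

text \<open>
  At a root of order \<open>\<mu>\<close> of the denominator the left side of the identity has order at most
  \<open>2 (\<mu> - 1) + 1\<close>, but the right side has order at least \<open>2 \<mu>\<close>.
\<close>

lemma denominator_constant: "degree d = 0"
proof (rule no_roots_imp_degree_0)
  fix r show "poly d r \<noteq> 0"
  proof
    assume r: "poly d r = 0"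
    then have pr: "poly p r \<noteq> 0" using no_common_root by blast
    note W = order_wronskian[OF d_nonzero r pr]
    have "order r (smult (a * b) ((wronskian p d)^2 * L)) = 2 * order r (wronskian p d) + order r L"
      using ab_nonzero W(1) L_nonzero by (simp add: order_smult order_mult power2_eq_square)
    also have "\<dots> < 2 * order r d"
      using W(2) by (simp add: order_L)
    also have "\<dots> \<le> order r (d^2) + order r ([:-q, m:] * (p * (p - d)))"
      using d_nonzero by (simp add: power2_eq_square order_mult)
    also have "\<dots> = order r (d^2 * ([:-q, m:] * (p * (p - d))))"
      using rhs_nonzero by (intro order_mult[symmetric]) (simp only: mult.left_commute not_False_eq_True)
    finally show False
      unfolding second_coefficient by (simp only: mult_ac)
  qed
qed

end

section \<open>Polynomial pullbacks: the Pell identity and residues\<close>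

text \<open>The assumption \<open>singular\<close> expresses that the points of \<open>S\<close> are
  genuine singularities: if it failed at \<open>e\<close>, the factor \<open>w - e\<close> would
  cancel from both coefficients.\<close>

locale polynomial_reduction =
  fixes S :: "complex set" and \<kappa> :: "complex \<Rightarrow> complex" and m q a b c :: complex and R :: "complex poly"
  assumes card_S: "card S = 3"
    and R_nonconstant: "degree R \<noteq> 0"
    and nontrivial': "m \<noteq> 0 \<or> q \<noteq> 0"
    and poly_reduction: "same_ode (subst_ode (hypergeometric_ode a b c) (poly R)) (heun_on S \<kappa> m q)"
    and singular: "\<And>e. e \<in> S \<Longrightarrow> \<kappa> e \<noteq> 0 \<or> m * e \<noteq> q"
begin

sublocale hypergeometric_pullback S \<kappa> m q a b c R 1
  using card_S R_nonconstant nontrivial' poly_reduction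
  by unfold_locales (auto intro: card_ge_0_finite)

text \<open>The root of the numerator \<open>m * w - q\<close>; \<open>m_nonzero\<close> excludes
  the default value of a division by zero.\<close>

definition t0 :: complex where "t0 = q / m"

definition c' :: complex where "c' = a + b - c + 1"

lemma R_nonzero: "R \<noteq> 0" and R_minus_1_nonzero: "R - 1 \<noteq> 0"
  using p_nonzero p_minus_d_nonzero by auto

lemma pderiv_R_nonzero: "pderiv R \<noteq> 0"
  using R_nonconstant by (simp add: pderiv_eq_0_iff)

lemma pderiv_R_minus_1: "pderiv (R - 1) = pderiv R"
  by (simp add: pderiv_diff)

lemma second_coefficient_poly: "smult (a * b) ((pderiv R)^2 * L) = [:-q, m:] * (R * (R - 1))"
  using second_coefficient by (simp add: wronskian_def)

lemma degree_L: "degree L = 3"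
  using card_S unfolding L_def by (subst degree_prod_eq_sum_degree) auto

lemma degree_R_minus_1: "degree (R - 1) = degree R"
  using R_nonconstant degree_add_eq_left[of "-1" R] by simp

text \<open>Parity of degrees: for \<open>m = 0\<close> the right side has degree 2n and the left
  side 2(n - 1) + 3.\<close>

lemma m_nonzero: "m \<noteq> 0"
proof
  assume "m = 0"
  then have "degree ([:-q, m:] * (R * (R - 1))) = 2 * degree R"
    using nontrivial' R_nonzero R_minus_1_nonzero degree_R_minus_1 by (simp add: degree_mult_eq)
  moreover have "degree (smult (a * b) ((pderiv R)^2 * L)) = 2 * (degree R - 1) + 3"
    using ab_nonzero pderiv_R_nonzero L_nonzero
    by (simp add: degree_mult_eq degree_pderiv degree_L power2_eq_square)
  ultimately show False
    using second_coefficient_poly R_nonconstant by simp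
qed

text \<open>Leading coefficients. The identity reflects that a polynomial of degree n multiplies the
  exponents at infinity by n.\<close>

lemma m_eq: "m = a * b * (of_nat (degree R))^2"
proof -
  have 1: "lead_coeff L = 1"
    unfolding L_def by (simp add: lead_coeff_prod)
  have 2: "lead_coeff (pderiv R) = of_nat (degree R) * lead_coeff R"
    using R_nonconstant by (simp add: degree_pderiv coeff_pderiv)
  have 3: "lead_coeff (R - 1) = lead_coeff R"
    using R_nonconstant degree_R_minus_1 by (simp add: coeff_eq_0)
  have 4: "lead_coeff [:-q, m:] = m"
    using m_nonzero by simp
  have "lead_coeff (smult (a * b) ((pderiv R)^2 * L)) = a * b * (of_nat (degree R) * lead_coeff R)^2"
    by (simp only: lead_coeff_smult lead_coeff_mult power2_eq_square 1 2) simp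
  moreover have "lead_coeff ([:-q, m:] * (R * (R - 1))) = m * (lead_coeff R)^2"
    by (simp only: lead_coeff_mult 3 4 power2_eq_square)
  ultimately have "m * (lead_coeff R)^2 = a * b * (of_nat (degree R) * lead_coeff R)^2"
    unfolding second_coefficient_poly by simp
  then show ?thesis
    using R_nonzero by (simp add: power_mult_distrib)
qed

text \<open>Dividing by \<open>a * b\<close> leaves a condition on \<open>R\<close>,
  \<open>t0\<close> and \<open>L\<close> alone. Chebyshev polynomials satisfy the analogous n^2 (T^2
  - 1) = (x^2 - 1) T'^2, hence the name.\<close>

lemma pell_equation:
  "smult ((of_nat (degree R))^2) ([:-t0, 1:] * (R * (R - 1))) = (pderiv R)^2 * L"
proof -
  have "smult (a * b) (smult ((of_nat (degree R))^2) ([:-t0, 1:] * (R * (R - 1))))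
      = smult m [:-t0, 1:] * (R * (R - 1))"
    by (simp only: m_eq[symmetric] smult_smult mult_smult_left)
  also have "smult m [:-t0, 1:] = [:-q, m:]"
    using m_nonzero by (simp add: t0_def)
  also have "\<dots> * (R * (R - 1)) = smult (a * b) ((pderiv R)^2 * L)"
    by (rule second_coefficient_poly[symmetric])
  finally show ?thesis
    using ab_nonzero by (metis smult_cancel)
qed

lemma order_equation:
  "2 * order r (pderiv R) + (if r \<in> S then 1 else 0)
    = (if r = t0 then 1 else 0) + (order r R + order r (R - 1))"
proof -
  have 1: "order r [:-t0, 1:] = (if r = t0 then 1 else 0)"
    using order_prod_linear[of "{t0}" r] by simp
  have nz: "R * (R - 1) \<noteq> 0" "[:-t0, 1:] * (R * (R - 1)) \<noteq> 0"
    using R_nonzero R_minus_1_nonzero unfolding mult_eq_0_iff by auto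
  have "order r ((pderiv R)^2 * L) = 2 * order r (pderiv R) + (if r \<in> S then 1 else 0)"
    using pderiv_R_nonzero L_nonzero by (simp add: order_mult power2_eq_square order_L)
  moreover have "order r (smult ((of_nat (degree R))^2) ([:-t0, 1:] * (R * (R - 1))))
      = order r ([:-t0, 1:] * (R * (R - 1)))"
    using R_nonconstant by (intro order_smult) simp
  moreover have "\<dots> = (if r = t0 then 1 else 0) + (order r R + order r (R - 1))"
    unfolding order_mult[OF nz(2)] order_mult[OF nz(1)] 1 ..
  ultimately show ?thesis
    unfolding pell_equation by simp
qed

text \<open>The first coefficient of the pullback is a combination, with weights \<open>c\<close>,
  \<open>c'\<close> and -1, of the logarithmic derivatives of \<open>R\<close>, \<open>R - 1\<close>
  and R', so its residues are combinations of orders.\<close>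

lemma residue_equation:
  "c * of_nat (order r R) + c' * of_nat (order r (R - 1)) - of_nat (order r (pderiv R))
    = (if r \<in> S then \<kappa> r else 0)"
proof -
  obtain F where F: "finite F"
    "\<And>s. s \<notin> F \<Longrightarrow> fst (subst_ode (hypergeometric_ode a b c) (poly R)) s = fst (heun_on S \<kappa> m q) s"
    using poly_reduction unfolding same_ode_def by blast
  have dR: "deriv (poly P) = poly (pderiv P)" for P :: "complex poly"
    by (rule ext) (simp add: DERIV_imp_deriv)
  let ?lhs = "\<lambda>w. c * ((w - r) * (poly (pderiv R) w / poly R w))
    + c' * ((w - r) * (poly (pderiv (R - 1)) w / poly (R - 1) w))
    - (w - r) * (poly (pderiv (pderiv R)) w / poly (pderiv R) w)"
  have "(?lhs \<longlongrightarrow> c * of_nat (order r R) + c' * of_nat (order r (R - 1)) - of_nat (order r (pderiv R))) (at r)"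
    by (intro tendsto_intros tendsto_log_deriv_poly R_nonzero R_minus_1_nonzero pderiv_R_nonzero)
  moreover have "(?lhs \<longlongrightarrow> (if r \<in> S then \<kappa> r else 0)) (at r)"
  proof (rule Lim_transform_eventually)
    have summand: "((\<lambda>w. (w - r) * (\<kappa> e / (w - e))) \<longlongrightarrow> (if e = r then \<kappa> e else 0)) (at r)" for e
    proof (cases "e = r")
      case True
      have "((\<lambda>w. \<kappa> e) \<longlongrightarrow> \<kappa> e) (at r)" by simp
      then show ?thesis
        using True by (rule_tac Lim_transform_eventually) (auto simp: eventually_at_filter)
    next
      case False
      have "((\<lambda>w. (w - r) * (\<kappa> e / (w - e))) \<longlongrightarrow> (r - r) * (\<kappa> e / (r - e))) (at r)"
        using False by (intro tendsto_intros) auto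
      then show ?thesis using False by simp
    qed
    have "((\<lambda>w. \<Sum>e\<in>S. (w - r) * (\<kappa> e / (w - e))) \<longlongrightarrow> (\<Sum>e\<in>S. if e = r then \<kappa> e else 0)) (at r)"
      by (intro tendsto_intros summand)
    then show "((\<lambda>w. (w - r) * fst (heun_on S \<kappa> m q) w) \<longlongrightarrow> (if r \<in> S then \<kappa> r else 0)) (at r)"
      using finite_S by (simp add: heun_on_def sum_distrib_left sum.delta')
    have "eventually (\<lambda>w. w \<notin> F) (at r)"
      using eventually_not_in_finite[OF F(1)] .
    then show "eventually (\<lambda>w. (w - r) * fst (heun_on S \<kappa> m q) w = ?lhs w) (at r)"
    proof eventually_elim
      case (elim w)
      \<comment> \<open>This holds for vanishing denominators too, so the roots of \<open>R\<close>,
        \<open>R - 1\<close> and R' need not be excluded.\<close>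
      have distr: "u * ((c / X + c' / Y) * Z - V / Z) = c * (u * (Z / X)) + c' * (u * (Z / Y)) - u * (V / Z)"
        for u X Y Z V :: complex
        by (simp add: algebra_simps)
      have "fst (subst_ode (hypergeometric_ode a b c) (poly R)) w
          = (c / poly R w + c' / poly (R - 1) w) * poly (pderiv R) w
            - poly (pderiv (pderiv R)) w / poly (pderiv R) w"
        by (simp add: subst_ode_def hypergeometric_ode_def dR c'_def)
      then show ?case
        unfolding F(2)[OF elim, symmetric] pderiv_R_minus_1 by (simp only: distr)
    qed
  qed
  ultimately show ?thesis
    by (rule tendsto_unique[rotated]) simp
qed

end

context polynomial_reduction begin

lemma order_at_zero: "poly R r = 0 \<Longrightarrow> order r R = Suc (order r (pderiv R)) \<and> order r (R - 1) = 0"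
  using order_pderiv[OF R_nonzero] by (auto intro: order_0I)

lemma order_at_one: "poly R r = 1 \<Longrightarrow> order r (R - 1) = Suc (order r (pderiv R)) \<and> order r R = 0"
  using order_pderiv[OF R_minus_1_nonzero, of r] by (auto simp: pderiv_R_minus_1 intro: order_0I)

lemma order_elsewhere: "poly R r \<noteq> 0 \<Longrightarrow> poly R r \<noteq> 1 \<Longrightarrow> order r R = 0 \<and> order r (R - 1) = 0"
  by (auto intro: order_0I)

lemma mt0: "m * t0 = q"
  using m_nonzero by (simp add: t0_def)

text \<open>Outside the two fibres the order equation allows only \<open>e = t0\<close>, unramified.
  The residue \<kappa> at \<open>e\<close> is then 0 and the numerator vanishes there, so
  \<open>e\<close> would not be singular.\<close>

lemma poly_R_singular:
  assumes "e \<in> S"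
  shows "poly R e = 0 \<or> poly R e = 1"
proof (rule ccontr)
  assume "\<not> (poly R e = 0 \<or> poly R e = 1)"
  then have ord: "order e R = 0" "order e (R - 1) = 0"
    using order_elsewhere by auto
  have "order e (pderiv R) = 0" and "e = t0"
    using order_equation[of e] ord assms by (auto split: if_splits)
  with residue_equation[of e] ord assms have "\<kappa> e = 0" by simp
  with singular[OF assms] mt0 \<open>e = t0\<close> show False by simp
qed

text \<open>For a nonsingular \<open>t0\<close> outside the two fibres the order equation would
  equate an even number with 1.\<close>

lemma poly_R_t0: "poly R t0 = 0 \<or> poly R t0 = 1"
proof (cases "t0 \<in> S")
  case False
  show ?thesis
  proof (rule ccontr)
    assume "\<not> ?thesis"
    then have "2 * order t0 (pderiv R) = 1"
      using order_equation[of t0] order_elsewhere[of t0] False by auto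
    then show False by presburger
  qed
qed (rule poly_R_singular)

end

section \<open>Shape of R when t0 lies over 0\<close>

text \<open>If \<open>t0\<close> lies over 1 instead, \<open>1 - R\<close> satisfies the same
  assumptions with \<open>c\<close> and \<open>c'\<close> exchanged.\<close>

locale normalized_polynomial_reduction = polynomial_reduction +
  assumes t0_zero: "poly R t0 = 0"
begin

text \<open>The solution of the order equation at \<open>t0\<close>: with order \<mu> for
  \<open>R\<close> and \<mu> - 1 for R', it reads 2(\<mu> - 1) + [t0 in S] = 1 + \<mu>.\<close>

definition \<mu> :: nat where "\<mu> = (if t0 \<in> S then 2 else 3)"

definition J :: "complex set" where "J = {e \<in> S. poly R e = 0} - {t0}"

definition K :: "complex set" where "K = {e \<in> S. poly R e = 1}"

text \<open>The numerator vanishes at \<open>t0\<close>, so a singular \<open>t0\<close> has nonzero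
  parameter \<open>2 * c - 1\<close>. The resulting inequality \<open>c \<noteq> 1/2\<close>
  excludes nonsingular double points in this fibre.\<close>

lemma at_t0:
  shows "order t0 R = \<mu>" "t0 \<notin> S \<Longrightarrow> c = 2/3" "t0 \<in> S \<Longrightarrow> \<kappa> t0 = 2 * c - 1" "c \<noteq> 1/2"
proof -
  have ord: "order t0 R = Suc (order t0 (pderiv R))" "order t0 (R - 1) = 0"
    using order_at_zero[OF t0_zero] by auto
  have \<mu>: "order t0 (pderiv R) = \<mu> - 1"
    using order_equation[of t0] ord by (auto simp: \<mu>_def split: if_splits)
  then show "order t0 R = \<mu>" using ord by (simp add: \<mu>_def)
  have res: "c * of_nat \<mu> - of_nat (\<mu> - 1) = (if t0 \<in> S then \<kappa> t0 else 0)"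
    using residue_equation[of t0] ord \<mu> by (simp add: \<mu>_def split: if_splits)
  show 1: "c = 2/3" if "t0 \<notin> S"
    using res that by (simp add: \<mu>_def field_simps)
  show 2: "\<kappa> t0 = 2 * c - 1" if "t0 \<in> S"
    using res that by (simp add: \<mu>_def field_simps)
  show "c \<noteq> 1/2"
  proof (cases "t0 \<in> S")
    case True
    with 2 singular[of t0] mt0 have "2 * c - 1 \<noteq> 0" by auto
    moreover have "2 * c - 1 = 0" if "c = 1/2" unfolding that by simp
    ultimately show ?thesis by blast
  next
    case False
    show ?thesis unfolding 1[OF False] by simp
  qed
qed

text \<open>A nonsingular point here would have order 2 and vanishing residue
  \<open>2 * c - 1\<close>, contrary to \<open>c \<noteq> 1/2\<close>.\<close>

lemma at_zero:
  assumes "poly R r = 0" "r \<noteq> t0"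
  shows "r \<in> S" "order r R = 1" "\<kappa> r = c"
proof -
  note ord = order_at_zero[OF assms(1)]
  show S: "r \<in> S"
  proof (rule ccontr)
    assume "r \<notin> S"
    with order_equation[of r] ord assms have "order r (pderiv R) = 1" by auto
    with residue_equation[of r] ord \<open>r \<notin> S\<close> have "c * 2 = 1" by simp
    then have "c = 1/2" by (simp add: field_simps)
    with at_t0(4) show False by simp
  qed
  with order_equation[of r] ord assms have "order r (pderiv R) = 0" by auto
  with residue_equation[of r] ord S show "order r R = 1" "\<kappa> r = c" by simp_all
qed

text \<open>In this fibre double points do occur; the vanishing of their residue
  \<open>2 * c' - 1\<close> is the price.\<close>

lemma at_one:
  assumes "poly R r = 1"
  shows "r \<in> S \<Longrightarrow> \<kappa> r = c'" "poly (pderiv R) r = 0 \<Longrightarrow> c' = 1/2"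
proof -
  note ord = order_at_one[OF assms]
  have "r \<noteq> t0" using assms t0_zero by auto
  then have *: "order r (pderiv R) = (if r \<in> S then 0 else 1)"
    using order_equation[of r] ord by (auto split: if_splits)
  then show "\<kappa> r = c'" if "r \<in> S"
    using residue_equation[of r] ord that by simp
  show "c' = 1/2" if "poly (pderiv R) r = 0"
  proof -
    have "order r (pderiv R) \<noteq> 0"
      using that pderiv_R_nonzero order_root by blast
    then have "r \<notin> S" "order r (pderiv R) = 1" using * by (auto split: if_splits)
    with residue_equation[of r] ord have "c' * 2 - 1 = 0" by simp
    then show ?thesis by (simp add: field_simps)
  qed
qed

lemma S_decomposition:
  "S = (if t0 \<in> S then {t0} else {}) \<union> J \<union> K" "t0 \<notin> J" "t0 \<notin> K" "J \<inter> K = {}" "finite J" "finite K"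
  using poly_R_singular t0_zero finite_S unfolding J_def K_def by auto

abbreviation P :: "complex set \<Rightarrow> complex poly" where
  "P X \<equiv> \<Prod>e\<in>X. [:-e, 1:]"

abbreviation Z :: "complex poly" where
  "Z \<equiv> [:-t0, 1:]"

text \<open>The cofactor of the derivative of \<open>R\<close> after removing \<open>C\<close> and
  the root \<open>t0\<close>. Its roots are the double points over 1.\<close>

definition U :: "complex poly" where
  "U = smult (of_nat \<mu>) (P J) + Z * pderiv (P J)"

definition C :: complex where "C = lead_coeff R"

lemma C_nonzero: "C \<noteq> 0"
  using R_nonzero by (simp add: C_def)

lemma R_eq: "R = smult C (Z ^ \<mu> * P J)"
proof -
  have "{z. poly R z = 0} = insert t0 J"
    using at_zero(1) t0_zero by (auto simp: J_def)
  then have "R = smult C (\<Prod>z\<in>insert t0 J. [:-z, 1:] ^ order z R)"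
    using complex_poly_decompose[of R] by (simp add: C_def)
  also have "(\<Prod>z\<in>insert t0 J. [:-z, 1:] ^ order z R) = Z ^ \<mu> * (\<Prod>z\<in>J. [:-z, 1:] ^ order z R)"
    using S_decomposition by (simp add: at_t0)
  also have "(\<Prod>z\<in>J. [:-z, 1:] ^ order z R) = P J"
    by (intro prod.cong) (auto simp: J_def at_zero)
  finally show ?thesis .
qed

lemma pderiv_R_eq: "pderiv R = smult C (Z ^ (\<mu> - 1) * U)"
proof -
  have "\<mu> \<noteq> 0" by (simp add: \<mu>_def)
  then obtain k where k: "\<mu> = Suc k" using not0_implies_Suc by blast
  have "pderiv R = pderiv (smult C (Z ^ Suc k * P J))"
    using arg_cong[OF R_eq, of pderiv] unfolding k .
  then show ?thesis
    unfolding pderiv_smult U_def k lemma_order_pderiv1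
    by (simp only: diff_Suc_1 distrib_left mult_smult_right power_Suc mult_ac add.commute)
qed

lemma degree_R: "degree R = \<mu> + card J"
proof -
  have "degree (P J) = card J"
    by (subst degree_prod_eq_sum_degree) auto
  moreover have "P J \<noteq> 0" "Z ^ \<mu> \<noteq> 0"
    using S_decomposition by (auto simp: prod_zero_iff)
  ultimately have "degree (smult C (Z ^ \<mu> * P J)) = \<mu> + card J"
    using C_nonzero by (simp add: degree_mult_eq degree_linear_power)
  then show ?thesis
    using arg_cong[OF R_eq, of degree] by (rule trans[rotated])
qed

text \<open>The exponent \<open>3 - \<mu>\<close> is 1 if \<open>t0\<close> is singular and 0
  otherwise.\<close>

lemma L_eq: "L = Z ^ (3 - \<mu>) * P J * P K"
proof (cases "t0 \<in> S")
  case True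
  have "L = P (insert t0 (J \<union> K))"
    unfolding L_def using S_decomposition(1) True by (intro prod.cong) auto
  also have "\<dots> = Z * P (J \<union> K)"
    using S_decomposition by (intro prod.insert) auto
  also have "P (J \<union> K) = P J * P K"
    using S_decomposition by (intro prod.union_disjoint) auto
  also have "Z = Z ^ (3 - \<mu>)" using True by (simp add: \<mu>_def)
  finally show ?thesis by (simp only: mult.assoc)
next
  case False
  have "L = P (J \<union> K)"
    unfolding L_def using S_decomposition(1) False by (intro prod.cong) auto
  also have "P (J \<union> K) = P J * P K"
    using S_decomposition by (intro prod.union_disjoint) auto
  finally show ?thesis using False by (simp add: \<mu>_def)
qed

text \<open>With \<open>R\<close>, R' and \<open>L\<close> factored, the Pell identity contains the
  factor \<open>Z ^ (\<mu> + 1) * P J\<close> on both sides; the exponents agree for both values of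
  \<mu>.\<close>

lemma square_identity: "smult ((of_nat (degree R))^2) (R - 1) = smult C (U^2 * P K)"
proof -
  have nz: "Z ^ (\<mu> + 1) * P J \<noteq> 0"
    using S_decomposition by (simp add: prod_zero_iff del: mult_pCons_left)
  have "(Z ^ (\<mu> + 1) * P J) * smult C (smult ((of_nat (degree R))^2) (R - 1))
      = smult ((of_nat (degree R))^2) (Z * (smult C (Z ^ \<mu> * P J) * (R - 1)))"
    by (simp only: mult_smult_left mult_smult_right smult_smult power_add power_one_right mult_ac)
  also have "\<dots> = (smult C (Z ^ (\<mu> - 1) * U))^2 * (Z ^ (3 - \<mu>) * P J * P K)"
    using pell_equation unfolding pderiv_R_eq[symmetric] R_eq[symmetric] L_eq[symmetric] .
  also have "\<dots> = (Z ^ (2 * (\<mu> - 1) + (3 - \<mu>)) * P J) * smult C (smult C (U^2 * P K))"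
    by (simp only: power_add power_mult power2_eq_square mult_smult_left mult_smult_right smult_smult mult_ac
        power_mult_distrib)
  also have "2 * (\<mu> - 1) + (3 - \<mu>) = \<mu> + 1"
    by (simp add: \<mu>_def)
  finally have "smult C (smult ((of_nat (degree R))^2) (R - 1)) = smult C (smult C (U^2 * P K))"
    using nz mult_left_cancel by blast
  then show ?thesis
    using C_nonzero by (metis smult_cancel)
qed

text \<open>The shift to \<open>y = w - t0\<close> puts the ramified point at 0, so that comparing
  coefficients constrains only the differences \<open>e - t0\<close>.\<close>

lemma poly_identity:
  "(of_nat (\<mu> + card J))^2 * (C * y ^ \<mu> * (\<Prod>e\<in>J. y - (e - t0)) - 1)
    = C * (poly U (t0 + y))^2 * (\<Prod>e\<in>K. y - (e - t0))"
proof -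
  have shift: "t0 + y - e = y - (e - t0)" for e by simp
  have "poly (smult ((of_nat (degree R))^2) (R - 1)) (t0 + y) = poly (smult C (U^2 * P K)) (t0 + y)"
    by (simp only: square_identity)
  moreover have "poly R (t0 + y) = C * y ^ \<mu> * (\<Prod>e\<in>J. y - (e - t0))"
    using arg_cong[OF R_eq, of "\<lambda>p. poly p (t0 + y)"] by (simp add: poly_prod shift)
  moreover have "poly (P K) (t0 + y) = (\<Prod>e\<in>K. y - (e - t0))"
    by (simp add: poly_prod shift)
  ultimately show ?thesis
    by (simp only: degree_R poly_smult poly_diff poly_1 poly_mult poly_power mult.assoc)
qed

lemma c'_half:
  assumes "poly U r = 0"
  shows "c' = 1/2"
proof (rule at_one)
  have "poly (smult ((of_nat (degree R))^2) (R - 1)) r = 0"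
    unfolding square_identity using assms by simp
  then show "poly R r = 1" using R_nonconstant by simp
  show "poly (pderiv R) r = 0"
    unfolding pderiv_R_eq using assms by simp
qed

lemma exponents:
  "e \<in> J \<Longrightarrow> \<kappa> e = c" "e \<in> K \<Longrightarrow> \<kappa> e = c'"
  using at_zero(3) at_one(1) by (auto simp: J_def K_def)

end

section \<open>Classification of the polynomial pullbacks\<close>

text \<open>The affine map given by \<open>A\<close> and \<open>B\<close>, applied after
  \<open>1 / (s - d4)\<close>, will be the normalizing transformation. Subcases 2a and 2d speak of
  \<gamma>, \<delta>, \<epsilon> directly; letting these range over all parameters of
  \<open>S\<close> avoids naming an order of the points.\<close>

definition subcase_holds ::
    "subcase \<Rightarrow> complex set \<Rightarrow> (complex \<Rightarrow> complex) \<Rightarrow> complex \<Rightarrow> complex \<Rightarrow> complex \<Rightarrow> bool" where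
  "subcase_holds k S \<kappa> t0 A B \<longleftrightarrow>
     A \<noteq> 0 \<and> (\<lambda>e. A * e + B) ` S = {0, 1, subcase_D k} \<and> A * t0 + B = subcase_ratio k \<and>
     (\<forall>\<gamma>\<in>\<kappa> ` S. \<forall>\<delta>\<in>\<kappa> ` S. \<forall>\<epsilon>\<in>\<kappa> ` S. subcase_exponents k (\<lambda>x. \<kappa> ((x - B) / A)) \<gamma> \<delta> \<epsilon>)"

text \<open>The affine map is the one that sends \<open>e0\<close> to 0 and \<open>e1\<close> to 1;
  \<open>D\<close> and the ratio then become division-free relations between differences.\<close>

lemma subcase_holdsI:
  assumes S: "S = {e0, e1, eD}" and "e0 \<noteq> e1"
    and D: "eD - e0 = subcase_D k * (e1 - e0)"
    and t0: "t0 - e0 = subcase_ratio k * (e1 - e0)"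
    and exps: "\<And>\<kappa>' \<gamma> \<delta> \<epsilon>. \<kappa>' 0 = \<kappa> e0 \<Longrightarrow> \<kappa>' 1 = \<kappa> e1 \<Longrightarrow> \<kappa>' (subcase_D k) = \<kappa> eD \<Longrightarrow>
        \<gamma> \<in> \<kappa> ` S \<Longrightarrow> \<delta> \<in> \<kappa> ` S \<Longrightarrow> \<epsilon> \<in> \<kappa> ` S \<Longrightarrow> subcase_exponents k \<kappa>' \<gamma> \<delta> \<epsilon>"
  shows "\<exists>A B. subcase_holds k S \<kappa> t0 A B"
proof -
  define A where "A = 1 / (e1 - e0)"
  define B where "B = - e0 / (e1 - e0)"
  have A: "A \<noteq> 0" using \<open>e0 \<noteq> e1\<close> by (simp add: A_def)
  have aff: "A * x + B = (x - e0) / (e1 - e0)" for x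
    by (simp add: A_def B_def diff_divide_distrib)
  have img: "A * e0 + B = 0" "A * e1 + B = 1" "A * eD + B = subcase_D k" "A * t0 + B = subcase_ratio k"
    unfolding aff D t0 using \<open>e0 \<noteq> e1\<close> by simp_all
  have inv: "(A * x + B - B) / A = x" for x
    using A by simp
  have "subcase_holds k S \<kappa> t0 A B"
    unfolding subcase_holds_def
  proof (intro conjI ballI)
    show "(\<lambda>e. A * e + B) ` S = {0, 1, subcase_D k}"
      unfolding S by (simp add: img)
    fix \<gamma> \<delta> \<epsilon> assume "\<gamma> \<in> \<kappa> ` S" "\<delta> \<in> \<kappa> ` S" "\<epsilon> \<in> \<kappa> ` S"
    then show "subcase_exponents k (\<lambda>x. \<kappa> ((x - B) / A)) \<gamma> \<delta> \<epsilon>"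
      using inv[of e0] inv[of e1] inv[of eD] unfolding img by (intro exps) simp_all
  qed (use A img in auto)
  then show ?thesis by blast
qed

lemma csqrt_squares:
  "(complex_of_real (sqrt 2))^2 = 2" "(complex_of_real (sqrt 3))^2 = 3" "(complex_of_real (sqrt 15))^2 = 15"
  by (simp_all flip: of_real_power)

lemma square_eq_neg:
  fixes s \<delta> r :: complex
  assumes "s^2 = - (r^2 * \<delta>^2)"
  shows "s = \<i> * r * \<delta> \<or> s = - (\<i> * r * \<delta>)"
proof -
  have "(s - \<i> * r * \<delta>) * (s + \<i> * r * \<delta>) = s^2 - \<i>^2 * (r^2 * \<delta>^2)"
    by (simp add: power2_eq_square algebra_simps)
  also have "\<dots> = 0" using assms by simp
  finally show ?thesis by (auto simp: eq_neg_iff_add_eq_0)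
qed

text \<open>With the first two elementary symmetric functions zero, the differences
  \<open>e - t0\<close> are the cube roots of one number: an equilateral triangle with centre
  \<open>t0\<close>. The two orientations are interchanged by swapping \<open>e1\<close> and
  \<open>e2\<close>, and the ratio is the centroid \<open>(1 + D) / 3\<close>.\<close>

lemma equilateral_subcase:
  fixes e1 e2 e3 t0 :: complex
  assumes S: "S = {e1, e2, e3}" and ne: "e1 \<noteq> e2"
    and x: "(e1 - t0) + (e2 - t0) + (e3 - t0) = 0"
      "(e1 - t0) * (e2 - t0) + (e1 - t0) * (e3 - t0) + (e2 - t0) * (e3 - t0) = 0"
    and k: "subcase_D k = 1/2 + \<i> * (sqrt 3 / 2)" "subcase_ratio k = 1/2 + \<i> * (sqrt 3 / 6)"
    and exps: "\<And>\<kappa>' \<gamma> \<delta> \<epsilon>. \<gamma> \<in> \<kappa> ` S \<Longrightarrow> \<delta> \<in> \<kappa> ` S \<Longrightarrow> \<epsilon> \<in> \<kappa> ` S \<Longrightarrow> subcase_exponents k \<kappa>' \<gamma> \<delta> \<epsilon>"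
  shows "\<exists>A B. subcase_holds k S \<kappa> t0 A B"
proof -
  have *: "\<exists>A B. subcase_holds k S \<kappa> t0 A B"
    if "S = {e0, e1, eD}" "e0 \<noteq> e1" "(e0 - t0) + (e1 - t0) + (eD - t0) = 0"
      "2 * eD - e1 - e0 = \<i> * sqrt 3 * (e1 - e0)" for e0 e1 eD
  proof (rule subcase_holdsI[OF that(1,2)])
    show "eD - e0 = subcase_D k * (e1 - e0)"
      using that(4) unfolding k of_real_divide of_real_numeral by (simp add: field_simps)
    moreover have "3 * (t0 - e0) = (e1 - e0) + (eD - e0)"
      using that(3) by (simp add: algebra_simps)
    ultimately have "t0 - e0 = (1 + subcase_D k) / 3 * (e1 - e0)"
      by (simp add: field_simps)
    also have "(1 + subcase_D k) / 3 = subcase_ratio k"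
      unfolding k by (simp add: field_simps)
    finally show "t0 - e0 = subcase_ratio k * (e1 - e0)" .
  qed (rule exps)
  have "(2 * e3 - e2 - e1)^2 = - ((complex_of_real (sqrt 3))^2 * (e2 - e1)^2)"
    unfolding csqrt_squares using x by algebra
  then consider "2 * e3 - e2 - e1 = \<i> * sqrt 3 * (e2 - e1)" | "2 * e3 - e2 - e1 = - (\<i> * sqrt 3 * (e2 - e1))"
    using square_eq_neg by blast
  then show ?thesis
  proof cases
    case 1
    show ?thesis by (rule *[OF S ne]) (use x 1 in simp_all)
  next
    case 2
    have "S = {e2, e1, e3}" "e2 \<noteq> e1" using S ne by auto
    then show ?thesis by (rule *) (use x 2 in \<open>simp_all add: algebra_simps\<close>)
  qed
qed

text \<open>The midpoint of \<open>p\<close> and \<open>q\<close> is t0 + (\<nu>/2)(s - t0), and s -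
  t0 = \<plusminus> i r (q - p). Sending \<open>p\<close>, \<open>q\<close> to 0, 1 puts the images
  of \<open>s\<close> and \<open>t0\<close> on the line with real part 1/2; exchanging
  \<open>p\<close> and \<open>q\<close> settles the sign.\<close>

lemma isosceles_subcase:
  fixes p q s t0 r \<nu> :: complex
  assumes S: "S = {p, q, s}" and ne: "p \<noteq> q"
    and sum: "(p - t0) + (q - t0) = \<nu> * (s - t0)"
    and diff: "(s - t0)^2 = - (r^2 * (q - p)^2)"
    and k: "subcase_D k = 1/2 + \<i> * ((1 - \<nu> / 2) * r)" "subcase_ratio k = 1/2 - \<i> * (\<nu> / 2 * r)"
    and exps: "\<And>\<kappa>' \<gamma> \<delta> \<epsilon>. {\<kappa>' 0, \<kappa>' 1} \<subseteq> {\<kappa> p, \<kappa> q} \<Longrightarrow> \<kappa>' (subcase_D k) = \<kappa> s \<Longrightarrow>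
        subcase_exponents k \<kappa>' \<gamma> \<delta> \<epsilon>"
  shows "\<exists>A B. subcase_holds k S \<kappa> t0 A B"
proof -
  have *: "\<exists>A B. subcase_holds k S \<kappa> t0 A B"
    if e: "S = {e0, e1, s}" "e0 \<noteq> e1" "(e0 - t0) + (e1 - t0) = \<nu> * (s - t0)"
      "s - t0 = \<i> * r * (e1 - e0)" "{e0, e1} = {p, q}" for e0 e1
  proof (rule subcase_holdsI[OF that(1,2)])
    have 1: "2 * (t0 - e0) = (e1 - e0) - \<nu> * (\<i> * r * (e1 - e0))"
      using e(3) unfolding e(4) by (simp add: algebra_simps)
    then show "t0 - e0 = subcase_ratio k * (e1 - e0)"
      unfolding k by (simp add: field_simps)
    have "2 * (s - e0) = 2 * (\<i> * r * (e1 - e0)) + 2 * (t0 - e0)"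
      unfolding e(4)[symmetric] by simp
    with 1 show "s - e0 = subcase_D k * (e1 - e0)"
      unfolding k by (simp add: field_simps)
    show "subcase_exponents k \<kappa>' \<gamma> \<delta> \<epsilon>" if "\<kappa>' 0 = \<kappa> e0" "\<kappa>' 1 = \<kappa> e1" "\<kappa>' (subcase_D k) = \<kappa> s" for \<kappa>' \<gamma> \<delta> \<epsilon>
      using that e(5) by (intro exps) auto
  qed
  consider "s - t0 = \<i> * r * (q - p)" | "s - t0 = - (\<i> * r * (q - p))"
    using square_eq_neg[OF diff] by blast
  then show ?thesis
  proof cases
    case 1
    show ?thesis by (rule *[OF S ne sum 1]) simp
  next
    case 2
    have "S = {q, p, s}" "q \<noteq> p" using S ne by auto
    moreover have "(q - t0) + (p - t0) = \<nu> * (s - t0)" using sum by (simp add: add.commute)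
    moreover have "s - t0 = \<i> * r * (p - q)" using 2 by (simp add: algebra_simps)
    ultimately show ?thesis by (rule *) auto
  qed
qed


lemma poly_coeffs_zero:
  fixes p :: "complex poly"
  assumes "\<And>y. poly p y = 0"
  shows "p = 0"
  using assms poly_all_0_iff_0 by blast

section \<open>Comparison of coefficients in the seven cases\<close>

context normalized_polynomial_reduction begin

lemma poly_U: "poly U (t0 + y) = of_nat \<mu> * poly (P J) (t0 + y) + y * poly (pderiv (P J)) (t0 + y)"
  by (simp add: U_def algebra_simps)

lemma sum_of_cards: "card J + card K + (if t0 \<in> S then 1 else 0) = 3"
proof -
  have "card S = card ((if t0 \<in> S then {t0} else {}) \<union> (J \<union> K))"
    using S_decomposition(1) by (metis Un_assoc)
  also have "\<dots> = card (if t0 \<in> S then {t0} else {} :: complex set) + card (J \<union> K)"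
    using S_decomposition by (intro card_Un_disjoint) auto
  also have "card (J \<union> K) = card J + card K"
    using S_decomposition by (intro card_Un_disjoint) auto
  finally show ?thesis using card_S by auto
qed

text \<open>Here \<open>R\<close> is \<open>C * y^3\<close> and \<open>U\<close> is constant, so the
  singular points are the cube roots of \<open>1 / C\<close> around \<open>t0\<close>, and
  \<open>c'\<close> stays free.\<close>

lemma case_triple_0:
  assumes "t0 \<notin> S" "J = {}"
  shows "\<exists>k A B. subcase_holds k S \<kappa> t0 A B"
proof -
  have "card K = 3" using sum_of_cards assms by simp
  then obtain e1 e2 e3 where K: "K = {e1, e2, e3}" and ne: "e1 \<noteq> e2" "e1 \<noteq> e3" "e2 \<noteq> e3"
    by (auto simp: card_3_iff)
  have \<mu>: "\<mu> = 3" using assms by (simp add: \<mu>_def)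
  define x1 x2 x3 where x: "x1 = e1 - t0" "x2 = e2 - t0" "x3 = e3 - t0"
  have id: "9 * (C * y^3 - 1) = C * 9 * ((y - x1) * (y - x2) * (y - x3))" for y
    using poly_identity[of y] ne poly_U[of y] unfolding assms(2) K \<mu> x by (simp add: mult_ac)
  \<comment> \<open>The difference of the two sides of \<open>id\<close>, written by its
    coefficients; the leading terms cancel. The later cases proceed in the same way.\<close>
  have "[: -9 + 9 * C * x1 * x2 * x3, - 9 * C * (x1 * x2 + x1 * x3 + x2 * x3), 9 * C * (x1 + x2 + x3) :] = 0"
  proof (rule poly_coeffs_zero, unfold poly_pCons poly_0, goal_cases)
    case (1 y)
    show ?case using id[of y] by algebra
  qed
  then have *: "x1 * x2 + x1 * x3 + x2 * x3 = 0" "x1 + x2 + x3 = 0"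
    using C_nonzero by auto
  have S: "S = {e1, e2, e3}"
    using S_decomposition(1) assms K by simp
  have "\<exists>A B. subcase_holds Case2a S \<kappa> t0 A B"
  proof (rule equilateral_subcase[OF S ne(1)])
    show "subcase_exponents Case2a \<kappa>' \<gamma> \<delta> \<epsilon>"
      if "\<gamma> \<in> \<kappa> ` S" "\<delta> \<in> \<kappa> ` S" "\<epsilon> \<in> \<kappa> ` S" for \<kappa>' \<gamma> \<delta> \<epsilon>
    proof -
      have "\<kappa> e = c'" if "e \<in> S" for e
        using that equalityD1[OF trans[OF S K[symmetric]]] exponents(2) by (meson subsetD)
      then show ?thesis using that by auto
    qed
  qed (use * in \<open>simp_all add: x\<close>)
  then show ?thesis by blast
qed

text \<open>A quartic with a triple and a simple zero. The root of the linear \<open>U\<close> makes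
  \<open>c' = 1/2\<close>; the coefficients of y^3 and y^2 determine the triangle.\<close>

lemma case_triple_1:
  assumes "t0 \<notin> S" "J = {s}"
  shows "\<exists>k A B. subcase_holds k S \<kappa> t0 A B"
proof -
  have "card K = 2" using sum_of_cards assms by simp
  then obtain p q' where K: "K = {p, q'}" and ne: "p \<noteq> q'"
    by (auto simp: card_2_iff)
  have \<mu>: "\<mu> = 3" using assms by (simp add: \<mu>_def)
  define x1 x2 x3 where x: "x1 = p - t0" "x2 = q' - t0" "x3 = s - t0"
  have U: "poly U (t0 + y) = 4 * y - 3 * x3" for y
    using poly_U[of y] unfolding assms(2) \<mu> x by (simp add: pderiv_pCons algebra_simps)
  have id: "16 * (C * y^3 * (y - x3) - 1) = C * (4 * y - 3 * x3)^2 * ((y - x1) * (y - x2))" for y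
    using poly_identity[of y] ne unfolding U assms(2) K \<mu> x by simp
  have "[: -16 - 9 * C * x3^2 * x1 * x2, C * (24 * x3 * x1 * x2 + 9 * x3^2 * (x1 + x2)),
      - C * (16 * x1 * x2 + 24 * x3 * (x1 + x2) + 9 * x3^2), C * (16 * (x1 + x2) + 8 * x3) :] = 0"
  proof (rule poly_coeffs_zero, unfold poly_pCons poly_0, goal_cases)
    case (1 y)
    show ?case using id[of y] by algebra
  qed
  then have *: "16 * (x1 + x2) + 8 * x3 = 0" "16 * x1 * x2 + 24 * x3 * (x1 + x2) + 9 * x3^2 = 0"
    using C_nonzero by auto
  have S: "S = {p, q', s}"
    using S_decomposition(1) assms K by auto
  have "c' = 1/2"
    using U[of "3 * x3 / 4"] by (intro c'_half) auto
  then have \<kappa>: "\<kappa> p = 1/2" "\<kappa> q' = 1/2" "\<kappa> s = 2/3"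
    using exponents at_t0(2) assms K by auto
  have "\<exists>A B. subcase_holds Case2b S \<kappa> t0 A B"
  proof (rule isosceles_subcase[OF S ne, where \<nu> = "- 1/2" and r = "complex_of_real (sqrt 2)"])
    show "p - t0 + (q' - t0) = - 1 / 2 * (s - t0)"
      unfolding x[symmetric] using *(1) by (simp add: field_simps) algebra
    have "(x3)^2 = - (2 * (x2 - x1)^2)"
      using * by algebra
    then show "(s - t0)\<^sup>2 = - ((complex_of_real (sqrt 2))\<^sup>2 * (q' - p)\<^sup>2)"
      unfolding csqrt_squares x by simp
  qed (use \<kappa> in auto)
  then show ?thesis by blast
qed

text \<open>A quintic whose quadratic \<open>U\<close> supplies double points over 1. The
  coefficients of y^4 and y^3 already determine the triangle.\<close>

lemma case_triple_2:
  assumes "t0 \<notin> S" "J = {p, q'}" "p \<noteq> q'"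
  shows "\<exists>k A B. subcase_holds k S \<kappa> t0 A B"
proof -
  have "card K = 1" using sum_of_cards assms by simp
  then obtain s where K: "K = {s}"
    by (auto simp: card_1_singleton_iff)
  have \<mu>: "\<mu> = 3" using assms by (simp add: \<mu>_def)
  define x1 x2 x3 where x: "x1 = p - t0" "x2 = q' - t0" "x3 = s - t0"
  have U: "poly U (t0 + y) = 5 * y^2 - 4 * (x1 + x2) * y + 3 * x1 * x2" for y
    using poly_U[of y] assms(3) unfolding assms(2) \<mu> x
    by (simp add: pderiv_pCons pderiv_mult algebra_simps power2_eq_square)
  have id: "25 * (C * y^3 * ((y - x1) * (y - x2)) - 1)
      = C * (5 * y^2 - 4 * (x1 + x2) * y + 3 * x1 * x2)^2 * (y - x3)" for y
    using poly_identity[of y] assms(3) unfolding U assms(2) K \<mu> x by simp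
  have "[: -25 + 9 * C * (x1 * x2)^2 * x3, - C * (9 * (x1 * x2)^2 + 24 * (x1 + x2) * x3 * x1 * x2),
      C * (24 * (x1 + x2) * x1 * x2 + x3 * (16 * (x1 + x2)^2 + 30 * x1 * x2)),
      - C * (5 * x1 * x2 + 16 * (x1 + x2)^2 + 40 * (x1 + x2) * x3), C * (15 * (x1 + x2) + 25 * x3) :] = 0"
  proof (rule poly_coeffs_zero, unfold poly_pCons poly_0, goal_cases)
    case (1 y)
    show ?case using id[of y] by algebra
  qed
  then have *: "15 * (x1 + x2) + 25 * x3 = 0" "5 * x1 * x2 + 16 * (x1 + x2)^2 + 40 * (x1 + x2) * x3 = 0"
    using C_nonzero by auto
  have S: "S = {p, q', s}"
    using S_decomposition(1) assms K by auto
  \<comment> \<open>One root of \<open>U\<close> suffices for \<open>c' = 1/2\<close>; it exists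
    because the leading coefficient 5 rules out a constant.\<close>
  have "\<exists>r. poly U r = 0"
  proof (rule ccontr)
    assume "\<nexists>r. poly U r = 0"
    then have "degree U = 0" by (intro no_roots_imp_degree_0) blast
    then obtain u where "U = [:u:]" using degree_0_id by metis
    then have "poly [:3 * x1 * x2 - u, - 4 * (x1 + x2), 5:] y = 0" for y
      using U[of y] by (simp add: algebra_simps power2_eq_square)
    then have "[:3 * x1 * x2 - u, - 4 * (x1 + x2), 5:] = 0" by (rule poly_coeffs_zero)
    then show False by simp
  qed
  then have "c' = 1/2" using c'_half by blast
  then have \<kappa>: "\<kappa> p = 2/3" "\<kappa> q' = 2/3" "\<kappa> s = 1/2"
    using exponents at_t0(2) assms K by auto
  have "\<exists>A B. subcase_holds Case2c S \<kappa> t0 A B"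
  proof (rule isosceles_subcase[OF S assms(3), where \<nu> = "- 5/3" and r = "complex_of_real (sqrt 15) / 15"])
    show "p - t0 + (q' - t0) = - 5 / 3 * (s - t0)"
      unfolding x[symmetric] using *(1) by (simp add: field_simps) algebra
    have "15 * (x3)^2 = - ((x2 - x1)^2)"
      using * by algebra
    then show "(s - t0)\<^sup>2 = - ((complex_of_real (sqrt 15) / 15)\<^sup>2 * (q' - p)\<^sup>2)"
      unfolding csqrt_squares x power_divide by (simp add: field_simps)
  qed (use \<kappa> in auto)
  then show ?thesis by blast
qed

text \<open>A sextic with \<open>R - 1\<close> a multiple of a square. The coefficients of y^5 and
  y^4 make \<open>R\<close> quadratic in y^3, so this is the cubic of subcase 2a followed by a
  quadratic map.\<close>

lemma case_triple_3:
  assumes "t0 \<notin> S" "J = {e1, e2, e3}" and ne: "e1 \<noteq> e2" "e1 \<noteq> e3" "e2 \<noteq> e3"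
  shows "\<exists>k A B. subcase_holds k S \<kappa> t0 A B"
proof -
  have "card K = 0" using sum_of_cards assms by simp
  then have K: "K = {}" using S_decomposition by simp
  have \<mu>: "\<mu> = 3" using assms by (simp add: \<mu>_def)
  define x1 x2 x3 where x: "x1 = e1 - t0" "x2 = e2 - t0" "x3 = e3 - t0"
  have xnz: "x1 * x2 * x3 \<noteq> 0" using S_decomposition(2) unfolding assms(2) x by auto
  define \<sigma>1 \<sigma>2 \<sigma>3 where \<sigma>: "\<sigma>1 = x1 + x2 + x3" "\<sigma>2 = x1 * x2 + x1 * x3 + x2 * x3" "\<sigma>3 = x1 * x2 * x3"
  have U: "poly U (t0 + y) = 6 * y^3 - 5 * \<sigma>1 * y^2 + 4 * \<sigma>2 * y - 3 * \<sigma>3" for y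
  proof -
    have PJ: "P J = [:-e1, 1:] * ([:-e2, 1:] * [:-e3, 1:])"
      unfolding assms(2) using ne by simp
    have "poly (pderiv (P J)) (t0 + y) = (y - x2) * (y - x3) + (y - x1) * (y - x3) + (y - x1) * (y - x2)"
      unfolding PJ pderiv_mult x by (simp add: pderiv_pCons) algebra
    moreover have "poly (P J) (t0 + y) = (y - x1) * (y - x2) * (y - x3)"
      unfolding PJ x by simp algebra
    ultimately show ?thesis
      unfolding poly_U \<mu> \<sigma> of_nat_numeral by algebra
  qed
  have id: "36 * (C * y^3 * ((y - x1) * ((y - x2) * (y - x3))) - 1)
      = C * (6 * y^3 - 5 * \<sigma>1 * y^2 + 4 * \<sigma>2 * y - 3 * \<sigma>3)^2" for y
    using poly_identity[of y] ne unfolding U assms(2) K \<mu> x by simp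
  have "(y - x1) * ((y - x2) * (y - x3)) = y^3 - \<sigma>1 * y^2 + \<sigma>2 * y - \<sigma>3" for y
    unfolding \<sigma> by algebra
  note id = id[unfolded this]
  have "[: -36 - 9 * C * \<sigma>3^2, 24 * C * \<sigma>2 * \<sigma>3, - C * (16 * \<sigma>2^2 + 30 * \<sigma>1 * \<sigma>3),
      C * (40 * \<sigma>1 * \<sigma>2), C * (- 12 * \<sigma>2 - 25 * \<sigma>1^2), C * 24 * \<sigma>1 :] = 0"
  proof (rule poly_coeffs_zero, unfold poly_pCons poly_0, goal_cases)
    case (1 y)
    show ?case using id[of y] by algebra
  qed
  then have *: "\<sigma>1 = 0" "\<sigma>2 = 0"
    using C_nonzero by auto
  have S: "S = {e1, e2, e3}"
    using S_decomposition(1) assms K by auto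
  have "\<exists>A B. subcase_holds Case2d S \<kappa> t0 A B"
  proof (rule equilateral_subcase[OF S ne(1)])
    show "subcase_exponents Case2d \<kappa>' \<gamma> \<delta> \<epsilon>"
      if "\<gamma> \<in> \<kappa> ` S" "\<delta> \<in> \<kappa> ` S" "\<epsilon> \<in> \<kappa> ` S" for \<kappa>' \<gamma> \<delta> \<epsilon>
    proof -
      have "\<kappa> e = 2/3" if "e \<in> S" for e
        using that equalityD1[OF trans[OF S assms(2)[symmetric]]] exponents(1) at_t0(2)[OF assms(1)]
        by (metis subsetD)
      then show ?thesis using that by auto
    qed
  qed (use * in \<open>simp_all add: x \<sigma>\<close>)
  then show ?thesis by blast
qed

text \<open>Here \<open>R\<close> is \<open>C * y^2\<close>: the other two points are opposite with
  respect to \<open>t0\<close> and share the parameter \<open>c'\<close>.\<close>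

lemma case_double_0:
  assumes "t0 \<in> S" "J = {}"
  shows "\<exists>k A B. subcase_holds k S \<kappa> t0 A B"
proof -
  have "card K = 2" using sum_of_cards assms by simp
  then obtain p q' where K: "K = {p, q'}" and ne: "p \<noteq> q'"
    by (auto simp: card_2_iff)
  have \<mu>: "\<mu> = 2" using assms by (simp add: \<mu>_def)
  define x1 x2 where x: "x1 = p - t0" "x2 = q' - t0"
  have id: "4 * (C * y^2 - 1) = C * 4 * ((y - x1) * (y - x2))" for y
    using poly_identity[of y] ne poly_U[of y] unfolding assms(2) K \<mu> x by simp
  have "[: -4 - 4 * C * x1 * x2, 4 * C * (x1 + x2) :] = 0"
  proof (rule poly_coeffs_zero, unfold poly_pCons poly_0, goal_cases)
    case (1 y)
    show ?case using id[of y] by algebra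
  qed
  then have *: "x1 + x2 = 0"
    using C_nonzero by auto
  have S: "S = {p, t0, q'}" and "p \<noteq> t0"
    using S_decomposition(1,3) assms K by auto
  have "\<exists>A B. subcase_holds Case1a S \<kappa> t0 A B"
  proof (rule subcase_holdsI[OF S \<open>p \<noteq> t0\<close>])
    show "q' - p = subcase_D Case1a * (t0 - p)"
      using * unfolding x by (simp add: algebra_simps)
    show "subcase_exponents Case1a \<kappa>' \<gamma> \<delta> \<epsilon>"
      if "\<kappa>' 0 = \<kappa> p" "\<kappa>' (subcase_D Case1a) = \<kappa> q'" for \<kappa>' \<gamma> \<delta> \<epsilon>
      using that exponents(2) K by simp
  qed simp
  then show ?thesis by blast
qed

text \<open>The y^2 coefficient gives \<open>x2 = - 3 * x1\<close>. Up to scale \<open>p\<close>,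
  \<open>t0\<close>, \<open>s\<close> lie at -1, 0, 3, whence \<open>D = 4\<close>.\<close>

lemma case_double_1:
  assumes "t0 \<in> S" "J = {s}"
  shows "\<exists>k A B. subcase_holds k S \<kappa> t0 A B"
proof -
  have "card K = 1" using sum_of_cards assms by simp
  then obtain p where K: "K = {p}"
    by (auto simp: card_1_singleton_iff)
  have \<mu>: "\<mu> = 2" using assms by (simp add: \<mu>_def)
  define x1 x2 where x: "x1 = p - t0" "x2 = s - t0"
  have U: "poly U (t0 + y) = 3 * y - 2 * x2" for y
    using poly_U[of y] unfolding assms(2) \<mu> x by (simp add: pderiv_pCons algebra_simps)
  have id: "9 * (C * y^2 * (y - x2) - 1) = C * (3 * y - 2 * x2)^2 * (y - x1)" for y
    using poly_identity[of y] unfolding U assms(2) K \<mu> x by simp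
  have "[: -9 + 4 * C * x2^2 * x1, - C * (4 * x2^2 + 12 * x1 * x2), C * (3 * x2 + 9 * x1) :] = 0"
  proof (rule poly_coeffs_zero, unfold poly_pCons poly_0, goal_cases)
    case (1 y)
    show ?case using id[of y] by algebra
  qed
  then have *: "3 * x2 + 9 * x1 = 0"
    using C_nonzero by auto
  have S: "S = {p, t0, s}" and "p \<noteq> t0"
    using S_decomposition(1,3) assms K by auto
  have "c' = 1/2"
    using U[of "2 * x2 / 3"] by (intro c'_half) auto
  then have \<kappa>: "\<kappa> p = 1/2" "\<kappa> s = c" "\<kappa> t0 = 2 * c - 1"
    using exponents at_t0(3) assms K by auto
  have "\<exists>A B. subcase_holds Case1b S \<kappa> t0 A B"
  proof (rule subcase_holdsI[OF S \<open>p \<noteq> t0\<close>])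
    show "s - p = subcase_D Case1b * (t0 - p)"
      using * unfolding x by (simp add: algebra_simps) algebra
    show "subcase_exponents Case1b \<kappa>' \<gamma> \<delta> \<epsilon>"
      if "\<kappa>' 0 = \<kappa> p" "\<kappa>' 1 = \<kappa> t0" "\<kappa>' (subcase_D Case1b) = \<kappa> s" for \<kappa>' \<gamma> \<delta> \<epsilon>
      using that \<kappa> by simp
  qed simp
  then show ?thesis by blast
qed

text \<open>The y^3 coefficient makes the outer points opposite, as in subcase 1a. They now lie in
  the fibre of \<open>t0\<close>, so their common parameter \<open>c\<close> also determines that of
  \<open>t0\<close>.\<close>

lemma case_double_2:
  assumes "t0 \<in> S" "J = {p, q'}" "p \<noteq> q'"
  shows "\<exists>k A B. subcase_holds k S \<kappa> t0 A B"
proof -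
  have "card K = 0" using sum_of_cards assms by simp
  then have K: "K = {}" using S_decomposition by simp
  have \<mu>: "\<mu> = 2" using assms by (simp add: \<mu>_def)
  define x1 x2 where x: "x1 = p - t0" "x2 = q' - t0"
  have U: "poly U (t0 + y) = 4 * y^2 - 3 * (x1 + x2) * y + 2 * x1 * x2" for y
    using poly_U[of y] assms(3) unfolding assms(2) \<mu> x
    by (simp add: pderiv_pCons pderiv_mult algebra_simps power2_eq_square)
  have id: "16 * (C * y^2 * ((y - x1) * (y - x2)) - 1)
      = C * (4 * y^2 - 3 * (x1 + x2) * y + 2 * x1 * x2)^2" for y
    using poly_identity[of y] assms(3) unfolding U assms(2) K \<mu> x by simp
  have "[: -16 - 4 * C * (x1 * x2)^2, 12 * C * (x1 + x2) * x1 * x2,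
      - 9 * C * (x1 + x2)^2, 8 * C * (x1 + x2) :] = 0"
  proof (rule poly_coeffs_zero, unfold poly_pCons poly_0, goal_cases)
    case (1 y)
    show ?case using id[of y] by algebra
  qed
  then have *: "x1 + x2 = 0"
    using C_nonzero by auto
  have S: "S = {p, t0, q'}" and "p \<noteq> t0"
    using S_decomposition(1,2) assms K by auto
  have \<kappa>: "\<kappa> p = c" "\<kappa> q' = c" "\<kappa> t0 = 2 * c - 1"
    using exponents at_t0(3) assms by auto
  have "\<exists>A B. subcase_holds Case1c S \<kappa> t0 A B"
  proof (rule subcase_holdsI[OF S \<open>p \<noteq> t0\<close>])
    show "q' - p = subcase_D Case1c * (t0 - p)"
      using * unfolding x by (simp add: algebra_simps)
    show "subcase_exponents Case1c \<kappa>' \<gamma> \<delta> \<epsilon>"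
      if "\<kappa>' 0 = \<kappa> p" "\<kappa>' 1 = \<kappa> t0" "\<kappa>' (subcase_D Case1c) = \<kappa> q'" for \<kappa>' \<gamma> \<delta> \<epsilon>
      using that \<kappa> by simp
  qed simp
  then show ?thesis by blast
qed

lemma classification: "\<exists>k A B. subcase_holds k S \<kappa> t0 A B"
proof -
  have "card J = 0 \<or> card J = 1 \<or> card J = 2 \<or> card J = 3 \<and> t0 \<notin> S"
    using sum_of_cards by (auto split: if_splits)
  then consider "J = {}" | s where "J = {s}" | p q' where "J = {p, q'}" "p \<noteq> q'"
    | e1 e2 e3 where "t0 \<notin> S" "J = {e1, e2, e3}" "e1 \<noteq> e2" "e1 \<noteq> e3" "e2 \<noteq> e3"
    using S_decomposition(5) by (auto simp: card_1_singleton_iff card_2_iff card_3_iff)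
  then show ?thesis
  proof cases
    case 1 then show ?thesis using case_triple_0 case_double_0 by blast
  next
    case 2 then show ?thesis using case_triple_1 case_double_1 by blast
  next
    case 3 then show ?thesis using case_triple_2 case_double_2 by blast
  next
    case 4 then show ?thesis using case_triple_3 by blast
  qed
qed

end

text \<open>The reflection \<open>z \<mapsto> 1 - z\<close> exchanges the singular points 0 and 1.
  The equality is literal, since the conventional values at the poles agree as well.\<close>

lemma subst_ode_hypergeometric_reflect:
  "subst_ode (hypergeometric_ode a b (a + b - c + 1)) (poly (1 - R)) = subst_ode (hypergeometric_ode a b c) (poly R)"
proof -
  have d: "deriv (poly P) = poly (pderiv P)" for P :: "complex poly"
    by (rule ext) (simp add: DERIV_imp_deriv)
  have 1: "(x / (1 - z) + y / (1 - z - 1)) * (- w) - (- u) / (- w) = (y / z + x / (z - 1)) * w - u / w"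
    for x y z w u :: complex
    by (cases "z = 0"; cases "z = 1"; cases "w = 0") (simp_all add: field_simps)
  have 2: "x / ((1 - z) * (1 - z - 1)) * (- w)^2 = x / (z * (z - 1)) * w^2" for x z w :: complex
    by (simp add: algebra_simps)
  show ?thesis
    unfolding subst_ode_def hypergeometric_ode_def fst_conv snd_conv d pderiv_diff pderiv_minus poly_diff poly_minus
    using 1[of "a + b - c + 1" _ c] 2[of "a * b"] by (simp add: pderiv_diff pderiv_minus)
qed

context polynomial_reduction begin

lemma classification: "\<exists>k A B. subcase_holds k S \<kappa> (q / m) A B"
proof (cases "poly R t0 = 0")
  case True
  then interpret normalized_polynomial_reduction S \<kappa> m q a b c R
    by unfold_locales
  show ?thesis using classification by (simp add: t0_def)
next
  case False
  interpret flipped: polynomial_reduction S \<kappa> m q a b "a + b - c + 1" "1 - R"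
  proof
    show "degree (1 - R) \<noteq> 0"
      using degree_R_minus_1 R_nonconstant by (metis degree_minus minus_diff_eq)
    show "same_ode (subst_ode (hypergeometric_ode a b (a + b - c + 1)) (poly (1 - R))) (heun_on S \<kappa> m q)"
      unfolding subst_ode_hypergeometric_reflect by (rule poly_reduction)
  qed (use card_S nontrivial' singular in auto)
  interpret flipped: normalized_polynomial_reduction S \<kappa> m q a b "a + b - c + 1" "1 - R"
    by unfold_locales (use False poly_R_t0 in simp)
  show ?thesis using flipped.classification by (simp add: t0_def)
qed

end

section \<open>From rational substitutions in s to polynomials in w\<close>

lemma rational_normal_form:
  fixes p q :: "complex poly"
  assumes "q \<noteq> 0" "\<nexists>k. p = smult k q"
  obtains p1 q1 where "q1 \<noteq> 0" "\<And>r. \<not> (poly p1 r = 0 \<and> poly q1 r = 0)" "degree p1 \<noteq> 0 \<or> degree q1 \<noteq> 0"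
    "\<And>s. poly q s \<noteq> 0 \<Longrightarrow> poly p s / poly q s = poly p1 s / poly q1 s"
proof -
  obtain p1 q1 g where *: "p = p1 * g" "q = q1 * g" "\<And>r. \<not> (poly p1 r = 0 \<and> poly q1 r = 0)"
    using cancel_common_roots[OF assms(1), of p] by blast
  have "q1 \<noteq> 0" using * assms by auto
  moreover have "degree p1 \<noteq> 0 \<or> degree q1 \<noteq> 0"
  proof (rule ccontr)
    assume "\<not> ?thesis"
    then obtain x y where xy: "p1 = [:x:]" "q1 = [:y:]"
      by (metis degree_eq_zeroE)
    with \<open>q1 \<noteq> 0\<close> have "p = smult (x / y) q" by (simp add: *)
    with assms(2) show False by blast
  qed
  ultimately show thesis using * by (intro that[of q1 p1]) auto
qed

text \<open>A root of \<open>q\<close> is a pole, which survives in the derivative; without one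
  \<open>q\<close> is constant and \<open>p\<close> is not.\<close>

lemma wronskian_nonzero:
  assumes "q \<noteq> 0" "\<And>r. \<not> (poly p r = 0 \<and> poly q r = 0)" "degree p \<noteq> 0 \<or> degree q \<noteq> 0"
  shows "wronskian p q \<noteq> 0"
proof (cases "\<exists>r. poly q r = 0")
  case True
  then show ?thesis using assms(2) order_wronskian(1)[OF assms(1)] by blast
next
  case False
  then have "degree q = 0" using no_roots_imp_degree_0 by blast
  then have "pderiv q = 0" "pderiv p \<noteq> 0" using assms(3) by (auto simp: pderiv_eq_0_iff)
  then show ?thesis using assms(1) by (simp add: wronskian_def)
qed

lemma poly_recip_coord:
  "\<exists>P n. \<forall>s. s \<noteq> d \<longrightarrow> poly p (recip_coord d A B s) = poly P s / (s - d) ^ n"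
proof (induction p)
  case (pCons a p)
  then obtain P n where P: "\<And>s. s \<noteq> d \<Longrightarrow> poly p (recip_coord d A B s) = poly P s / (s - d) ^ n"
    by blast
  show ?case
  proof (intro exI[of _ "smult a ([:-d, 1:] ^ Suc n) + [:A - B * d, B:] * P"] exI[of _ "Suc n"] allI impI)
    fix s assume s: "s \<noteq> d"
    have "poly (pCons a p) (recip_coord d A B s) = a + (A / (s - d) + B) * (poly P s / (s - d) ^ n)"
      using P[OF s] by (simp add: recip_coord_def)
    also have "\<dots> = (a * (s - d) ^ Suc n + (A + B * (s - d)) * poly P s) / (s - d) ^ Suc n"
      using s by (simp add: field_simps)
    also have "\<dots> = poly (smult a ([:-d, 1:] ^ Suc n) + [:A - B * d, B:] * P) s / (s - d) ^ Suc n"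
      by (simp add: algebra_simps)
    finally show "poly (pCons a p) (recip_coord d A B s)
      = poly (smult a ([:-d, 1:] ^ Suc n) + [:A - B * d, B:] * P) s / (s - d) ^ Suc n" .
  qed
qed (auto intro: exI[of _ 0])

text \<open>Away from its pole the coordinate takes every value except \<open>B\<close>.\<close>

lemma poly_eq_on_recip_coord:
  assumes "A \<noteq> 0" "\<And>s. s \<noteq> d \<Longrightarrow> poly p (recip_coord d A B s) = poly q (recip_coord d A B s)"
  shows "p = q"
proof (rule poly_eq_cofinite)
  fix x assume "x \<notin> {B}"
  then have "recip_coord d A B (d + A / (x - B)) = x" "d + A / (x - B) \<noteq> d"
    using assms(1) by (auto simp: recip_coord_def)
  then show "poly p x = poly q x" using assms(2) by metis
qed simp

lemma rational_recip_coord: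
  fixes p q :: "complex poly"
  assumes "A \<noteq> 0" "q \<noteq> 0" "\<nexists>k. p = smult k q"
  obtains P Q where "Q \<noteq> 0" "\<nexists>k. P = smult k Q"
    "\<And>s. s \<noteq> d \<Longrightarrow> poly p (recip_coord d A B s) / poly q (recip_coord d A B s) = poly P s / poly Q s"
proof -
  obtain P1 n where P1: "\<And>s. s \<noteq> d \<Longrightarrow> poly p (recip_coord d A B s) = poly P1 s / (s - d) ^ n"
    using poly_recip_coord by metis
  obtain Q1 l where Q1: "\<And>s. s \<noteq> d \<Longrightarrow> poly q (recip_coord d A B s) = poly Q1 s / (s - d) ^ l"
    using poly_recip_coord by metis
  define P Q where "P = P1 * [:-d, 1:] ^ l" and "Q = Q1 * [:-d, 1:] ^ n"
  have "Q1 \<noteq> 0"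
  proof
    assume "Q1 = 0"
    then have "q = 0" using Q1 by (intro poly_eq_on_recip_coord[OF assms(1), of d _ B]) simp
    with assms(2) show False by simp
  qed
  then have "Q \<noteq> 0" by (simp add: Q_def)
  moreover have "\<nexists>k. P = smult k Q"
  proof
    assume "\<exists>k. P = smult k Q"
    then obtain k where k: "P = smult k Q" by blast
    have "p = smult k q"
    proof (rule poly_eq_on_recip_coord[OF assms(1), of d _ B])
      fix s assume s: "s \<noteq> d"
      have "poly P1 s * (s - d) ^ l = k * (poly Q1 s * (s - d) ^ n)"
        using arg_cong[OF k, of "\<lambda>p. poly p s"] by (simp add: P_def Q_def)
      then show "poly p (recip_coord d A B s) = poly (smult k q) (recip_coord d A B s)"
        unfolding poly_smult P1[OF s] Q1[OF s] using s by (simp add: field_simps)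
    qed
    with assms(3) show False by blast
  qed
  moreover have "poly p (recip_coord d A B s) / poly q (recip_coord d A B s) = poly P s / poly Q s"
    if "s \<noteq> d" for s
    unfolding P1[OF that] Q1[OF that] divide_divide_times_eq by (simp add: P_def Q_def)
  ultimately show thesis by (intro that)
qed

lemma subst_ode_recip_coord_compose:
  assumes "A \<noteq> 0" "finite G" "\<And>z. z \<notin> G \<Longrightarrow> R analytic_on {z} \<and> deriv R z \<noteq> 0"
  shows "same_ode (subst_ode E (R \<circ> recip_coord d A B)) (subst_ode (subst_ode E R) (recip_coord d A B))"
proof (rule subst_ode_compose[OF _ _ inj_recip_coord[OF assms(1)] assms(2,3)])
  show "finite {d}" by simp
  show "recip_coord d A B analytic_on {s} \<and> deriv (recip_coord d A B) s \<noteq> 0" if "s \<notin> {d}" for s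
    using that assms(1) recip_coord_deriv[of s d A B] by simp
qed

lemma subst_ode_id: "subst_ode E (\<lambda>w. w) = E"
proof -
  have 1: "deriv (\<lambda>w::complex. w) = (\<lambda>w. 1)" by (rule ext) (simp add: DERIV_imp_deriv)
  have 2: "deriv (\<lambda>w::complex. 1 :: complex) = (\<lambda>w. 0)" by simp
  show ?thesis unfolding subst_ode_def 1 2 by simp
qed

lemma general_heun_same_ode_heun_on:
  fixes x1 x2 x3 :: complex
  assumes "x1 = recip_coord d4 A B d1" "x2 = recip_coord d4 A B d2" "x3 = recip_coord d4 A B d3"
    and "A \<noteq> 0" "distinct [d1, d2, d3, d4]"
    and "\<alpha> + \<beta> - \<kappa> x1 - \<kappa> x2 - \<kappa> x3 + 1 = 0"
    and "q'' = (q - \<alpha> * \<beta> * B) / A * ((d4 - d1) * (d4 - d2) * (d4 - d3))"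
  shows "same_ode (subst_ode (heun_on {x1, x2, x3} \<kappa> (\<alpha> * \<beta>) q) (recip_coord d4 A B))
      (general_heun_ode d1 d2 d3 d4 (\<kappa> x1) (\<kappa> x2) (\<kappa> x3) \<alpha> \<beta> q'')"
  unfolding same_ode_def
  by (intro exI[of _ "{d1, d2, d3, d4}"]) (use heun_on_coefficients_at[OF assms(1-5) _ assms(6,7)] in auto)

lemma heun_on_of_general_heun:
  assumes E: "same_ode (subst_ode (heun_on S \<kappa> m q) (recip_coord d 1 0)) E"
  shows "same_ode (subst_ode E (recip_coord 0 1 d)) (heun_on S \<kappa> m q)"
proof -
  \<comment> \<open>At 0 the convention \<open>1 / 0 = 0\<close> gives first \<open>d\<close> and
    then 0 again, so the composition is the identity on the whole plane.\<close>
  have inv: "recip_coord d 1 0 \<circ> recip_coord 0 1 d = (\<lambda>w. w)"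
    by (rule ext) (simp add: recip_coord_def)
  have "same_ode (subst_ode (heun_on S \<kappa> m q) (recip_coord d 1 0 \<circ> recip_coord 0 1 d))
      (subst_ode (subst_ode (heun_on S \<kappa> m q) (recip_coord d 1 0)) (recip_coord 0 1 d))"
  proof (rule subst_ode_recip_coord_compose)
    show "recip_coord d 1 0 analytic_on {z} \<and> deriv (recip_coord d 1 0) z \<noteq> 0" if "z \<notin> {d}" for z
      using that recip_coord_deriv[of z d 1 0] by simp
  qed auto
  then have "same_ode (heun_on S \<kappa> m q) (subst_ode (subst_ode (heun_on S \<kappa> m q) (recip_coord d 1 0)) (recip_coord 0 1 d))"
    unfolding inv subst_ode_id .
  also have "same_ode \<dots> (subst_ode E (recip_coord 0 1 d))"
    by (intro same_ode_subst_ode E inj_recip_coord) simp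
  finally show ?thesis by (rule same_ode_sym)
qed

text \<open>Fractions are reduced twice: in \<open>s\<close>, so that the derivative vanishes only
  finitely often and the chain rule applies, and in \<open>w\<close>, where the reduced denominator
  must be constant.\<close>

lemma reducible_imp_subcase_holds:
  assumes "reducible_to_hypergeometric E"
    and "same_ode (subst_ode (heun_on S \<kappa> m q) (recip_coord d 1 0)) E"
    and "card S = 3" "m \<noteq> 0 \<or> q \<noteq> 0" "\<And>e. e \<in> S \<Longrightarrow> \<kappa> e \<noteq> 0 \<or> m * e \<noteq> q"
  shows "m \<noteq> 0 \<and> (\<exists>k A B. subcase_holds k S \<kappa> (q / m) A B)"
proof -
  obtain R a b c p0 q0 where R: "q0 \<noteq> 0" "\<nexists>k. p0 = smult k q0" "R = (\<lambda>s. poly p0 s / poly q0 s)"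
    and red: "same_ode (subst_ode (hypergeometric_ode a b c) R) E"
    using assms(1) unfolding reducible_to_hypergeometric_def nonconstant_rational_def
    by (elim exE conjE) (rule that; (assumption | simp))
  let ?H = "hypergeometric_ode a b c"
  obtain p1 q1 where 1: "q1 \<noteq> 0" "\<And>r. \<not> (poly p1 r = 0 \<and> poly q1 r = 0)" "degree p1 \<noteq> 0 \<or> degree q1 \<noteq> 0"
    "\<And>s. poly q0 s \<noteq> 0 \<Longrightarrow> poly p0 s / poly q0 s = poly p1 s / poly q1 s"
    by (rule rational_normal_form[OF R(1,2)]) (rule that; (assumption | simp))
  define R1 where "R1 = (\<lambda>s. poly p1 s / poly q1 s)"
  have "same_ode (subst_ode ?H R1) (subst_ode ?H R)"
    by (rule subst_ode_cong_off_finite[of "{s. poly q0 s = 0}"])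
      (use R(1) 1(4) in \<open>auto simp: R(3) R1_def poly_roots_finite\<close>)
  then have red1: "same_ode (subst_ode ?H R1) E"
    using red by (rule same_ode_trans)
  have nonconst1: "\<nexists>k. p1 = smult k q1"
  proof
    assume "\<exists>k. p1 = smult k q1"
    then obtain k where k: "p1 = smult k q1" by blast
    then have "poly q1 r \<noteq> 0" for r using 1(2)[of r] by auto
    then have "degree q1 = 0" by (rule no_roots_imp_degree_0)
    with 1(3) k show False by (simp split: if_splits)
  qed
  obtain P Q where PQ: "Q \<noteq> 0" "\<nexists>k. P = smult k Q"
    "\<And>s. s \<noteq> 0 \<Longrightarrow> poly p1 (recip_coord 0 1 d s) / poly q1 (recip_coord 0 1 d s) = poly P s / poly Q s"
    by (rule rational_recip_coord[OF one_neq_zero 1(1) nonconst1, where d = 0 and B = d]) (rule that; (assumption | simp))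
  obtain P1 Q1 where 2: "Q1 \<noteq> 0" "\<And>r. \<not> (poly P1 r = 0 \<and> poly Q1 r = 0)" "degree P1 \<noteq> 0 \<or> degree Q1 \<noteq> 0"
    "\<And>s. poly Q s \<noteq> 0 \<Longrightarrow> poly P s / poly Q s = poly P1 s / poly Q1 s"
    by (rule rational_normal_form[OF PQ(1,2)]) (rule that; (assumption | simp))
  let ?N = "recip_coord 0 1 d"
  have "same_ode (subst_ode ?H (\<lambda>s. poly P1 s / poly Q1 s)) (subst_ode ?H (R1 \<circ> ?N))"
    by (rule subst_ode_cong_off_finite[of "{0} \<union> {s. poly Q s = 0}"])
      (use PQ 2(4) in \<open>auto simp: R1_def poly_roots_finite\<close>)
  also have "same_ode (subst_ode ?H (R1 \<circ> ?N)) (subst_ode (subst_ode ?H R1) ?N)"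
  proof (rule subst_ode_recip_coord_compose)
    show "finite ({s. poly q1 s = 0} \<union> {s. poly (wronskian p1 q1) s = 0})"
      using 1(1) wronskian_nonzero[OF 1(1-3)] by (simp add: poly_roots_finite)
    show "R1 analytic_on {z} \<and> deriv R1 z \<noteq> 0"
      if "z \<notin> {s. poly q1 s = 0} \<union> {s. poly (wronskian p1 q1) s = 0}" for z
      using that rational_deriv[of q1 z p1] by (simp add: R1_def)
  qed simp
  also have "same_ode \<dots> (subst_ode E ?N)"
    by (intro same_ode_subst_ode red1 inj_recip_coord) simp
  also have "same_ode \<dots> (heun_on S \<kappa> m q)"
    by (rule heun_on_of_general_heun) fact
  finally have pullback: "same_ode (subst_ode ?H (\<lambda>s. poly P1 s / poly Q1 s)) (heun_on S \<kappa> m q)" .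
  interpret pullback: hypergeometric_pullback S \<kappa> m q a b c P1 Q1
    using assms(3,4) 2 pullback by unfold_locales (auto intro: card_ge_0_finite)
  obtain u where u: "Q1 = [:u:]" "u \<noteq> 0"
    using pullback.denominator_constant pullback.d_nonzero by (metis degree_eq_zeroE pCons_0_0)
  have "degree P1 \<noteq> 0" using 2(3) u by simp
  have eq: "(\<lambda>s. poly P1 s / poly Q1 s) = poly (smult (1 / u) P1)"
    by (rule ext) (simp add: u)
  interpret reduced: polynomial_reduction S \<kappa> m q a b c "smult (1 / u) P1"
    by unfold_locales (use assms(3-5) pullback \<open>degree P1 \<noteq> 0\<close> u(2) in \<open>simp_all add: eq\<close>)
  show ?thesis using reduced.m_nonzero reduced.classification by blast
qed

section \<open>The normalizing Moebius transformation\<close>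

text \<open>If both alternatives failed, the numerator would contain the factor
  \<open>s - d1\<close>, and cancelling it would extend both coefficients analytically.\<close>

lemma singular_point_imp:
  assumes "distinct [d1, d2, d3, d4]" "singular_point (general_heun_ode d1 d2 d3 d4 \<gamma> \<delta> \<epsilon> \<alpha> \<beta> q'') d1"
  shows "\<gamma> \<noteq> 0 \<or> \<alpha> * \<beta> * ((d4 - d1) * (d4 - d2) * (d4 - d3)) \<noteq> q'' * (d1 - d4)"
proof (rule ccontr)
  assume "\<not> ?thesis"
  then have \<gamma>: "\<gamma> = 0" and num: "\<alpha> * \<beta> * ((d4 - d1) * (d4 - d2) * (d4 - d3)) = q'' * (d1 - d4)"
    by auto
  let ?f = "\<lambda>s. \<delta> / (s - d2) + \<epsilon> / (s - d3) + (1 - \<alpha> - \<beta>) / (s - d4)"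
  let ?g = "\<lambda>s. - q'' / ((s - d2) * (s - d3) * (s - d4)^2)"
  have "?f analytic_on {d1}" "?g analytic_on {d1}"
    using assms(1) by (auto intro!: analytic_intros)
  moreover have "eventually (\<lambda>s. fst (general_heun_ode d1 d2 d3 d4 \<gamma> \<delta> \<epsilon> \<alpha> \<beta> q'') s = ?f s \<and>
      snd (general_heun_ode d1 d2 d3 d4 \<gamma> \<delta> \<epsilon> \<alpha> \<beta> q'') s = ?g s) (at d1)"
    using eventually_not_in_finite[of "{d1, d2, d3, d4}" d1, simplified]
  proof eventually_elim
    case (elim s)
    have "q'' * (d1 - d4) / (s - d4) - q'' = - q'' * (s - d1) / (s - d4)"
      using elim by (simp add: field_simps)
    then have "(q'' * (d1 - d4) / (s - d4) - q'') / ((s - d1) * (s - d2) * (s - d3) * (s - d4)) = ?g s"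
      using elim by (simp add: divide_simps power2_eq_square)
    then show ?case
      by (simp add: general_heun_ode_def \<gamma> num)
  qed
  ultimately show False
    using assms(2) unfolding ordinary_point_def by blast
qed

lemma general_heun_ode_swap:
  "general_heun_ode d1 d2 d3 d4 \<gamma> \<delta> \<epsilon> \<alpha> \<beta> q'' = general_heun_ode d2 d1 d3 d4 \<delta> \<gamma> \<epsilon> \<alpha> \<beta> q''"
  "general_heun_ode d1 d2 d3 d4 \<gamma> \<delta> \<epsilon> \<alpha> \<beta> q'' = general_heun_ode d3 d2 d1 d4 \<epsilon> \<delta> \<gamma> \<alpha> \<beta> q''"
  by (simp_all add: general_heun_ode_def add_ac mult_ac)

lemma general_heun_ode_accessory_unique:
  assumes "distinct [d1, d2, d3, d4]"
    and "same_ode (general_heun_ode d1 d2 d3 d4 \<gamma> \<delta> \<epsilon> \<alpha> \<beta> q) (general_heun_ode d1 d2 d3 d4 \<gamma> \<delta> \<epsilon> \<alpha> \<beta> q')"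
  shows "q = q'"
proof -
  obtain F where F: "finite F"
    "\<And>s. s \<notin> F \<Longrightarrow> snd (general_heun_ode d1 d2 d3 d4 \<gamma> \<delta> \<epsilon> \<alpha> \<beta> q) s
        = snd (general_heun_ode d1 d2 d3 d4 \<gamma> \<delta> \<epsilon> \<alpha> \<beta> q') s"
    using assms(2) unfolding same_ode_def by blast
  have "finite (F \<union> {d1, d2, d3, d4})" using F(1) by simp
  then obtain s where "s \<notin> F \<union> {d1, d2, d3, d4}"
    using ex_new_if_finite[OF infinite_UNIV_char_0[where 'a = complex]] by blast
  with F(2)[of s] show ?thesis by (simp add: general_heun_ode_def)
qed

text \<open>The coefficients come from A/(s - d) + B = (B s + A - B d)/(s - d).\<close>

definition pole_moebius :: "complex \<Rightarrow> complex \<Rightarrow> complex \<Rightarrow> riemann_sphere \<Rightarrow> riemann_sphere" where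
  "pole_moebius d A B = sphere_moebius B (A - B * d) 1 (- d)"

lemma pole_moebius_simps:
  "s \<noteq> d \<Longrightarrow> pole_moebius d A B (Fin s) = Fin (recip_coord d A B s)"
  "pole_moebius d A B (Fin d) = Infty"
  "pole_moebius d A B Infty = Fin B"
  by (auto simp: pole_moebius_def sphere_moebius_def moebius_def recip_coord_def field_simps)

lemma is_moebius_pole_moebius: "A \<noteq> 0 \<Longrightarrow> is_moebius (pole_moebius d A B)"
  unfolding is_moebius_def pole_moebius_def
  by (intro exI[of _ B] exI[of _ "A - B * d"] exI[of _ 1] exI[of _ "- d"]) auto

lemma inj_pole_moebius:
  assumes "A \<noteq> 0"
  shows "inj (pole_moebius d A B)"
proof (rule injI)
  have ne: "recip_coord d A B s \<noteq> B" if "s \<noteq> d" for s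
    using that assms by (simp add: recip_coord_def)
  fix x y assume *: "pole_moebius d A B x = pole_moebius d A B y"
  have cases: "(\<exists>s. s \<noteq> d \<and> x = Fin s) \<or> x = Fin d \<or> x = Infty" for x
    by (cases x) auto
  show "x = y"
    using * cases[of x] cases[of y] ne ne[symmetric] injD[OF inj_recip_coord[OF assms]]
    by (auto simp: pole_moebius_simps)
qed

lemma moebius_with_pole:
  assumes "is_moebius M" "M (Fin d) = Infty"
  obtains A B where "A \<noteq> 0" "M = pole_moebius d A B"
proof -
  obtain a b c e where *: "a * e - b * c \<noteq> 0" "M = sphere_moebius a b c e"
    using assms(1) unfolding is_moebius_def by blast
  have "c * d + e = 0"
    using assms(2) unfolding * sphere_moebius_def by (simp split: if_splits)
  then have e: "e = - (c * d)" by (simp add: add_eq_0_iff2)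
  with * have c: "c \<noteq> 0" by auto
  have "M x = pole_moebius d ((b + a * d) / c) (a / c) x" for x
  proof (cases x)
    case (Fin s)
    show ?thesis
    proof (cases "s = d")
      case False
      have ce: "c * s + e = c * (s - d)" by (simp add: e algebra_simps)
      have "(a * s + b) / (c * (s - d)) = (a * (s - d) + (b + a * d)) / (c * (s - d))"
        by (simp add: algebra_simps)
      also have "\<dots> = (b + a * d) / c / (s - d) + a / c"
        using False c by (simp add: add_divide_distrib)
      finally have pole: "c * s + e \<noteq> 0" "(a * s + b) / (c * s + e) = (b + a * d) / c / (s - d) + a / c"
        unfolding ce using False c by simp_all
      show ?thesis
        using pole unfolding * Fin pole_moebius_simps(1)[OF False]
        by (simp add: sphere_moebius_def moebius_def recip_coord_def)
    qed (use assms(2) Fin in \<open>simp add: pole_moebius_simps\<close>)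
  next
    case Infty
    then show ?thesis using c by (simp add: * sphere_moebius_def pole_moebius_simps)
  qed
  then have "M = pole_moebius d ((b + a * d) / c) (a / c)" by (rule ext)
  moreover have "a * e - b * c = - (c * (b + a * d))" by (simp add: e algebra_simps)
  then have "(b + a * d) / c \<noteq> 0" using * c by auto
  ultimately show thesis by (intro that)
qed

lemma recip_coord_affine: "recip_coord d A B s = A * recip_coord d 1 0 s + B"
  by (simp add: recip_coord_def)

lemma normalizing_pole_moebius_iff:
  assumes "distinct [d1, d2, d3, d4]" "A \<noteq> 0"
  shows "normalizing_moebius d1 d2 d3 d4 D (pole_moebius d4 A B) \<longleftrightarrow>
    recip_coord d4 A B ` {d1, d2, d3} = {0, 1, D}"
proof -
  have "pole_moebius d4 A B ` {Fin d1, Fin d2, Fin d3} = Fin ` (recip_coord d4 A B ` {d1, d2, d3})"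
    using assms(1) by (simp add: pole_moebius_simps)
  moreover have "{Fin 0, Fin 1, Fin D} = Fin ` {0, 1, D}" by simp
  moreover have "inj Fin" by (simp add: inj_def)
  ultimately show ?thesis
    unfolding normalizing_moebius_def
    using is_moebius_pole_moebius[OF assms(2)] by (simp add: pole_moebius_simps inj_image_eq_iff del: image_insert)
qed

lemma exponent_param_pole_moebius:
  assumes "distinct [d1, d2, d3, d4]" "A \<noteq> 0"
  shows "exponent_param d1 d2 d3 \<gamma> \<delta> \<epsilon> (pole_moebius d4 A B) (recip_coord d4 A B d1) = \<gamma>"
    "exponent_param d1 d2 d3 \<gamma> \<delta> \<epsilon> (pole_moebius d4 A B) (recip_coord d4 A B d2) = \<delta>"
    "exponent_param d1 d2 d3 \<gamma> \<delta> \<epsilon> (pole_moebius d4 A B) (recip_coord d4 A B d3) = \<epsilon>"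
proof -
  have "inv (pole_moebius d4 A B) (Fin (recip_coord d4 A B s)) = Fin s" if "s \<noteq> d4" for s
    using inv_f_f[OF inj_pole_moebius[OF assms(2)]] pole_moebius_simps(1)[OF that] by metis
  then show "exponent_param d1 d2 d3 \<gamma> \<delta> \<epsilon> (pole_moebius d4 A B) (recip_coord d4 A B d1) = \<gamma>"
    "exponent_param d1 d2 d3 \<gamma> \<delta> \<epsilon> (pole_moebius d4 A B) (recip_coord d4 A B d2) = \<delta>"
    "exponent_param d1 d2 d3 \<gamma> \<delta> \<epsilon> (pole_moebius d4 A B) (recip_coord d4 A B d3) = \<epsilon>"
    using assms(1) by (auto simp: exponent_param_def)
qed

section \<open>Independence of the accessory value from the normalization\<close>

text \<open>The types correspond to the affine symmetries of 0, 1, \<open>D\<close>: a reflection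
  about the middle point, the rotations of an equilateral triangle, or none. In the first two the
  ratio is the centroid.\<close>

lemma subcase_D_cases:
  obtains "subcase_D k = 2" "subcase_ratio k = 1"
  | "(subcase_D k)^2 - subcase_D k + 1 = 0" "3 * subcase_ratio k = 1 + subcase_D k"
  | "(subcase_D k)^2 - subcase_D k + 1 \<noteq> 0" "subcase_D k \<notin> {-1, 1/2, 2}"
proof -
  have im: "Im (subcase_D Case2b) \<noteq> 0" "Im (subcase_D Case2c) \<noteq> 0" by simp_all
  have real: "z \<notin> {-1, 1/2, 2}" if "Im z \<noteq> 0" for z using that by (auto simp: complex_eq_iff)
  have eq: "(1/2 + z)^2 - (1/2 + z) + 1 = z^2 + 3/4" for z :: complex
    by (simp add: power2_eq_square field_simps)
  have z: "\<i> * complex_of_real (5 * sqrt 2 / 4) = (\<i> * complex_of_real (sqrt 2)) * (5/4)"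
    "\<i> * complex_of_real (11 * sqrt 15 / 90) = (\<i> * complex_of_real (sqrt 15)) * (11/90)"
    "\<i> * complex_of_real (sqrt 3 / 2) = (\<i> * complex_of_real (sqrt 3)) * (1/2)" by simp_all
  have D: "(subcase_D Case2b)^2 - subcase_D Case2b + 1 \<noteq> 0" "(subcase_D Case2c)^2 - subcase_D Case2c + 1 \<noteq> 0"
    unfolding subcase_D.simps eq z power_mult_distrib csqrt_squares power2_i by (simp_all add: power2_eq_square)
  have e: "(1/2 + \<i> * complex_of_real (sqrt 3 / 2))^2 - (1/2 + \<i> * complex_of_real (sqrt 3 / 2)) + 1 = 0"
    unfolding eq z power_mult_distrib csqrt_squares power2_i by (simp add: power2_eq_square)
  show thesis
  proof (cases k)
    case Case2a
    show ?thesis by (rule that(2)) (use e in \<open>simp_all add: Case2a field_simps\<close>)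
  next
    case Case2d
    show ?thesis by (rule that(2)) (use e in \<open>simp_all add: Case2d field_simps\<close>)
  next
    case Case2b
    show ?thesis by (rule that(3)) (use D real[OF im(1)] in \<open>simp_all add: Case2b del: subcase_D.simps\<close>)
  next
    case Case2c
    show ?thesis by (rule that(3)) (use D real[OF im(2)] in \<open>simp_all add: Case2c del: subcase_D.simps\<close>)
  qed (use that in simp_all)
qed

lemma subcase_D_ne: "subcase_D k \<noteq> 0" "subcase_D k \<noteq> 1"
proof -
  have "Re (subcase_D k) \<noteq> 0 \<and> Re (subcase_D k) \<noteq> 1"
    by (cases k) simp_all
  then show "subcase_D k \<noteq> 0" "subcase_D k \<noteq> 1"
    by auto
qed

text \<open>An affine permutation of three points fixes their centroid, which is the ratio for the
  symmetric values of \<open>D\<close>. For the others the permutation is the identity.\<close>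

lemma affine_permutation_fixes_ratio:
  fixes u v :: complex and k :: subcase
  defines "D \<equiv> subcase_D k"
  assumes "{v, u + v, u * D + v} = {0, 1, D}"
  shows "u * subcase_ratio k + v = subcase_ratio k"
proof (rule subcase_D_cases[of k])
  have D01: "D \<noteq> 0" "D \<noteq> 1" using subcase_D_ne by (auto simp: D_def)
  have dist: "v \<noteq> u + v" "v \<noteq> u * D + v" "u + v \<noteq> u * D + v"
  proof -
    have "card {v, u + v, u * D + v} = 3" unfolding assms(2) using D01 by simp
    then show "v \<noteq> u + v" "v \<noteq> u * D + v" "u + v \<noteq> u * D + v"
      by (auto simp: card_insert_if split: if_splits)
  qed
  have sum: "u * (1 + D) + 3 * v = 1 + D"
  proof -
    have "(\<Sum>x\<in>{v, u + v, u * D + v}. x) = (\<Sum>x\<in>{0, 1, D}. x)" unfolding assms(2) ..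
    then show ?thesis using dist D01 by (simp add: algebra_simps)
  qed
  {
    assume "subcase_D k = 2" "subcase_ratio k = 1"
    then have "3 * (u * subcase_ratio k + v) = 3 * subcase_ratio k"
      using sum by (simp add: D_def algebra_simps)
    then show ?thesis by (metis mult_left_cancel zero_neq_numeral)
  next
    assume *: "3 * subcase_ratio k = 1 + subcase_D k"
    have "3 * (u * subcase_ratio k + v) = 3 * subcase_ratio k"
      using sum * unfolding D_def by algebra
    then show ?thesis by (metis mult_left_cancel zero_neq_numeral)
  next
    assume *: "(subcase_D k)^2 - subcase_D k + 1 \<noteq> 0" "subcase_D k \<notin> {-1, 1/2, 2}"
    have "v \<in> {0, 1, D}" "u + v \<in> {0, 1, D}" "u * D + v \<in> {0, 1, D}"
      using assms(2) by blast+
    note mem_uv = this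
    define w where "w = u + v"
    have eq: "(w - v) * D + v = u * D + v" by (simp add: w_def)
    have mem: "v \<in> {0, 1, D}" "w \<in> {0, 1, D}" "(w - v) * D + v \<in> {0, 1, D}"
      and dist': "v \<noteq> w" "v \<noteq> (w - v) * D + v" "w \<noteq> (w - v) * D + v"
      unfolding eq unfolding w_def using mem_uv dist by blast+
    have "D \<noteq> -1" "D \<noteq> 1/2" "D \<noteq> 2" "D * D - D + 1 \<noteq> 0"
      using * by (auto simp: D_def power2_eq_square)
    \<comment> \<open>Each nontrivial affine permutation would force one of the excluded
      equations.\<close>
    then have "D * D \<noteq> 1" "D * D \<noteq> 2 * D" "D * D + 1 \<noteq> D" "2 * D \<noteq> 1"
      using D01 by (auto simp: square_eq_1_iff field_simps)
    note D = this D01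
    have third: "(w - v) * D + v \<in> {0, 1, D} - {v, w}"
      using mem(3) dist'(2,3) by (metis DiffI insertE emptyE)
    consider "v = 0" "w = 1" | "v = 0" "w = D" | "v = 1" "w = 0" | "v = 1" "w = D" | "v = D" "w = 0" | "v = D" "w = 1"
      using mem(1,2) dist'(1) by blast
    then have "w = 1 \<and> v = 0"
    proof cases
      case 2
      with third D show ?thesis by simp
    next
      case 3
      with third have "1 - D = D" by auto
      with D show ?thesis by (simp add: diff_eq_eq)
    next
      case 4
      with third have "(D - 1) * D + 1 = 0" by auto
      then have "D * D + 1 = D" by algebra
      with D show ?thesis by simp
    next
      case 5
      with third have "- D * D + D = 1" by auto
      then have "D * D + 1 = D" by algebra
      with D show ?thesis by simp
    next
      case 6
      with third have "(1 - D) * D + D = 0" by auto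
      then have "D * D = 2 * D" by algebra
      with D show ?thesis by simp
    qed simp
    then have "u = 1 \<and> v = 0"
      by (auto simp: w_def)
    then show ?thesis by simp
  }
qed


lemma subcase_exponents_cong:
  assumes "\<And>x. x \<in> {0, 1, subcase_D k} \<Longrightarrow> \<kappa> x = \<kappa>' x"
  shows "subcase_exponents k \<kappa> \<gamma> \<delta> \<epsilon> \<longleftrightarrow> subcase_exponents k \<kappa>' \<gamma> \<delta> \<epsilon>"
  using assms by (cases k) simp_all



text \<open>The Heun equation in \<open>t\<close> pulls back to the general form with an accessory
  parameter affine in \<open>q\<close>. Since the equation determines that parameter, the
  existential over \<open>q\<close> can be solved.\<close>

lemma accessory_satisfies_iff:
  assumes d: "distinct [d1, d2, d3, d4]" and A: "A \<noteq> 0" and \<alpha>\<beta>: "\<alpha> * \<beta> \<noteq> 0"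
    and fuchs: "\<alpha> + \<beta> - \<gamma> - \<delta> - \<epsilon> + 1 = 0"
    and img: "recip_coord d4 A B ` {d1, d2, d3} = {0, 1, subcase_D k}"
  shows "accessory_satisfies k d1 d2 d3 d4 \<gamma> \<delta> \<epsilon> \<alpha> \<beta> (pole_moebius d4 A B) q'' \<longleftrightarrow>
    q'' = \<alpha> * \<beta> * (subcase_ratio k - B) / A * ((d4 - d1) * (d4 - d2) * (d4 - d3))"
proof -
  define \<kappa> where "\<kappa> = exponent_param d1 d2 d3 \<gamma> \<delta> \<epsilon> (pole_moebius d4 A B)"
  let ?x = "recip_coord d4 A B"
  let ?D = "subcase_D k"
  let ?\<Delta> = "(d4 - d1) * (d4 - d2) * (d4 - d3)"
  note \<kappa> = exponent_param_pole_moebius[OF d A, of \<gamma> \<delta> \<epsilon> B, folded \<kappa>_def]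
  have pullback: "same_ode (subst_ode (heun_ode ?D (\<kappa> 0) (\<kappa> 1) (\<kappa> ?D) \<alpha> \<beta> q) (\<lambda>s. coord (pole_moebius d4 A B (Fin s))))
      (general_heun_ode d1 d2 d3 d4 \<gamma> \<delta> \<epsilon> \<alpha> \<beta> ((q - \<alpha> * \<beta> * B) / A * ?\<Delta>))" for q
  proof -
    have S: "{0, 1, ?D} = {?x d1, ?x d2, ?x d3}" using img by simp
    have 1: "same_ode (subst_ode (heun_ode ?D (\<kappa> 0) (\<kappa> 1) (\<kappa> ?D) \<alpha> \<beta> q) (\<lambda>s. coord (pole_moebius d4 A B (Fin s))))
        (subst_ode (heun_ode ?D (\<kappa> 0) (\<kappa> 1) (\<kappa> ?D) \<alpha> \<beta> q) ?x)"
      \<comment> \<open>At \<open>d4\<close> the transformation takes the value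
        \<open>Infty\<close>, whose \<open>coord\<close> is unspecified.\<close>
      by (rule subst_ode_cong_off_finite[of "{d4}"]) (auto simp: pole_moebius_simps)
    have 2: "heun_ode ?D (\<kappa> 0) (\<kappa> 1) (\<kappa> ?D) \<alpha> \<beta> q = heun_on {?x d1, ?x d2, ?x d3} \<kappa> (\<alpha> * \<beta>) q"
      unfolding S[symmetric] by (rule heun_ode_eq_heun_on[OF subcase_D_ne])
    have 3: "same_ode (subst_ode (heun_ode ?D (\<kappa> 0) (\<kappa> 1) (\<kappa> ?D) \<alpha> \<beta> q) ?x) (general_heun_ode d1 d2 d3 d4 (\<kappa> (?x d1)) (\<kappa> (?x d2)) (\<kappa> (?x d3)) \<alpha> \<beta> ((q - \<alpha> * \<beta> * B) / A * ?\<Delta>))"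
      unfolding 2
      by (rule general_heun_same_ode_heun_on[OF refl refl refl A d _ refl]) (simp only: \<kappa> fuchs)
    from same_ode_trans[OF 1 3] show ?thesis unfolding \<kappa> .
  qed
  have "same_ode (subst_ode (heun_ode ?D (\<kappa> 0) (\<kappa> 1) (\<kappa> ?D) \<alpha> \<beta> q) (\<lambda>s. coord (pole_moebius d4 A B (Fin s))))
      (general_heun_ode d1 d2 d3 d4 \<gamma> \<delta> \<epsilon> \<alpha> \<beta> q'') \<longleftrightarrow> q'' = (q - \<alpha> * \<beta> * B) / A * ?\<Delta>" for q
  proof
    assume "same_ode (subst_ode (heun_ode ?D (\<kappa> 0) (\<kappa> 1) (\<kappa> ?D) \<alpha> \<beta> q) (\<lambda>s. coord (pole_moebius d4 A B (Fin s))))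
      (general_heun_ode d1 d2 d3 d4 \<gamma> \<delta> \<epsilon> \<alpha> \<beta> q'')"
    from same_ode_trans[OF same_ode_sym[OF this] pullback]
    show "q'' = (q - \<alpha> * \<beta> * B) / A * ?\<Delta>"
      by (rule general_heun_ode_accessory_unique[OF d])
  qed (simp only: pullback)
  then have "accessory_satisfies k d1 d2 d3 d4 \<gamma> \<delta> \<epsilon> \<alpha> \<beta> (pole_moebius d4 A B) q'' \<longleftrightarrow>
      (\<exists>q. q'' = (q - \<alpha> * \<beta> * B) / A * ?\<Delta> \<and> q / (\<alpha> * \<beta>) = subcase_ratio k)"
    unfolding accessory_satisfies_def Let_def \<kappa>_def[symmetric] by simp
  also have "\<dots> \<longleftrightarrow> (\<exists>q. q'' = (q - \<alpha> * \<beta> * B) / A * ?\<Delta> \<and> q = subcase_ratio k * (\<alpha> * \<beta>))"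
    using \<alpha>\<beta> by (simp add: divide_eq_eq)
  also have "\<dots> \<longleftrightarrow> q'' = \<alpha> * \<beta> * (subcase_ratio k - B) / A * ?\<Delta>"
  proof -
    have "\<alpha> * \<beta> * (subcase_ratio k - B) = subcase_ratio k * (\<alpha> * \<beta>) - \<alpha> * \<beta> * B"
      by (simp add: algebra_simps)
    then show ?thesis by simp
  qed
  finally show ?thesis .
qed



section \<open>Cross-ratio orbits\<close>

definition orbit_of :: "complex \<Rightarrow> complex set" where
  "orbit_of \<sigma> = {\<sigma>, 1 - \<sigma>, 1 / \<sigma>, 1 / (1 - \<sigma>), \<sigma> / (\<sigma> - 1), (\<sigma> - 1) / \<sigma>}"

lemma orbit_of_compl: "orbit_of (1 - \<sigma>) = orbit_of \<sigma>"
proof -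
  have "(1 - \<sigma>) / (1 - \<sigma> - 1) = (\<sigma> - 1) / \<sigma>" "(1 - \<sigma> - 1) / (1 - \<sigma>) = \<sigma> / (\<sigma> - 1)"
    using minus_divide_divide[of "\<sigma> - 1" \<sigma>] minus_divide_divide[of \<sigma> "\<sigma> - 1"] by simp_all
  then show ?thesis unfolding orbit_of_def by auto
qed

lemma orbit_of_inverse:
  assumes "\<sigma> \<noteq> 0" "\<sigma> \<noteq> 1"
  shows "orbit_of (1 / \<sigma>) = orbit_of \<sigma>"
proof -
  have "1 - 1 / \<sigma> = (\<sigma> - 1) / \<sigma>" "1 / (1 / \<sigma>) = \<sigma>" "1 / (1 - 1 / \<sigma>) = \<sigma> / (\<sigma> - 1)"
    "1 / \<sigma> / (1 / \<sigma> - 1) = 1 / (1 - \<sigma>)" "(1 / \<sigma> - 1) / (1 / \<sigma>) = 1 - \<sigma>"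
    using assms by (simp_all add: divide_simps)
  then show ?thesis unfolding orbit_of_def by auto
qed

lemma standard_orbit_eq: "standard_orbit D = orbit_of (D / (D - 1))"
  by (simp add: cross_ratio_orbit_def orbit_of_def Let_def cross_ratio_def)

text \<open>In this order of arguments the cross-ratio is \<open>D / (D - 1)\<close>; inversion,
  complement and inversion lead from it to \<open>D\<close>.\<close>

lemma standard_orbit_eq':
  assumes "D \<noteq> 0" "D \<noteq> 1"
  shows "standard_orbit D = orbit_of D"
proof -
  have "1 - 1 / D = 1 / (D / (D - 1))" "D / (D - 1) \<noteq> 1" "D / (D - 1) \<noteq> 0"
    using assms by (simp_all add: divide_simps)
  then show ?thesis
    using assms orbit_of_compl[of "1 / D"] orbit_of_inverse[of D] orbit_of_inverse[of "D / (D - 1)"]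
    by (simp add: standard_orbit_eq)
qed

text \<open>With \<open>d4\<close> sent to infinity the cross-ratio becomes
  \<open>(x3 - x1) / (x3 - x2)\<close>, and the six bijections onto 0, 1, \<open>D\<close> produce
  the members of one orbit.\<close>

lemma cross_ratio_orbit_normalized:
  assumes d: "distinct [d1, d2, d3, d4]" and A: "A \<noteq> 0" and D: "D \<noteq> 0" "D \<noteq> 1"
    and img: "recip_coord d4 A B ` {d1, d2, d3} = {0, 1, D}"
  shows "cross_ratio_orbit (Fin d1) (Fin d2) (Fin d3) (Fin d4) = standard_orbit D"
proof -
  define x1 x2 x3 where x: "x1 = recip_coord d4 A B d1" "x2 = recip_coord d4 A B d2" "x3 = recip_coord d4 A B d3"
  have ne: "d1 - d4 \<noteq> 0" "d2 - d4 \<noteq> 0" "d3 - d4 \<noteq> 0" "d3 - d2 \<noteq> 0" using d by auto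
  have diff: "recip_coord d4 A B s - recip_coord d4 A B s' = A * (s' - s) / ((s - d4) * (s' - d4))"
    if "s \<noteq> d4" "s' \<noteq> d4" for s s'
    using that by (simp add: recip_coord_def diff_frac_eq right_diff_distrib)
  have "(x3 - x1) / (x3 - x2)
      = (A * (d1 - d3) / ((d3 - d4) * (d1 - d4))) / (A * (d2 - d3) / ((d3 - d4) * (d2 - d4)))"
    using ne unfolding x by (simp add: diff)
  also have "\<dots> = (d1 - d3) * (d2 - d4) / ((d1 - d4) * (d2 - d3))"
    using ne A by simp
  also have "\<dots> = ((- (d3 - d1)) * (- (d4 - d2))) / ((- (d4 - d1)) * (- (d3 - d2)))"
    by simp
  also have "\<dots> = cross_ratio (Fin d1) (Fin d2) (Fin d3) (Fin d4)"
    unfolding cross_ratio_def sphere_diff.simps minus_mult_minus ..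
  finally have cr: "cross_ratio_orbit (Fin d1) (Fin d2) (Fin d3) (Fin d4) = orbit_of ((x3 - x1) / (x3 - x2))"
    by (simp add: cross_ratio_orbit_def orbit_of_def Let_def)
  have "{x1, x2, x3} = {0, 1, D}" using img by (simp add: x)
  then have "x1 \<in> {0, 1, D}" "x2 \<in> {0, 1, D}" "x3 \<in> {0, 1, D}" by blast+
  moreover have "x1 \<noteq> x2" "x1 \<noteq> x3" "x2 \<noteq> x3"
    using d inj_recip_coord[OF A, of d4 B] unfolding x by (auto dest: injD)
  ultimately consider "x1 = 0" "x2 = 1" "x3 = D" | "x1 = 1" "x2 = 0" "x3 = D" | "x1 = 0" "x2 = D" "x3 = 1"
    | "x1 = D" "x2 = 0" "x3 = 1" | "x1 = 1" "x2 = D" "x3 = 0" | "x1 = D" "x2 = 1" "x3 = 0"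
    by (elim insertE emptyE) simp_all
  then have "(x3 - x1) / (x3 - x2) \<in> {D / (D - 1), 1 / (D / (D - 1)), 1 / (1 - D), 1 - D, 1 / D, D}"
    by cases simp_all
  moreover have "orbit_of (1 / (D / (D - 1))) = orbit_of (D / (D - 1))"
    using D by (intro orbit_of_inverse) (simp_all add: divide_simps)
  moreover have "orbit_of (1 / (1 - D)) = orbit_of D" "orbit_of (1 - D) = orbit_of D" "orbit_of (1 / D) = orbit_of D"
    using D by (simp_all add: orbit_of_inverse orbit_of_compl)
  moreover have "orbit_of (D / (D - 1)) = orbit_of D"
    using standard_orbit_eq'[OF D] standard_orbit_eq by simp
  ultimately show ?thesis
    unfolding cr standard_orbit_eq by (elim insertE emptyE) (simp_all only:)
qed

section \<open>Existence of the pullbacks\<close>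

definition log_deriv :: "complex poly \<Rightarrow> complex \<Rightarrow> complex" where
  "log_deriv p x = poly (pderiv p) x / poly p x"

lemma log_deriv_mult:
  "poly p x \<noteq> 0 \<Longrightarrow> poly q x \<noteq> 0 \<Longrightarrow> log_deriv (p * q) x = log_deriv p x + log_deriv q x"
  by (simp add: log_deriv_def pderiv_mult add_divide_distrib)

lemma log_deriv_smult: "u \<noteq> 0 \<Longrightarrow> log_deriv (smult u p) x = log_deriv p x"
  by (simp add: log_deriv_def pderiv_smult)

lemma log_deriv_linear: "log_deriv [:- e, 1:] x = 1 / (x - e)"
  by (simp add: log_deriv_def pderiv_pCons)

lemma log_deriv_power:
  assumes "poly p x \<noteq> 0"
  shows "log_deriv (p ^ n) x = of_nat n * log_deriv p x"
proof (induction n)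
  case (Suc n)
  have "log_deriv (p ^ Suc n) x = log_deriv p x + log_deriv (p ^ n) x"
    using assms by (simp add: log_deriv_mult)
  then show ?case by (simp add: Suc algebra_simps)
qed (simp add: log_deriv_def)

lemma log_deriv_prod_linear:
  assumes "finite X" "x \<notin> X"
  shows "log_deriv (\<Prod>e\<in>X. [:- e, 1:]) x = (\<Sum>e\<in>X. 1 / (x - e))"
  using assms
proof (induction X)
  case (insert e X)
  have nz: "poly [:- e, 1:] x \<noteq> 0" "poly (\<Prod>e\<in>X. [:- e, 1:]) x \<noteq> 0"
    using insert by (auto simp: poly_prod prod_zero_iff)
  show ?case
    unfolding prod.insert[OF insert.hyps(1,2)] log_deriv_mult[OF nz] log_deriv_linear
    using insert by simp
qed (simp add: log_deriv_def)

text \<open>The hypotheses are the factorizations found in the classification, with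
  \<open>t0 = 0\<close> and \<open>V = U / n\<close>. All roots being explicit, both coefficients
  follow from logarithmic derivatives.\<close>

lemma polynomial_pullback:
  fixes J K :: "complex set" and R V :: "complex poly" and C a b c :: complex and n \<mu> :: nat
  defines "c' \<equiv> a + b - c + 1"
  assumes fin: "finite J" "finite K" "J \<inter> K = {}" "0 \<notin> J" "0 \<notin> K"
    and R: "R = smult C ([:0, 1:] ^ \<mu> * (\<Prod>e\<in>J. [:- e, 1:]))"
    and R': "pderiv R = smult (of_nat n * C) ([:0, 1:] ^ (\<mu> - 1) * V)"
    and R1: "R - 1 = smult C (V^2 * (\<Prod>e\<in>K. [:- e, 1:]))"
    and nz: "C \<noteq> 0" "n \<noteq> 0" "V \<noteq> 0"
    and \<mu>: "\<mu> = 2 \<and> S = insert 0 (J \<union> K) \<and> \<kappa> 0 = 2 * c - 1 \<or> \<mu> = 3 \<and> S = J \<union> K \<and> c = 2/3"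
    and \<kappa>: "\<And>e. e \<in> J \<Longrightarrow> \<kappa> e = c" "\<And>e. e \<in> K \<Longrightarrow> \<kappa> e = c'"
    and V: "c' = 1/2 \<or> pderiv V = 0"
    and m: "m = a * b * (of_nat n)^2"
  shows "same_ode (subst_ode (hypergeometric_ode a b c) (poly R)) (heun_on S \<kappa> m 0)"
  unfolding same_ode_def
proof (intro exI[of _ "insert 0 (J \<union> K \<union> {x. poly V x = 0})"] allI impI conjI)
  show "finite (insert 0 (J \<union> K \<union> {x. poly V x = 0}))"
    using fin nz(3) by (simp add: poly_roots_finite)
  fix x assume "x \<notin> insert 0 (J \<union> K \<union> {x. poly V x = 0})"
  then have x: "x \<noteq> 0" "x \<notin> J" "x \<notin> K" "poly V x \<noteq> 0" by auto
  let ?J = "\<Prod>e\<in>J. [:- e, 1:]" and ?K = "\<Prod>e\<in>K. [:- e, 1:]"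
  have pnz: "poly ?J x \<noteq> 0" "poly ?K x \<noteq> 0"
    using x fin by (auto simp: poly_prod prod_zero_iff)
  have Z: "log_deriv ([:0, 1:] ^ i) x = of_nat i / x" for i
    using log_deriv_power[of "[:0, 1:]" x i] x log_deriv_linear[of 0 x] by simp
  have dR: "deriv (poly P) = poly (pderiv P)" for P :: "complex poly"
    by (rule ext) (simp add: DERIV_imp_deriv)
  have p1: "pderiv (R - 1) = pderiv R" by (simp add: pderiv_diff)
  have l1: "log_deriv R x = of_nat \<mu> / x + (\<Sum>e\<in>J. 1 / (x - e))"
    unfolding R using nz x pnz fin by (simp add: log_deriv_smult log_deriv_mult Z log_deriv_prod_linear del: mult_pCons_left)
  have l2: "log_deriv (R - 1) x = 2 * log_deriv V x + (\<Sum>e\<in>K. 1 / (x - e))"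
    unfolding R1 using nz x pnz fin by (simp add: log_deriv_smult log_deriv_mult log_deriv_power log_deriv_prod_linear)
  have l3: "log_deriv (pderiv R) x = of_nat (\<mu> - 1) / x + log_deriv V x"
    unfolding R' using nz x by (simp add: log_deriv_smult log_deriv_mult Z del: mult_pCons_left)
  have "fst (subst_ode (hypergeometric_ode a b c) (poly R)) x
      = (c / poly R x + c' / poly (R - 1) x) * poly (pderiv R) x - poly (pderiv (pderiv R)) x / poly (pderiv R) x"
    by (simp add: subst_ode_def hypergeometric_ode_def dR c'_def)
  also have "\<dots> = c * log_deriv R x + c' * log_deriv (R - 1) x - log_deriv (pderiv R) x"
    unfolding log_deriv_def p1 by (simp add: distrib_right)
  also have "\<dots> = (c * of_nat \<mu> - of_nat (\<mu> - 1)) / x + c * (\<Sum>e\<in>J. 1 / (x - e)) + c' * (\<Sum>e\<in>K. 1 / (x - e))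
      + (2 * c' - 1) * log_deriv V x"
    unfolding l1 l2 l3 by (simp add: algebra_simps diff_divide_distrib)
  \<comment> \<open>The double points over 1 contribute no pole: either their residue vanishes or
    there are none.\<close>
  also have "(2 * c' - 1) * log_deriv V x = 0"
  proof (rule disjE[OF V])
    assume "c' = 1/2"
    show ?thesis unfolding \<open>c' = 1/2\<close> by simp
  qed (simp add: log_deriv_def)
  also have "c * (\<Sum>e\<in>J. 1 / (x - e)) = (\<Sum>e\<in>J. \<kappa> e / (x - e))"
    unfolding sum_distrib_left by (intro sum.cong) (simp_all add: \<kappa>)
  also have "c' * (\<Sum>e\<in>K. 1 / (x - e)) = (\<Sum>e\<in>K. \<kappa> e / (x - e))"
    unfolding sum_distrib_left by (intro sum.cong) (simp_all add: \<kappa>)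
  also have "(c * of_nat \<mu> - of_nat (\<mu> - 1)) / x + (\<Sum>e\<in>J. \<kappa> e / (x - e)) + (\<Sum>e\<in>K. \<kappa> e / (x - e)) + 0
      = (\<Sum>e\<in>S. \<kappa> e / (x - e))"
    using \<mu> fin by (auto simp: sum.union_disjoint algebra_simps)
  finally show "fst (subst_ode (hypergeometric_ode a b c) (poly R)) x = fst (heun_on S \<kappa> m 0) x"
    by (simp add: heun_on_def)
  have "snd (subst_ode (hypergeometric_ode a b c) (poly R)) x
      = a * b / (poly R x * poly (R - 1) x) * (poly (pderiv R) x)^2"
    by (simp add: subst_ode_def hypergeometric_ode_def dR)
  also have "\<dots> = a * b / (C * (x ^ \<mu> * poly ?J x) * (C * ((poly V x)^2 * poly ?K x)))
      * (of_nat n * C * (x ^ (\<mu> - 1) * poly V x))^2"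
    unfolding R' R1 unfolding R by simp
  also have "\<dots> = m * ((x ^ (\<mu> - 1))^2 / x ^ \<mu>) / (poly ?J x * poly ?K x)"
    unfolding m using nz x pnz by (simp add: divide_simps power2_eq_square)
  \<comment> \<open>The left power is \<open>x ^ (\<mu> - 2)\<close>. For \<mu> = 2 the point 0
    belongs to \<open>S\<close> and its factor cancels the \<open>x\<close> in the numerator on the
    right.\<close>
  also have "(x ^ (\<mu> - 1))^2 / x ^ \<mu> / (poly ?J x * poly ?K x) = x / (\<Prod>e\<in>S. x - e)"
    using \<mu> x fin by (auto simp: prod.union_disjoint poly_prod power2_eq_square power3_eq_cube)
  then have "m * ((x ^ (\<mu> - 1))^2 / x ^ \<mu>) / (poly ?J x * poly ?K x) = m * x / (\<Prod>e\<in>S. x - e)"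
    by (metis times_divide_eq_right)
  finally show "snd (subst_ode (hypergeometric_ode a b c) (poly R)) x = snd (heun_on S \<kappa> m 0) x"
    by (simp add: heun_on_def)
qed

text \<open>
  In the coordinate \<open>x = u * t + v\<close> the zero of the second coefficient is at \<open>0\<close>.
\<close>

definition pullback_exists :: "subcase \<Rightarrow> (complex \<Rightarrow> complex) \<Rightarrow> complex \<Rightarrow> complex \<Rightarrow> bool" where
  "pullback_exists k \<kappa> \<alpha> \<beta> \<longleftrightarrow>
     (\<exists>u v a b c R. u \<noteq> 0 \<and> u * subcase_ratio k + v = 0 \<and> degree R \<noteq> 0 \<and>
        same_ode (subst_ode (hypergeometric_ode a b c) (poly R))
          (heun_on ((\<lambda>t. u * t + v) ` {0, 1, subcase_D k}) (\<lambda>x. \<kappa> ((x - v) / u)) (\<alpha> * \<beta>) 0))"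

text \<open>The points \<open>xa\<close>, \<open>xb\<close>, \<open>xD\<close> are the images of 0,
  1, \<open>D\<close>; the pairs in the hypothesis on \<kappa> match each point with its
  parameter.\<close>

lemma pullback_existsI:
  fixes J K :: "complex set" and R V :: "complex poly" and C c c' u v xa xb xD \<alpha> \<beta> :: complex and n \<mu> :: nat
  assumes u: "u \<noteq> 0" and ratio: "u * subcase_ratio k + v = 0"
    and img: "v = xa" "u + v = xb" "u * subcase_D k + v = xD"
    and fin: "finite J" "finite K" "J \<inter> K = {}" "0 \<notin> J" "0 \<notin> K"
    and R: "R = smult C ([:0, 1:] ^ \<mu> * (\<Prod>e\<in>J. [:- e, 1:]))"
    and R': "pderiv R = smult (of_nat n * C) ([:0, 1:] ^ (\<mu> - 1) * V)"
    and R1: "R - 1 = smult C (V^2 * (\<Prod>e\<in>K. [:- e, 1:]))"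
    and nz: "C \<noteq> 0" "n \<noteq> 0" "V \<noteq> 0"
    and \<mu>: "\<mu> = 2 \<and> {xa, xb, xD} = insert 0 (J \<union> K) \<or> \<mu> = 3 \<and> {xa, xb, xD} = J \<union> K \<and> c = 2/3"
    and \<kappa>: "\<And>e y. (e, y) \<in> {(xa, \<kappa> 0), (xb, \<kappa> 1), (xD, \<kappa> (subcase_D k))} \<Longrightarrow>
       (e = 0 \<longrightarrow> y = 2 * c - 1) \<and> (e \<in> J \<longrightarrow> y = c) \<and> (e \<in> K \<longrightarrow> y = c')"
    and c': "\<alpha> + \<beta> = of_nat n * (c + c' - 1)"
    and V: "c' = 1/2 \<or> pderiv V = 0"
  shows "pullback_exists k \<kappa> \<alpha> \<beta>"
proof -
  \<comment> \<open>Substitution of degree n multiplies the exponents at infinity by n.\<close>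
  define a b where "a = \<alpha> / of_nat n" and "b = \<beta> / of_nat n"
  have "a + b = (\<alpha> + \<beta>) / of_nat n"
    by (simp add: a_def b_def add_divide_distrib)
  then have ab: "a + b - c + 1 = c'"
    unfolding c' using nz by simp
  define \<kappa>x where "\<kappa>x = (\<lambda>x. \<kappa> ((x - v) / u))"
  have S: "(\<lambda>t. u * t + v) ` {0, 1, subcase_D k} = {xa, xb, xD}"
    using img by simp
  have "\<kappa>x xa = \<kappa> 0" "\<kappa>x xb = \<kappa> 1" "\<kappa>x xD = \<kappa> (subcase_D k)"
    unfolding img[symmetric] \<kappa>x_def using u by simp_all
  then have "(e, \<kappa>x e) \<in> {(xa, \<kappa> 0), (xb, \<kappa> 1), (xD, \<kappa> (subcase_D k))}" if "e \<in> {xa, xb, xD}" for e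
    using that by (elim insertE emptyE) simp_all
  note K = \<kappa>[OF this]
  define T where "T = {xa, xb, xD}"
  have \<mu>T: "\<mu> = 2 \<and> T = insert 0 (J \<union> K) \<or> \<mu> = 3 \<and> T = J \<union> K \<and> c = 2/3"
    using \<mu> unfolding T_def .
  note K = K[folded T_def]
  have sub: "J \<subseteq> T" "K \<subseteq> T" "\<mu> = 2 \<Longrightarrow> 0 \<in> T"
    using \<mu>T by auto
  have red: "same_ode (subst_ode (hypergeometric_ode a b c) (poly R)) (heun_on T \<kappa>x (\<alpha> * \<beta>) 0)"
  proof (rule polynomial_pullback[OF fin R R' R1 nz])
    show "\<alpha> * \<beta> = a * b * (of_nat n)^2"
      using nz by (simp add: a_def b_def power2_eq_square)
    show "\<mu> = 2 \<and> T = insert 0 (J \<union> K) \<and> \<kappa>x 0 = 2 * c - 1 \<or> \<mu> = 3 \<and> T = J \<union> K \<and> c = 2 / 3"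
      using \<mu>T
    proof
      assume *: "\<mu> = 2 \<and> T = insert 0 (J \<union> K)"
      then have "\<kappa>x 0 = 2 * c - 1" using K[of 0] sub(3) by simp
      with * show ?thesis by simp
    qed simp
    show "a + b - c + 1 = 1/2 \<or> pderiv V = 0"
      unfolding ab by (rule V)
    fix e
    show "\<kappa>x e = c" if "e \<in> J"
      using K[OF subsetD[OF sub(1) that]] that by simp
    show "\<kappa>x e = a + b - c + 1" if "e \<in> K"
      unfolding ab using K[OF subsetD[OF sub(2) that]] that by simp
  qed
  have deg: "degree R \<noteq> 0"
  proof
    assume "degree R = 0"
    then have "pderiv R = 0" by (simp add: pderiv_eq_0_iff)
    with R' nz show False by simp
  qed
  show ?thesis
    unfolding pullback_exists_def
    by (intro exI[of _ u] exI[of _ v] exI[of _ a] exI[of _ b] exI[of _ c] exI[of _ R] conjI u ratio deg)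
      (use red in \<open>simp only: S T_def \<kappa>x_def\<close>)
qed

lemma poly_ext:
  fixes p q :: "complex poly"
  assumes "\<And>x. poly p x = poly q x"
  shows "p = q"
  using poly_eq_cofinite[of "{}"] assms by simp

lemma fuchs_sum: "\<alpha> + \<beta> = x + y + z - 1" if "\<alpha> + \<beta> - x - y - z + 1 = 0" for \<alpha> \<beta> x y z :: complex
  using that by algebra

text \<open>
  The polynomials below are those found in the coefficient comparisons of the classification, with the
  free scale of \<open>x\<close> chosen so that the rational points are integers.
\<close>

lemma pullback_1a:
  assumes "\<kappa> 0 = \<kappa> 2" "\<alpha> + \<beta> - \<kappa> 0 - \<kappa> 1 - \<kappa> 2 + 1 = 0"
  shows "pullback_exists Case1a \<kappa> \<alpha> \<beta>"
\<comment> \<open>The value of \<open>c\<close> solves \<kappa> 1 = 2c - 1, the condition at the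
  double point 0.\<close>
proof (rule pullback_existsI[where u = 1 and v = "-1" and xa = "-1" and xb = 0 and xD = 1 and J = "{}" and K = "{1, -1}"
      and V = 1 and C = 1 and n = 2 and \<mu> = 2 and c = "(\<kappa> 1 + 1) / 2" and c' = "\<kappa> 0" and R = "[:0, 0, 1:]"])
  show "\<alpha> + \<beta> = of_nat 2 * ((\<kappa> 1 + 1) / 2 + \<kappa> 0 - 1)"
    unfolding fuchs_sum[OF assms(2)] assms(1) by (simp add: field_simps)
  show "(e = 0 \<longrightarrow> y = 2 * ((\<kappa> 1 + 1) / 2) - 1) \<and> (e \<in> {} \<longrightarrow> y = (\<kappa> 1 + 1) / 2) \<and> (e \<in> {1, -1} \<longrightarrow> y = \<kappa> 0)"
    if "(e, y) \<in> {(-1, \<kappa> 0), (0, \<kappa> 1), (1, \<kappa> (subcase_D Case1a))}" for e y :: complex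
    using that assms(1) by (auto simp: add_divide_distrib)
qed (simp_all add: pderiv_pCons power2_eq_square one_pCons insert_commute)

text \<open>R = x^2 (3 - x) / 4, scaled to take the value 1 at its other critical point 2.\<close>

lemma pullback_1b:
  assumes "1 - \<kappa> 1 = 2 * (1 - \<kappa> 4)" "\<kappa> 0 = 1/2" "\<alpha> + \<beta> - \<kappa> 0 - \<kappa> 1 - \<kappa> 4 + 1 = 0"
  shows "pullback_exists Case1b \<kappa> \<alpha> \<beta>"
proof (rule pullback_existsI[where u = 1 and v = "-1" and xa = "-1" and xb = 0 and xD = 3 and J = "{3}" and K = "{-1}"
      and V = "[:-2, 1:]" and C = "-1/4" and n = 3 and \<mu> = 2 and c = "\<kappa> 4" and c' = "1/2" and R = "[:0, 0, 3/4, -1/4:]"])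
  have 1: "\<kappa> 1 = 2 * \<kappa> 4 - 1" using assms(1) by algebra
  show "\<alpha> + \<beta> = of_nat 3 * (\<kappa> 4 + 1/2 - 1)"
    unfolding fuchs_sum[OF assms(3)] 1 assms(2) by (simp add: field_simps)
  show "(e = 0 \<longrightarrow> y = 2 * \<kappa> 4 - 1) \<and> (e \<in> {3} \<longrightarrow> y = \<kappa> 4) \<and> (e \<in> {-1} \<longrightarrow> y = 1/2)"
    if "(e, y) \<in> {(-1, \<kappa> 0), (0, \<kappa> 1), (3, \<kappa> (subcase_D Case1b))}" for e y :: complex
    using that assms(2) 1 by auto
qed (simp_all add: pderiv_pCons power2_eq_square one_pCons insert_commute)

text \<open>R = 4t (1 - t) with t = x^2, the polynomial of subcase 1a followed by a quadratic
  map.\<close>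

lemma pullback_1c:
  assumes "\<kappa> 0 = \<kappa> 2" "1 - \<kappa> 1 = 2 * (1 - \<kappa> 0)" "\<alpha> + \<beta> - \<kappa> 0 - \<kappa> 1 - \<kappa> 2 + 1 = 0"
  shows "pullback_exists Case1c \<kappa> \<alpha> \<beta>"
proof (rule pullback_existsI[where u = 1 and v = "-1" and xa = "-1" and xb = 0 and xD = 1 and J = "{1, -1}" and K = "{}"
      and V = "[:-1/2, 0, 1:]" and C = "-4" and n = 4 and \<mu> = 2 and c = "\<kappa> 0" and c' = "1/2" and R = "[:0, 0, 4, 0, -4:]"])
  have 1: "\<kappa> 1 = 2 * \<kappa> 0 - 1" using assms(2) by algebra
  show "\<alpha> + \<beta> = of_nat 4 * (\<kappa> 0 + 1/2 - 1)"
    unfolding fuchs_sum[OF assms(3)] 1 assms(1)[symmetric] by (simp add: field_simps)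
  show "(e = 0 \<longrightarrow> y = 2 * \<kappa> 0 - 1) \<and> (e \<in> {1, -1} \<longrightarrow> y = \<kappa> 0) \<and> (e \<in> {} \<longrightarrow> y = 1/2)"
    if "(e, y) \<in> {(-1, \<kappa> 0), (0, \<kappa> 1), (1, \<kappa> (subcase_D Case1c))}" for e y :: complex
    using that assms(1) 1 by auto
qed (simp_all add: pderiv_pCons power2_eq_square one_pCons insert_commute)




text \<open>The hypothesis makes \<omega> a primitive cube root of unity, and
  \<open>- 1 - \<omega>\<close> is its square.\<close>

lemma cube_roots:
  fixes \<omega> :: complex
  assumes "\<omega>^2 + \<omega> + 1 = 0"
  shows "(\<Prod>e\<in>{1, \<omega>, - 1 - \<omega>}. [:- e, 1:]) = [:-1, 0, 0, 1:]"
    "finite {1, \<omega>, - 1 - \<omega>}" "0 \<notin> {1, \<omega>, - 1 - \<omega>}"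
proof -
  have val: "\<omega> \<noteq> x" if "x^2 + x + 1 \<noteq> 0" for x
    using assms that by blast
  \<comment> \<open>For these values two of the three roots would coincide or one would
    vanish.\<close>
  have "\<omega> \<noteq> 1" "\<omega> \<noteq> 0" "\<omega> \<noteq> -1" "\<omega> \<noteq> -2" "\<omega> \<noteq> -1/2"
    by (rule val; simp add: power2_eq_square)+
  moreover have "1 = - 1 - \<omega> \<longleftrightarrow> \<omega> = -2" "0 = - 1 - \<omega> \<longleftrightarrow> \<omega> = -1"
    by (auto simp: eq_diff_eq eq_neg_iff_add_eq_0 add.commute)
  moreover have "\<omega> \<noteq> - 1 - \<omega>"
  proof
    assume "\<omega> = - 1 - \<omega>"
    then have "2 * \<omega> = -1" by algebra
    then have "\<omega> = -1/2" by (simp add: field_simps)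
    with \<open>\<omega> \<noteq> -1/2\<close> show False by blast
  qed
  ultimately have ne: "1 \<noteq> \<omega>" "1 \<noteq> - 1 - \<omega>" "\<omega> \<noteq> - 1 - \<omega>" and ne0: "0 \<noteq> \<omega>" "0 \<noteq> - 1 - \<omega>"
    by simp_all
  have eq: "[:- 1, 1:] * ([:- \<omega>, 1:] * [:- (- 1 - \<omega>), 1:]) = [:-1, 0, 0, 1:]"
    by (rule poly_ext, unfold poly_mult poly_pCons poly_0) (use assms in algebra)
  have "(\<Prod>e\<in>{1, \<omega>, - 1 - \<omega>}. [:- e, 1:]) = [:- 1, 1:] * ([:- \<omega>, 1:] * [:- (- 1 - \<omega>), 1:])"
    using ne by (simp del: mult_pCons_left mult_pCons_right)
  then show "(\<Prod>e\<in>{1, \<omega>, - 1 - \<omega>}. [:- e, 1:]) = [:-1, 0, 0, 1:]"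
    unfolding eq .
  show "0 \<notin> {1, \<omega>, - 1 - \<omega>}"
    using ne0 by simp
qed simp

lemma i_sqrt3_square: "(\<i> * complex_of_real (sqrt 3))^2 = - 3"
  unfolding power_mult_distrib csqrt_squares by simp

text \<open>R = x^3. The affine map sends 0, 1, \<open>D\<close> to the cube roots of unity, and the
  nonsingular triple point 0 requires \<open>c = 2/3\<close>.\<close>

lemma pullback_2a:
  assumes "\<kappa> 0 = \<kappa> 1" "\<kappa> 1 = \<kappa> (subcase_D Case2a)" "\<alpha> + \<beta> - \<kappa> 0 - \<kappa> 1 - \<kappa> (subcase_D Case2a) + 1 = 0"
  shows "pullback_exists Case2a \<kappa> \<alpha> \<beta>"
proof -
  define r where "r = \<i> * complex_of_real (sqrt 3)"
  have r: "r * r = - 3" using i_sqrt3_square by (simp add: r_def power2_eq_square)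
  have D: "subcase_D Case2a = 1/2 + r/2" "subcase_ratio Case2a = 1/2 + r/6"
    by (simp_all add: r_def)
  define \<omega> where "\<omega> = - 1/2 + r/2"
  have "\<omega>^2 + \<omega> + 1 = (r * r + 3) / 4"
    by (simp add: \<omega>_def power2_eq_square field_simps)
  then have \<omega>: "\<omega>^2 + \<omega> + 1 = 0" unfolding r by simp
  have "(\<omega> - 1) * (1/2 + r/2) = (r * r - 2 * r - 3) / 4" "(\<omega> - 1) * (1/2 + r/6) = (r * r - 9) / 12"
    by (simp_all add: \<omega>_def field_simps)
  then have img: "(\<omega> - 1) * (1/2 + r/2) + 1 = - 1 - \<omega>" "(\<omega> - 1) * (1/2 + r/6) + 1 = 0"
    unfolding r by (simp_all add: \<omega>_def field_simps)
  show ?thesis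
  proof (rule pullback_existsI[where u = "\<omega> - 1" and v = 1 and xa = 1 and xb = \<omega> and xD = "- 1 - \<omega>" and J = "{}"
        and K = "{1, \<omega>, - 1 - \<omega>}" and V = 1 and C = 1 and n = 3 and \<mu> = 3 and c = "2/3" and c' = "\<kappa> 0" and R = "[:0, 0, 0, 1:]"])
    show "\<alpha> + \<beta> = of_nat 3 * (2/3 + \<kappa> 0 - 1)"
      unfolding fuchs_sum[OF assms(3)] assms(1,2) by (simp add: field_simps)
    show "(\<omega> - 1) * subcase_D Case2a + 1 = - 1 - \<omega>" "(\<omega> - 1) * subcase_ratio Case2a + 1 = 0"
      unfolding D by (rule img)+
    show "\<omega> - 1 \<noteq> 0"
    proof
      assume "\<omega> - 1 = 0"
      then have "\<omega> = 1" by simp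
      with \<omega> show False by simp
    qed
    show "(e = 0 \<longrightarrow> y = 2 * (2 / 3) - 1) \<and> (e \<in> {} \<longrightarrow> y = 2/3) \<and> (e \<in> {1, \<omega>, - 1 - \<omega>} \<longrightarrow> y = \<kappa> 0)"
      if "(e, y) \<in> {(1, \<kappa> 0), (\<omega>, \<kappa> 1), (- 1 - \<omega>, \<kappa> (subcase_D Case2a))}" for e y :: complex
    proof -
      have "e \<in> {1, \<omega>, - 1 - \<omega>}" using that by blast
      then have "e \<noteq> 0" using cube_roots(3)[OF \<omega>] by metis
      moreover have "y = \<kappa> 0"
        using that by (elim insertE emptyE) (use assms in \<open>simp_all del: subcase_D.simps\<close>)
      ultimately show ?thesis by simp
    qed
    show "[:0, 0, 0, 1:] - 1 = smult 1 (1^2 * (\<Prod>e\<in>{1, \<omega>, - 1 - \<omega>}. [:- e, 1:]))"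
      unfolding cube_roots[OF \<omega>] by (simp add: power2_eq_square one_pCons)
  qed (use cube_roots(3)[OF \<omega>] in \<open>simp_all add: pderiv_pCons power2_eq_square power3_eq_cube one_pCons\<close>)
qed

text \<open>R = 4t (1 - t) with t = x^3. The double points over 1 are the roots of x^3 =
  1/2.\<close>

lemma pullback_2d:
  assumes "\<kappa> 0 = 2/3" "\<kappa> 1 = 2/3" "\<kappa> (subcase_D Case2d) = 2/3" "\<alpha> + \<beta> - \<kappa> 0 - \<kappa> 1 - \<kappa> (subcase_D Case2d) + 1 = 0"
  shows "pullback_exists Case2d \<kappa> \<alpha> \<beta>"
proof -
  define r where "r = \<i> * complex_of_real (sqrt 3)"
  have r: "r * r = - 3" using i_sqrt3_square by (simp add: r_def power2_eq_square)
  have D: "subcase_D Case2d = 1/2 + r/2" "subcase_ratio Case2d = 1/2 + r/6"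
    by (simp_all add: r_def)
  define \<omega> where "\<omega> = - 1/2 + r/2"
  have "\<omega>^2 + \<omega> + 1 = (r * r + 3) / 4"
    by (simp add: \<omega>_def power2_eq_square field_simps)
  then have \<omega>: "\<omega>^2 + \<omega> + 1 = 0" unfolding r by simp
  have "(\<omega> - 1) * (1/2 + r/2) = (r * r - 2 * r - 3) / 4" "(\<omega> - 1) * (1/2 + r/6) = (r * r - 9) / 12"
    by (simp_all add: \<omega>_def field_simps)
  then have img: "(\<omega> - 1) * (1/2 + r/2) + 1 = - 1 - \<omega>" "(\<omega> - 1) * (1/2 + r/6) + 1 = 0"
    unfolding r by (simp_all add: \<omega>_def field_simps)
  show ?thesis
  proof (rule pullback_existsI[where u = "\<omega> - 1" and v = 1 and xa = 1 and xb = \<omega> and xD = "- 1 - \<omega>" and K = "{}"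
        and J = "{1, \<omega>, - 1 - \<omega>}" and V = "[:-1/2, 0, 0, 1:]" and C = "-4" and n = 6 and \<mu> = 3 and c = "2/3"
        and c' = "1/2" and R = "[:0, 0, 0, 4, 0, 0, -4:]"])
    show "\<alpha> + \<beta> = of_nat 6 * (2/3 + 1/2 - 1)"
      unfolding fuchs_sum[OF assms(4)] assms(1,2,3) by (simp add: field_simps)
    show "(\<omega> - 1) * subcase_D Case2d + 1 = - 1 - \<omega>" "(\<omega> - 1) * subcase_ratio Case2d + 1 = 0"
      unfolding D by (rule img)+
    show "\<omega> - 1 \<noteq> 0"
    proof
      assume "\<omega> - 1 = 0"
      then have "\<omega> = 1" by simp
      with \<omega> show False by simp
    qed
    show "(e = 0 \<longrightarrow> y = 2 * (2 / 3) - 1) \<and> (e \<in> {1, \<omega>, - 1 - \<omega>} \<longrightarrow> y = 2/3) \<and> (e \<in> {} \<longrightarrow> y = 1/2)"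
      if "(e, y) \<in> {(1, \<kappa> 0), (\<omega>, \<kappa> 1), (- 1 - \<omega>, \<kappa> (subcase_D Case2d))}" for e y :: complex
    proof -
      have "e \<in> {1, \<omega>, - 1 - \<omega>}" using that by blast
      then have "e \<noteq> 0" using cube_roots(3)[OF \<omega>] by metis
      moreover have "y = 2/3"
        using that by (elim insertE emptyE) (use assms in \<open>simp_all del: subcase_D.simps\<close>)
      ultimately show ?thesis by simp
    qed
    show "[:0, 0, 0, 4, 0, 0, -4:] = smult (-4) ([:0, 1:] ^ 3 * (\<Prod>e\<in>{1, \<omega>, - 1 - \<omega>}. [:- e, 1:]))"
      unfolding cube_roots[OF \<omega>] by (simp add: power3_eq_cube)
  qed (use cube_roots(3)[OF \<omega>] in \<open>simp_all add: pderiv_pCons power2_eq_square power3_eq_cube one_pCons\<close>)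
qed

text \<open>R = x^3 (4 - x) / 27 takes the value 1 doubly at its critical point 3; the two other
  points over 1 are the roots of x^2 + 2x + 3.\<close>

lemma pullback_2b:
  assumes "\<kappa> (subcase_D Case2b) = 2/3" "\<kappa> 0 = 1/2" "\<kappa> 1 = 1/2" "\<alpha> + \<beta> - \<kappa> 0 - \<kappa> 1 - \<kappa> (subcase_D Case2b) + 1 = 0"
  shows "pullback_exists Case2b \<kappa> \<alpha> \<beta>"
proof -
  define r where "r = \<i> * complex_of_real (sqrt 2)"
  have r: "r * r = - 2"
    unfolding r_def power2_eq_square[symmetric] power_mult_distrib csqrt_squares by simp
  have D: "subcase_D Case2b = 1/2 + r * 5/4" "subcase_ratio Case2b = 1/2 + r/4"
    by (simp_all add: r_def)
  have r0: "r \<noteq> 0" by (simp add: r_def)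
  define p p' where "p = - 1 + r" and "p' = - 1 - r"
  have "Im p \<noteq> 0" "Im p' \<noteq> 0" "Im p \<noteq> Im p'"
    by (simp_all add: p_def p'_def r_def)
  then have ne: "p \<noteq> p'" "p \<noteq> 0" "p' \<noteq> 0" "p \<noteq> 4" "p' \<noteq> 4"
    by auto
  have "- 2 * r * (1/2 + r * 5/4) = - r - 5/2 * (r * r)" "- 2 * r * (1/2 + r/4) = - r - 1/2 * (r * r)"
    "p * p' = 1 - r * r"
    by (simp_all add: p_def p'_def field_simps)
  then have img: "- 2 * r * (1/2 + r * 5/4) + p = 4" "- 2 * r * (1/2 + r/4) + p = 0" "- 2 * r + p = p'"
    and pp: "p + p' = - 2" "p * p' = 3"
    unfolding r by (simp_all add: p_def p'_def)
  show ?thesis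
  proof (rule pullback_existsI[where u = "- 2 * r" and v = "p" and xa = "p" and xb = "p'" and xD = 4 and J = "{4}"
        and K = "{p, p'}" and V = "[:-3, 1:]" and C = "-1/27" and n = 4 and \<mu> = 3 and c = "2/3" and c' = "1/2"
        and R = "[:0, 0, 0, 4/27, -1/27:]"])
    show "\<alpha> + \<beta> = of_nat 4 * (2/3 + 1/2 - 1)"
      unfolding fuchs_sum[OF assms(4)] assms(1,2,3) by (simp add: field_simps)
    show "- 2 * r * subcase_D Case2b + p = 4" "- 2 * r * subcase_ratio Case2b + p = 0" "- 2 * r + p = p'"
      unfolding D by (rule img)+
    show "(e = 0 \<longrightarrow> y = 2 * (2 / 3) - 1) \<and> (e \<in> {4} \<longrightarrow> y = 2/3) \<and> (e \<in> {p, p'} \<longrightarrow> y = 1/2)"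
      if "(e, y) \<in> {(p, \<kappa> 0), (p', \<kappa> 1), (4, \<kappa> (subcase_D Case2b))}" for e y :: complex
    proof -
      note H = that
      consider "e = p" "y = \<kappa> 0" | "e = p'" "y = \<kappa> 1" | "e = 4" "y = \<kappa> (subcase_D Case2b)"
        using H by blast
      then show ?thesis
        by cases (use assms ne in \<open>simp_all del: subcase_D.simps\<close>)
    qed
    have "[:- p, 1:] * [:- p', 1:] = [:3, 2, 1:]"
      by (rule poly_ext, unfold poly_mult poly_pCons poly_0) (use pp in algebra)
    then have "(\<Prod>e\<in>{p, p'}. [:- e, 1:]) = [:3, 2, 1:]"
      using ne(1) by simp
    then show "[:0, 0, 0, 4/27, -1/27:] - 1 = smult (-1/27) ([:-3, 1:]^2 * (\<Prod>e\<in>{p, p'}. [:- e, 1:]))"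
      by (simp add: one_pCons power2_eq_square)
  qed (use ne r0 in \<open>simp_all add: pderiv_pCons power2_eq_square power3_eq_cube one_pCons insert_commute\<close>)
qed

text \<open>The scale puts the simple point over 1 at 3: 1728 (R - 1) = (x - 3)(x^2 + 4x + 24)^2,
  while the simple zeros of \<open>R\<close> are the roots of x^2 + 5x + 40.\<close>

lemma pullback_2c:
  assumes "\<kappa> (subcase_D Case2c) = 1/2" "\<kappa> 0 = 2/3" "\<kappa> 1 = 2/3" "\<alpha> + \<beta> - \<kappa> 0 - \<kappa> 1 - \<kappa> (subcase_D Case2c) + 1 = 0"
  shows "pullback_exists Case2c \<kappa> \<alpha> \<beta>"
proof -
  define r where "r = \<i> * complex_of_real (sqrt 15)"
  have r: "r * r = - 15"
    unfolding r_def power2_eq_square[symmetric] power_mult_distrib csqrt_squares by simp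
  have D: "subcase_D Case2c = 1/2 + r * 11/90" "subcase_ratio Case2c = 1/2 + r/18"
    by (simp_all add: r_def)
  have r0: "r \<noteq> 0" by (simp add: r_def)
  define p p' where "p = (- 5 + 3 * r) / 2" and "p' = (- 5 - 3 * r) / 2"
  have "Im p \<noteq> 0" "Im p' \<noteq> 0" "Im p \<noteq> Im p'"
    by (simp_all add: p_def p'_def r_def)
  then have ne: "p \<noteq> p'" "p \<noteq> 0" "p' \<noteq> 0" "p \<noteq> 3" "p' \<noteq> 3"
    by auto
  have comp: "- 3 * r * (1/2 + r * 11/90) = - 3/2 * r - 11/30 * (r * r)" "- 3 * r * (1/2 + r/18) = - 3/2 * r - 1/6 * (r * r)"
    "p * p' = (25 - 9 * (r * r)) / 4"
    by (simp_all add: p_def p'_def field_simps)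
  have img: "- 3 * r * (1/2 + r * 11/90) + p = 3" "- 3 * r * (1/2 + r/18) + p = 0" "- 3 * r + p = p'"
    and pp: "p + p' = - 5" "p * p' = 40"
    unfolding comp unfolding r by (simp_all add: p_def p'_def field_simps)
  show ?thesis
  proof (rule pullback_existsI[where u = "- 3 * r" and v = p and xa = p and xb = p' and xD = 3 and J = "{p, p'}"
        and K = "{3}" and V = "[:24, 4, 1:]" and C = "1/1728" and n = 5 and \<mu> = 3 and c = "2/3" and c' = "1/2"
        and R = "[:0, 0, 0, 40/1728, 5/1728, 1/1728:]"])
    show "\<alpha> + \<beta> = of_nat 5 * (2/3 + 1/2 - 1)"
      unfolding fuchs_sum[OF assms(4)] assms(1,2,3) by (simp add: field_simps)
    show "- 3 * r * subcase_D Case2c + p = 3" "- 3 * r * subcase_ratio Case2c + p = 0" "- 3 * r + p = p'"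
      unfolding D by (rule img)+
    show "(e = 0 \<longrightarrow> y = 2 * (2 / 3) - 1) \<and> (e \<in> {p, p'} \<longrightarrow> y = 2/3) \<and> (e \<in> {3} \<longrightarrow> y = 1/2)"
      if "(e, y) \<in> {(p, \<kappa> 0), (p', \<kappa> 1), (3, \<kappa> (subcase_D Case2c))}" for e y :: complex
    proof -
      note H = that
      consider "e = p" "y = \<kappa> 0" | "e = p'" "y = \<kappa> 1" | "e = 3" "y = \<kappa> (subcase_D Case2c)"
        using H by blast
      then show ?thesis
        by cases (use assms ne in \<open>simp_all del: subcase_D.simps\<close>)
    qed
    have "[:- p, 1:] * [:- p', 1:] = [:40, 5, 1:]"
      by (rule poly_ext, unfold poly_mult poly_pCons poly_0) (use pp in algebra)
    then have "(\<Prod>e\<in>{p, p'}. [:- e, 1:]) = [:40, 5, 1:]"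
      using ne(1) by simp
    then show "[:0, 0, 0, 40/1728, 5/1728, 1/1728:] = smult (1/1728) ([:0, 1:] ^ 3 * (\<Prod>e\<in>{p, p'}. [:- e, 1:]))"
      by (simp add: power3_eq_cube)
  qed (use ne r0 in \<open>simp_all add: pderiv_pCons power2_eq_square power3_eq_cube one_pCons insert_commute\<close>)
qed

text \<open>The inclusion carries the conditions of 2a and 2d, stated for \<gamma>, \<delta>,
  \<epsilon>, over to the values of \<kappa>.\<close>

lemma subcase_pullback_exists:
  assumes "subcase_exponents k \<kappa> \<gamma> \<delta> \<epsilon>" "{\<kappa> 0, \<kappa> 1, \<kappa> (subcase_D k)} \<subseteq> {\<gamma>, \<delta>, \<epsilon>}"
    and "\<alpha> + \<beta> - \<kappa> 0 - \<kappa> 1 - \<kappa> (subcase_D k) + 1 = 0"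
  shows "pullback_exists k \<kappa> \<alpha> \<beta>"
proof (cases k)
  case Case1a
  then show ?thesis using assms pullback_1a by simp
next
  case Case1b
  then show ?thesis using assms pullback_1b by simp
next
  case Case1c
  then show ?thesis using assms pullback_1c by simp
next
  case Case2a
  have "\<kappa> 0 = \<kappa> 1" "\<kappa> 1 = \<kappa> (subcase_D Case2a)"
    using assms(1,2) unfolding Case2a by (auto simp del: subcase_D.simps)
  then show ?thesis using assms(3) pullback_2a unfolding Case2a by blast
next
  case Case2b
  show ?thesis using assms(1,3) pullback_2b unfolding Case2b subcase_exponents.simps by blast
next
  case Case2c
  show ?thesis using assms(1,3) pullback_2c unfolding Case2c subcase_exponents.simps by blast
next
  case Case2d
  have "\<kappa> 0 = 2/3" "\<kappa> 1 = 2/3" "\<kappa> (subcase_D Case2d) = 2/3"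
    using assms(1,2) unfolding Case2d by (auto simp del: subcase_D.simps)
  then show ?thesis using assms(3) pullback_2d unfolding Case2d by blast
qed

section \<open>The main theorem\<close>

lemma reducible_of_pullback:
  fixes xa xb xc :: complex and R :: "complex poly"
  assumes d: "distinct [d1, d2, d3, d4]" and A: "A \<noteq> 0"
    and x: "xa = recip_coord d4 A B d1" "xb = recip_coord d4 A B d2" "xc = recip_coord d4 A B d3"
    and fuchs: "\<alpha> + \<beta> - \<kappa> xa - \<kappa> xb - \<kappa> xc + 1 = 0"
    and q'': "q'' = (q - \<alpha> * \<beta> * B) / A * ((d4 - d1) * (d4 - d2) * (d4 - d3))"
    and red: "same_ode (subst_ode (hypergeometric_ode a b c) (poly R)) (heun_on {xa, xb, xc} \<kappa> (\<alpha> * \<beta>) q)"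
    and deg: "degree R \<noteq> 0"
  shows "reducible_to_hypergeometric (general_heun_ode d1 d2 d3 d4 (\<kappa> xa) (\<kappa> xb) (\<kappa> xc) \<alpha> \<beta> q'')"
proof -
  let ?H = "hypergeometric_ode a b c" and ?N = "recip_coord d4 A B"
  have nonconst: "\<nexists>k. R = smult k 1"
  proof
    assume "\<exists>k. R = smult k 1"
    then obtain k where "R = [:k:]" by (auto simp: one_pCons)
    with deg show False by simp
  qed
  obtain P Q where PQ: "Q \<noteq> 0" "\<nexists>k. P = smult k Q"
    and eq: "\<And>s. s \<noteq> d4 \<Longrightarrow> poly R (?N s) / poly 1 (?N s) = poly P s / poly Q s"
    by (rule rational_recip_coord[OF A one_neq_zero nonconst, where d = d4 and B = B]) (rule that; (assumption | simp))
  have "same_ode (subst_ode ?H (\<lambda>s. poly P s / poly Q s)) (subst_ode ?H (poly R \<circ> ?N))"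
    by (rule subst_ode_cong_off_finite[of "{d4}"]) (use eq in auto)
  also have "same_ode (subst_ode ?H (poly R \<circ> ?N)) (subst_ode (subst_ode ?H (poly R)) ?N)"
  proof (rule subst_ode_recip_coord_compose[OF A])
    have "pderiv R \<noteq> 0" using deg by (simp add: pderiv_eq_0_iff)
    then show "finite {z. poly (pderiv R) z = 0}" by (rule poly_roots_finite)
    show "poly R analytic_on {z} \<and> deriv (poly R) z \<noteq> 0" if "z \<notin> {z. poly (pderiv R) z = 0}" for z
      using that rational_deriv[of 1 z R] by (simp add: wronskian_def)
  qed
  also have "same_ode \<dots> (subst_ode (heun_on {xa, xb, xc} \<kappa> (\<alpha> * \<beta>) q) ?N)"
    by (intro same_ode_subst_ode red inj_recip_coord A)
  also have "same_ode \<dots> (general_heun_ode d1 d2 d3 d4 (\<kappa> xa) (\<kappa> xb) (\<kappa> xc) \<alpha> \<beta> q'')"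
    by (rule general_heun_same_ode_heun_on[OF x A d fuchs q''])
  finally show ?thesis
    unfolding reducible_to_hypergeometric_def nonconstant_rational_def using PQ by blast
qed

lemma subcase_imp_reducible:
  assumes d: "distinct [d1, d2, d3, d4]" and fuchs: "\<alpha> + \<beta> - \<gamma> - \<delta> - \<epsilon> + 1 = 0" and \<alpha>\<beta>: "\<alpha> * \<beta> \<noteq> 0"
    and ex: "exponents_satisfy k d1 d2 d3 d4 \<gamma> \<delta> \<epsilon> M"
    and acc: "accessory_satisfies k d1 d2 d3 d4 \<gamma> \<delta> \<epsilon> \<alpha> \<beta> M q''"
  shows "reducible_to_hypergeometric (general_heun_ode d1 d2 d3 d4 \<gamma> \<delta> \<epsilon> \<alpha> \<beta> q'')"
proof -
  obtain A B where A: "A \<noteq> 0" and M: "M = pole_moebius d4 A B"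
    using ex moebius_with_pole[of M d4] unfolding exponents_satisfy_def normalizing_moebius_def by blast
  define \<kappa> where "\<kappa> = exponent_param d1 d2 d3 \<gamma> \<delta> \<epsilon> M"
  note \<kappa> = exponent_param_pole_moebius[OF d A, of \<gamma> \<delta> \<epsilon> B, folded M, folded \<kappa>_def]
  define t1 t2 t3 where t: "t1 = recip_coord d4 A B d1" "t2 = recip_coord d4 A B d2" "t3 = recip_coord d4 A B d3"
  let ?D = "subcase_D k"
  have img: "recip_coord d4 A B ` {d1, d2, d3} = {0, 1, ?D}"
    using ex normalizing_pole_moebius_iff[OF d A] unfolding exponents_satisfy_def M by blast
  then have S: "{t1, t2, t3} = {0, 1, ?D}" by (simp add: t)
  have dist: "t1 \<noteq> t2" "t1 \<noteq> t3" "t2 \<noteq> t3"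
    using d inj_recip_coord[OF A, of d4 B] unfolding t by (auto dest: injD)
  have "(\<Sum>x\<in>{t1, t2, t3}. \<kappa> x) = (\<Sum>x\<in>{0, 1, ?D}. \<kappa> x)" unfolding S ..
  then have "\<kappa> t1 + \<kappa> t2 + \<kappa> t3 = \<kappa> 0 + \<kappa> 1 + \<kappa> ?D"
    using dist subcase_D_ne[of k] by (simp add: add.assoc)
  then have "\<alpha> + \<beta> - \<kappa> 0 - \<kappa> 1 - \<kappa> ?D + 1 = 0"
    using fuchs unfolding t \<kappa> by algebra
  moreover have "{\<kappa> 0, \<kappa> 1, \<kappa> ?D} \<subseteq> {\<gamma>, \<delta>, \<epsilon>}"
  proof -
    have "\<kappa> ` {0, 1, ?D} = \<kappa> ` {t1, t2, t3}" unfolding S ..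
    then show ?thesis by (simp add: t \<kappa>)
  qed
  moreover have "subcase_exponents k \<kappa> \<gamma> \<delta> \<epsilon>"
    using ex unfolding exponents_satisfy_def \<kappa>_def by blast
  ultimately have "pullback_exists k \<kappa> \<alpha> \<beta>"
    by (intro subcase_pullback_exists)
  then obtain u v a b c R where u: "u \<noteq> 0" and ratio: "u * subcase_ratio k + v = 0" and deg: "degree R \<noteq> 0"
    and red: "same_ode (subst_ode (hypergeometric_ode a b c) (poly R))
          (heun_on ((\<lambda>t. u * t + v) ` {0, 1, ?D}) (\<lambda>x. \<kappa> ((x - v) / u)) (\<alpha> * \<beta>) 0)"
    unfolding pullback_exists_def by (elim exE conjE) (rule that; assumption)
  \<comment> \<open>The normalization and the affine map of the pullback combine into a single
    coordinate with pole \<open>d4\<close>.\<close>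
  have comp: "u * recip_coord d4 A B s + v = recip_coord d4 (u * A) (u * B + v) s" for s
    by (simp add: recip_coord_def algebra_simps)
  let ?\<kappa> = "\<lambda>x. \<kappa> ((x - v) / u)"
  let ?x1 = "u * t1 + v" and ?x2 = "u * t2 + v" and ?x3 = "u * t3 + v"
  have \<kappa>x: "?\<kappa> ?x1 = \<gamma>" "?\<kappa> ?x2 = \<delta>" "?\<kappa> ?x3 = \<epsilon>"
    using u \<kappa> by (simp_all add: t)
  have "reducible_to_hypergeometric (general_heun_ode d1 d2 d3 d4 (?\<kappa> ?x1) (?\<kappa> ?x2) (?\<kappa> ?x3) \<alpha> \<beta> q'')"
  proof (rule reducible_of_pullback[OF d _ _ _ _ _ _ _ deg,
        where \<kappa> = ?\<kappa> and A = "u * A" and B = "u * B + v" and xa = ?x1 and xb = ?x2 and xc = ?x3 and q = 0])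
    show "u * A \<noteq> 0" using u A by simp
    show "?x1 = recip_coord d4 (u * A) (u * B + v) d1" "?x2 = recip_coord d4 (u * A) (u * B + v) d2"
      "?x3 = recip_coord d4 (u * A) (u * B + v) d3"
      unfolding t by (rule comp)+
    show "\<alpha> + \<beta> - ?\<kappa> ?x1 - ?\<kappa> ?x2 - ?\<kappa> ?x3 + 1 = 0"
      unfolding \<kappa>x by (rule fuchs)
    have "(\<lambda>t. u * t + v) ` {0, 1, ?D} = {?x1, ?x2, ?x3}"
      unfolding S[symmetric] by simp
    then show "same_ode (subst_ode (hypergeometric_ode a b c) (poly R)) (heun_on {?x1, ?x2, ?x3} ?\<kappa> (\<alpha> * \<beta>) 0)"
      using red by simp
    \<comment> \<open>In the combined coordinate the accessory parameter is 0, since the affine map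
      sends the ratio to 0; this is the same value of \<open>q''\<close>.\<close>
    have "- (u * B + v) = u * (subcase_ratio k - B)"
      using ratio by algebra
    then have "(0 - \<alpha> * \<beta> * (u * B + v)) / (u * A) = \<alpha> * \<beta> * (subcase_ratio k - B) / A"
      using u by (metis (no_types, opaque_lifting) diff_0 mult.left_commute mult_divide_mult_cancel_left mult_minus_right)
    then show "q'' = (0 - \<alpha> * \<beta> * (u * B + v)) / (u * A) * ((d4 - d1) * (d4 - d2) * (d4 - d3))"
      using acc accessory_satisfies_iff[OF d A \<alpha>\<beta> fuchs img] unfolding M by simp
  qed
  then show ?thesis unfolding \<kappa>x .
qed

text \<open>The classification is applied in the coordinate \<open>1 / (s - d4)\<close>. The affine
  map that it yields, composed with this coordinate, is the required transformation.\<close>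

lemma reducible_imp_subcase:
  fixes d1 d2 d3 d4 \<alpha> \<beta> \<gamma> \<delta> \<epsilon> q'' :: complex
  defines "E \<equiv> general_heun_ode d1 d2 d3 d4 \<gamma> \<delta> \<epsilon> \<alpha> \<beta> q''"
  assumes d: "distinct [d1, d2, d3, d4]" and fuchs: "\<alpha> + \<beta> - \<gamma> - \<delta> - \<epsilon> + 1 = 0"
    and sing: "singular_point E d1" "singular_point E d2" "singular_point E d3"
    and nontriv: "\<alpha> * \<beta> \<noteq> 0 \<or> q'' \<noteq> 0" and red: "reducible_to_hypergeometric E"
  shows "\<alpha> * \<beta> \<noteq> 0 \<and> (\<exists>k M. exponents_satisfy k d1 d2 d3 d4 \<gamma> \<delta> \<epsilon> M \<and>
              accessory_satisfies k d1 d2 d3 d4 \<gamma> \<delta> \<epsilon> \<alpha> \<beta> M q'' \<and>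
              cross_ratio_orbit (Fin d1) (Fin d2) (Fin d3) (Fin d4) = standard_orbit (subcase_D k))"
proof -
  let ?\<Delta> = "(d4 - d1) * (d4 - d2) * (d4 - d3)"
  define e1 e2 e3 where e: "e1 = recip_coord d4 1 0 d1" "e2 = recip_coord d4 1 0 d2" "e3 = recip_coord d4 1 0 d3"
  have dist: "e1 \<noteq> e2" "e1 \<noteq> e3" "e2 \<noteq> e3"
    using d inj_recip_coord[of 1 d4 0] unfolding e by (auto dest: injD)
  have \<Delta>: "?\<Delta> \<noteq> 0" using d by auto
  define \<kappa> where "\<kappa> = (\<lambda>x. if x = e1 then \<gamma> else if x = e2 then \<delta> else \<epsilon>)"
  have \<kappa>: "\<kappa> e1 = \<gamma>" "\<kappa> e2 = \<delta>" "\<kappa> e3 = \<epsilon>" using dist by (auto simp: \<kappa>_def)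
  define q where "q = q'' / ?\<Delta>"
  have q: "q'' = q * ?\<Delta>" using \<Delta> by (simp add: q_def)
  have heun: "same_ode (subst_ode (heun_on {e1, e2, e3} \<kappa> (\<alpha> * \<beta>) q) (recip_coord d4 1 0)) E"
    using general_heun_same_ode_heun_on[OF e one_neq_zero d, of \<alpha> \<beta> \<kappa> q'' q] fuchs q
    unfolding \<kappa> E_def by simp
  \<comment> \<open>For \<open>e = 1 / (s - d4)\<close> the equation
    \<open>\<alpha> * \<beta> * e = q\<close> says that the numerator in \<open>s\<close> vanishes,
    so singularity carries over to \<open>w\<close>.\<close>
  have nonsing: "\<kappa> e \<noteq> 0 \<or> \<alpha> * \<beta> * e \<noteq> q"
    if "e = recip_coord d4 1 0 s" "\<kappa> e \<noteq> 0 \<or> \<alpha> * \<beta> * ?\<Delta> \<noteq> q'' * (s - d4)" "s \<noteq> d4" for e s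
  proof (rule ccontr)
    assume *: "\<not> (\<kappa> e \<noteq> 0 \<or> \<alpha> * \<beta> * e \<noteq> q)"
    then have "\<alpha> * \<beta> = q * (s - d4)"
      using that(1,3) by (auto simp: recip_coord_def divide_eq_eq)
    then have "\<alpha> * \<beta> * ?\<Delta> = q'' * (s - d4)" unfolding q by (simp add: mult_ac)
    with * that(2) show False by blast
  qed
  have ds: "d1 \<noteq> d4" "d2 \<noteq> d4" "d3 \<noteq> d4" using d by auto
  have "\<gamma> \<noteq> 0 \<or> \<alpha> * \<beta> * ?\<Delta> \<noteq> q'' * (d1 - d4)"
    using singular_point_imp[OF d sing(1)[unfolded E_def]] .
  moreover have "\<delta> \<noteq> 0 \<or> \<alpha> * \<beta> * ?\<Delta> \<noteq> q'' * (d2 - d4)"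
    using singular_point_imp[OF _ sing(2)[unfolded E_def general_heun_ode_swap(1)[of d1]]] d by (auto simp: mult_ac)
  moreover have "\<epsilon> \<noteq> 0 \<or> \<alpha> * \<beta> * ?\<Delta> \<noteq> q'' * (d3 - d4)"
    using singular_point_imp[OF _ sing(3)[unfolded E_def general_heun_ode_swap(2)[of d1]]] d by (auto simp: mult_ac)
  ultimately have nonsing': "\<kappa> e \<noteq> 0 \<or> \<alpha> * \<beta> * e \<noteq> q" if "e \<in> {e1, e2, e3}" for e
    using that nonsing[OF e(1) _ ds(1), unfolded \<kappa>] nonsing[OF e(2) _ ds(2), unfolded \<kappa>]
      nonsing[OF e(3) _ ds(3), unfolded \<kappa>] \<kappa> by (elim insertE emptyE) simp_all
  have "card {e1, e2, e3} = 3" using dist by simp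
  moreover have "\<alpha> * \<beta> \<noteq> 0 \<or> q \<noteq> 0" using nontriv q by auto
  ultimately obtain k A B where \<alpha>\<beta>: "\<alpha> * \<beta> \<noteq> 0" and holds: "subcase_holds k {e1, e2, e3} \<kappa> (q / (\<alpha> * \<beta>)) A B"
    using reducible_imp_subcase_holds[OF red heun _ _ nonsing'] by blast
  note holds = holds[unfolded subcase_holds_def]
  have A: "A \<noteq> 0" using holds by blast
  have t: "recip_coord d4 A B d1 = A * e1 + B" "recip_coord d4 A B d2 = A * e2 + B" "recip_coord d4 A B d3 = A * e3 + B"
    unfolding e by (rule recip_coord_affine)+
  have img: "recip_coord d4 A B ` {d1, d2, d3} = {0, 1, subcase_D k}"
    using holds by (simp add: t)
  define \<kappa>M where "\<kappa>M = exponent_param d1 d2 d3 \<gamma> \<delta> \<epsilon> (pole_moebius d4 A B)"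
  have \<kappa>M: "\<kappa>M x = \<kappa> ((x - B) / A)" if "x \<in> {0, 1, subcase_D k}" for x
  proof -
    have "x \<in> {A * e1 + B, A * e2 + B, A * e3 + B}" using that img by (simp add: t)
    then show ?thesis
      using exponent_param_pole_moebius[OF d A, of \<gamma> \<delta> \<epsilon> B, folded \<kappa>M_def, unfolded t] A \<kappa> by auto
  qed
  have "subcase_exponents k (\<lambda>x. \<kappa> ((x - B) / A)) \<gamma> \<delta> \<epsilon>"
    using holds \<kappa> by auto
  then have "subcase_exponents k \<kappa>M \<gamma> \<delta> \<epsilon>"
    using subcase_exponents_cong[of k \<kappa>M "\<lambda>x. \<kappa> ((x - B) / A)"] \<kappa>M by blast
  then have "exponents_satisfy k d1 d2 d3 d4 \<gamma> \<delta> \<epsilon> (pole_moebius d4 A B)"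
    unfolding exponents_satisfy_def normalizing_pole_moebius_iff[OF d A] \<kappa>M_def using img by blast
  moreover have "accessory_satisfies k d1 d2 d3 d4 \<gamma> \<delta> \<epsilon> \<alpha> \<beta> (pole_moebius d4 A B) q''"
  proof -
    have "A * (q / (\<alpha> * \<beta>)) + B = subcase_ratio k" using holds by blast
    then have "subcase_ratio k - B = A * (q / (\<alpha> * \<beta>))" by (metis add_diff_cancel_right')
    then have "\<alpha> * \<beta> * (subcase_ratio k - B) / A = q" using A \<alpha>\<beta> by simp
    then show ?thesis unfolding accessory_satisfies_iff[OF d A \<alpha>\<beta> fuchs img] using q by simp
  qed
  moreover have "cross_ratio_orbit (Fin d1) (Fin d2) (Fin d3) (Fin d4) = standard_orbit (subcase_D k)"
    by (rule cross_ratio_orbit_normalized[OF d A subcase_D_ne img])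
  ultimately show ?thesis using \<alpha>\<beta> by blast
qed

text \<open>Two normalizing transformations differ by an affine permutation of 0, 1,
  \<open>D\<close>, which fixes the ratio and hence the value of \<open>q''\<close>.\<close>

lemma accessory_unique:
  assumes d: "distinct [d1, d2, d3, d4]" and fuchs: "\<alpha> + \<beta> - \<gamma> - \<delta> - \<epsilon> + 1 = 0" and \<alpha>\<beta>: "\<alpha> * \<beta> \<noteq> 0"
    and ex: "\<exists>M. exponents_satisfy k d1 d2 d3 d4 \<gamma> \<delta> \<epsilon> M"
  shows "\<exists>!r. \<exists>M. exponents_satisfy k d1 d2 d3 d4 \<gamma> \<delta> \<epsilon> M \<and>
                  accessory_satisfies k d1 d2 d3 d4 \<gamma> \<delta> \<epsilon> \<alpha> \<beta> M r"
proof -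
  let ?\<Delta> = "(d4 - d1) * (d4 - d2) * (d4 - d3)"
  let ?D = "subcase_D k"
  have pole: "\<exists>A B. A \<noteq> 0 \<and> M = pole_moebius d4 A B \<and> recip_coord d4 A B ` {d1, d2, d3} = {0, 1, ?D}"
    if ex: "exponents_satisfy k d1 d2 d3 d4 \<gamma> \<delta> \<epsilon> M" for M
  proof -
    obtain A B where A: "A \<noteq> 0" and M: "M = pole_moebius d4 A B"
      using ex moebius_with_pole[of M d4] unfolding exponents_satisfy_def normalizing_moebius_def by blast
    then show ?thesis
      using ex normalizing_pole_moebius_iff[OF d A] unfolding exponents_satisfy_def M by blast
  qed
  obtain M A B where M: "exponents_satisfy k d1 d2 d3 d4 \<gamma> \<delta> \<epsilon> M" "M = pole_moebius d4 A B"
    and A: "A \<noteq> 0" and img: "recip_coord d4 A B ` {d1, d2, d3} = {0, 1, ?D}"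
    using ex pole by blast
  let ?r = "\<alpha> * \<beta> * (subcase_ratio k - B) / A * ?\<Delta>"
  show ?thesis
  proof (rule ex1I[of _ ?r])
    show "\<exists>M. exponents_satisfy k d1 d2 d3 d4 \<gamma> \<delta> \<epsilon> M \<and> accessory_satisfies k d1 d2 d3 d4 \<gamma> \<delta> \<epsilon> \<alpha> \<beta> M ?r"
      using M accessory_satisfies_iff[OF d A \<alpha>\<beta> fuchs img] by blast
  next
    fix r assume "\<exists>M. exponents_satisfy k d1 d2 d3 d4 \<gamma> \<delta> \<epsilon> M \<and> accessory_satisfies k d1 d2 d3 d4 \<gamma> \<delta> \<epsilon> \<alpha> \<beta> M r"
    then obtain A' B' where A': "A' \<noteq> 0" and img': "recip_coord d4 A' B' ` {d1, d2, d3} = {0, 1, ?D}"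
      and acc: "accessory_satisfies k d1 d2 d3 d4 \<gamma> \<delta> \<epsilon> \<alpha> \<beta> (pole_moebius d4 A' B') r"
      using pole by blast
    have r: "r = \<alpha> * \<beta> * (subcase_ratio k - B') / A' * ?\<Delta>"
      using acc accessory_satisfies_iff[OF d A' \<alpha>\<beta> fuchs img'] by blast
    define u v where "u = A' / A" and "v = B' - u * B"
    have uv: "recip_coord d4 A' B' s = u * recip_coord d4 A B s + v" for s
    proof -
      have "u * A = A'" using A by (simp add: u_def)
      then show ?thesis by (simp add: recip_coord_def v_def distrib_left)
    qed
    have "recip_coord d4 A' B' ` {d1, d2, d3} = (\<lambda>t. u * t + v) ` (recip_coord d4 A B ` {d1, d2, d3})"
      unfolding image_image uv ..
    then have "{0, 1, ?D} = (\<lambda>t. u * t + v) ` {0, 1, ?D}"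
      unfolding img img' .
    then have "{v, u + v, u * ?D + v} = {0, 1, ?D}" by simp
    then have "u * subcase_ratio k + v = subcase_ratio k"
      by (rule affine_permutation_fixes_ratio)
    then have "subcase_ratio k - B' = u * (subcase_ratio k - B)"
      unfolding v_def by (simp add: algebra_simps)
    then have "(subcase_ratio k - B') / A' = (subcase_ratio k - B) / A"
      using A A' by (simp add: u_def)
    then show "r = ?r" unfolding r by (metis times_divide_eq_right)
  qed
qed


section \<open>The explicit cross-ratio orbits\<close>

text \<open>For real part 1/2 the complement \<open>1 - D\<close> is the conjugate of
  \<open>D\<close>, and \<open>n\<close> is the squared modulus of both, so reciprocals are
  conjugates divided by \<open>n\<close>.\<close>

lemma standard_orbit_half:
  fixes y :: real
  defines "n \<equiv> 1/4 + y^2"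
  shows "standard_orbit (1/2 + \<i> * complex_of_real y) = {Complex (1/2) y, Complex (1/2) (- y),
    Complex (1 / (2 * n)) (- (y / n)), Complex (1 / (2 * n)) (y / n),
    Complex (1 - 1 / (2 * n)) (- (y / n)), Complex (1 - 1 / (2 * n)) (y / n)}"
proof -
  define D where "D = Complex (1/2) y"
  have D: "1/2 + \<i> * complex_of_real y = D"
    by (simp add: D_def complex_eq_iff)
  have n: "n > 0" unfolding n_def by (simp add: add_pos_nonneg)
  have "1/4 / n + y^2 / n = 1"
  proof -
    have "1/4 / n + y^2 / n = n / n"
      unfolding n_def by (rule add_divide_distrib[symmetric])
    then show ?thesis using n by simp
  qed
  then have inv: "D * Complex (1 / (2 * n)) (- (y / n)) = 1" "(1 - D) * Complex (1 / (2 * n)) (y / n) = 1"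
    by (simp_all add: D_def complex_eq_iff power2_eq_square)
  then have ne: "D \<noteq> 0" "D \<noteq> 1" by auto
  have i1: "1 / D = Complex (1 / (2 * n)) (- (y / n))"
    using inverse_unique[OF inv(1)] by (simp add: inverse_eq_divide)
  have i2: "1 / (1 - D) = Complex (1 / (2 * n)) (y / n)"
    using inverse_unique[OF inv(2)] by (simp add: inverse_eq_divide)
  have "D / (D - 1) = 1 - 1 / (1 - D)" "(D - 1) / D = 1 - 1 / D"
    using ne by (simp_all add: field_simps)
  then have "D / (D - 1) = Complex (1 - 1 / (2 * n)) (- (y / n))" "(D - 1) / D = Complex (1 - 1 / (2 * n)) (y / n)"
    unfolding i1 i2 by (simp_all add: complex_eq_iff)
  moreover have "1 - D = Complex (1/2) (- y)"
    by (simp add: D_def complex_eq_iff)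
  ultimately show ?thesis
    unfolding D standard_orbit_eq'[OF ne] orbit_of_def i1 i2 by (simp add: D_def)
qed

text \<open>The excluded value 1 belongs to the equianharmonic orbit, where the six values collapse.
  The set of squared moduli is an invariant that can tell two orbits apart.\<close>

lemma standard_orbit_half_generic:
  fixes y :: real
  defines "D \<equiv> 1/2 + \<i> * complex_of_real y"
  assumes y: "y > 0" and ne: "1/4 + y^2 \<noteq> 1"
  shows "card (standard_orbit D) = 6" "standard_orbit D \<inter> \<real> = {}"
    "(\<lambda>z. (norm z)^2) ` standard_orbit D = {1/4 + y^2, 1 / (1/4 + y^2), 1}"
proof -
  define n where "n = 1/4 + y^2"
  define p b where "p = 1 / (2 * n)" and "b = y / n"
  have n: "n > 0" "n \<noteq> 1" using ne by (simp_all add: n_def add_pos_nonneg)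
  have S: "standard_orbit D = {Complex (1/2) y, Complex (1/2) (- y), Complex p (- b), Complex p b,
      Complex (1 - p) (- b), Complex (1 - p) b}"
    unfolding D_def p_def b_def n_def by (rule standard_orbit_half)
  have b: "b > 0" "b \<noteq> y" using y n by (auto simp: b_def divide_eq_eq)
  have p: "p \<noteq> 1 - p" using n by (auto simp: p_def field_simps)
  show "card (standard_orbit D) = 6"
    unfolding S using y b p by (simp add: card_insert_if)
  show "standard_orbit D \<inter> \<real> = {}"
    unfolding S using y b by (auto simp: complex_is_Real_iff)
  have "p^2 = 1/4 / n^2" "b^2 = y^2 / n^2"
    by (simp_all add: p_def b_def power_divide power_mult_distrib)
  then have "p^2 + b^2 = (1/4 + y^2) / n^2"
    by (simp only: add_divide_distrib)
  then have "p^2 + b^2 = n / n^2"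
    by (simp only: n_def)
  then have pb: "p^2 + b^2 = 1 / n" using n by (simp add: power2_eq_square)
  moreover have "(1 - p)^2 + b^2 = 1 - 2 * p + (p^2 + b^2)"
    by (simp add: power2_eq_square algebra_simps)
  then have "(1 - p)^2 + b^2 = 1"
    unfolding pb by (simp add: p_def)
  ultimately show "(\<lambda>z. (norm z)^2) ` standard_orbit D = {1/4 + y^2, 1 / (1/4 + y^2), 1}"
    unfolding S by (simp add: cmod_power2 n_def power_divide insert_commute)
qed

theorem corollary4p2:
  fixes d1 d2 d3 d4 \<alpha> \<beta> \<gamma> \<delta> \<epsilon> q'' :: complex and E :: ode
  defines "E \<equiv> general_heun_ode d1 d2 d3 d4 \<gamma> \<delta> \<epsilon> \<alpha> \<beta> q''"
  assumes "distinct [d1, d2, d3, d4]"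
    and "\<alpha> + \<beta> - \<gamma> - \<delta> - \<epsilon> + 1 = 0"
    and "singular_point E d1" "singular_point E d2" "singular_point E d3" "singular_point E d4"
    and "\<alpha> * \<beta> \<noteq> 0 \<or> q'' \<noteq> 0"
  shows
    "(reducible_to_hypergeometric E \<longleftrightarrow>
        \<alpha> * \<beta> \<noteq> 0 \<and>
        (\<exists>D \<in> {2, 1/2 + \<i> * (sqrt 3 / 2), 4,
                1/2 + \<i> * (5 * sqrt 2 / 4), 1/2 + \<i> * (11 * sqrt 15 / 90)}.
           cross_ratio_orbit (Fin d1) (Fin d2) (Fin d3) (Fin d4) = standard_orbit D \<and>
           (\<exists>k M. subcase_D k = D \<and>
              exponents_satisfy k d1 d2 d3 d4 \<gamma> \<delta> \<epsilon> M \<and>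
              accessory_satisfies k d1 d2 d3 d4 \<gamma> \<delta> \<epsilon> \<alpha> \<beta> M q''))) \<and>
     (\<forall>k. \<alpha> * \<beta> \<noteq> 0 \<and>
        cross_ratio_orbit (Fin d1) (Fin d2) (Fin d3) (Fin d4) = standard_orbit (subcase_D k) \<and>
        (\<exists>M. exponents_satisfy k d1 d2 d3 d4 \<gamma> \<delta> \<epsilon> M) \<longrightarrow>
        (\<exists>!r. \<exists>M. exponents_satisfy k d1 d2 d3 d4 \<gamma> \<delta> \<epsilon> M \<and>
                  accessory_satisfies k d1 d2 d3 d4 \<gamma> \<delta> \<epsilon> \<alpha> \<beta> M r)) \<and>
     standard_orbit 2 = harmonic_orbit \<and>
     standard_orbit (1/2 + \<i> * (sqrt 3 / 2)) = equianharmonic_orbit \<and>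
     card (standard_orbit 4) = 6 \<and> standard_orbit 4 \<subseteq> \<real> \<and>
     (\<forall>D \<in> {1/2 + \<i> * (5 * sqrt 2 / 4), 1/2 + \<i> * (11 * sqrt 15 / 90)}.
        card (standard_orbit D) = 6 \<and> standard_orbit D \<inter> \<real> = {}) \<and>
     standard_orbit (1/2 + \<i> * (5 * sqrt 2 / 4)) \<noteq> standard_orbit (1/2 + \<i> * (11 * sqrt 15 / 90))"
proof (intro conjI)
  show "reducible_to_hypergeometric E \<longleftrightarrow>
        \<alpha> * \<beta> \<noteq> 0 \<and>
        (\<exists>D \<in> {2, 1/2 + \<i> * (sqrt 3 / 2), 4,
                1/2 + \<i> * (5 * sqrt 2 / 4), 1/2 + \<i> * (11 * sqrt 15 / 90)}.
           cross_ratio_orbit (Fin d1) (Fin d2) (Fin d3) (Fin d4) = standard_orbit D \<and>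
           (\<exists>k M. subcase_D k = D \<and>
              exponents_satisfy k d1 d2 d3 d4 \<gamma> \<delta> \<epsilon> M \<and>
              accessory_satisfies k d1 d2 d3 d4 \<gamma> \<delta> \<epsilon> \<alpha> \<beta> M q''))"
    (is "_ \<longleftrightarrow> _ \<and> (\<exists>D \<in> ?Ds. _)")
  proof
    assume "reducible_to_hypergeometric E"
    with reducible_imp_subcase[of d1 d2 d3 d4 \<alpha> \<beta> \<gamma> \<delta> \<epsilon> q''] assms obtain k M where *: "\<alpha> * \<beta> \<noteq> 0"
      "exponents_satisfy k d1 d2 d3 d4 \<gamma> \<delta> \<epsilon> M" "accessory_satisfies k d1 d2 d3 d4 \<gamma> \<delta> \<epsilon> \<alpha> \<beta> M q''"
      "cross_ratio_orbit (Fin d1) (Fin d2) (Fin d3) (Fin d4) = standard_orbit (subcase_D k)"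
      unfolding E_def by blast
    moreover have "subcase_D k \<in> ?Ds" by (cases k) simp_all
    ultimately show "\<alpha> * \<beta> \<noteq> 0 \<and> (\<exists>D \<in> ?Ds.
           cross_ratio_orbit (Fin d1) (Fin d2) (Fin d3) (Fin d4) = standard_orbit D \<and>
           (\<exists>k M. subcase_D k = D \<and> exponents_satisfy k d1 d2 d3 d4 \<gamma> \<delta> \<epsilon> M \<and>
              accessory_satisfies k d1 d2 d3 d4 \<gamma> \<delta> \<epsilon> \<alpha> \<beta> M q''))"
      by (intro conjI bexI[of _ "subcase_D k"] exI[of _ k] exI[of _ M] refl)
  qed (use subcase_imp_reducible[OF assms(2,3)] in \<open>unfold E_def, blast\<close>)
  show "\<forall>k. \<alpha> * \<beta> \<noteq> 0 \<and>
        cross_ratio_orbit (Fin d1) (Fin d2) (Fin d3) (Fin d4) = standard_orbit (subcase_D k) \<and>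
        (\<exists>M. exponents_satisfy k d1 d2 d3 d4 \<gamma> \<delta> \<epsilon> M) \<longrightarrow>
        (\<exists>!r. \<exists>M. exponents_satisfy k d1 d2 d3 d4 \<gamma> \<delta> \<epsilon> M \<and>
                  accessory_satisfies k d1 d2 d3 d4 \<gamma> \<delta> \<epsilon> \<alpha> \<beta> M r)"
    using accessory_unique[OF assms(2,3)] by blast
  show "standard_orbit 2 = harmonic_orbit"
  proof -
    have "standard_orbit 2 = {2, -1, 1/2, -1, 2, 1/2}"
      by (simp add: standard_orbit_eq' orbit_of_def)
    then show ?thesis unfolding harmonic_orbit_def by blast
  qed
  show "standard_orbit (1/2 + \<i> * (sqrt 3 / 2)) = equianharmonic_orbit"
  proof -
    have "1/4 + (sqrt 3 / 2)^2 = 1" by (simp add: power_divide)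
    then have "standard_orbit (1/2 + \<i> * (sqrt 3 / 2)) = {Complex (1/2) (sqrt 3 / 2), Complex (1/2) (- (sqrt 3 / 2))}"
      unfolding standard_orbit_half by auto
    moreover have "Complex (1/2) (sqrt 3 / 2) = 1/2 + \<i> * (sqrt 3 / 2)"
      "Complex (1/2) (- (sqrt 3 / 2)) = 1/2 - \<i> * (sqrt 3 / 2)"
      by (simp_all add: complex_eq_iff)
    ultimately show ?thesis unfolding equianharmonic_orbit_def by simp
  qed
  have orbit4: "standard_orbit 4 = complex_of_real ` {4, -3, 1/4, -1/3, 4/3, 3/4}"
    by (simp add: standard_orbit_eq' orbit_of_def)
  show "card (standard_orbit 4) = 6"
    unfolding orbit4 by (subst card_image) (simp_all add: inj_on_def)
  show "standard_orbit 4 \<subseteq> \<real>"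
    unfolding orbit4 by auto
  have squares: "(5 * sqrt 2 / 4)^2 = 25/8" "(11 * sqrt 15 / 90)^2 = 121/540"
    by (simp_all add: power_divide power_mult_distrib)
  note orbit_b = standard_orbit_half_generic[of "5 * sqrt 2 / 4", unfolded squares]
  note orbit_c = standard_orbit_half_generic[of "11 * sqrt 15 / 90", unfolded squares]
  show "\<forall>D \<in> {1/2 + \<i> * (5 * sqrt 2 / 4), 1/2 + \<i> * (11 * sqrt 15 / 90)}.
        card (standard_orbit D) = 6 \<and> standard_orbit D \<inter> \<real> = {}"
    using orbit_b(1,2) orbit_c(1,2) by simp
  show "standard_orbit (1/2 + \<i> * (5 * sqrt 2 / 4)) \<noteq> standard_orbit (1/2 + \<i> * (11 * sqrt 15 / 90))"
  proof
    assume "standard_orbit (1/2 + \<i> * (5 * sqrt 2 / 4)) = standard_orbit (1/2 + \<i> * (11 * sqrt 15 / 90))"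
    then have "{1/4 + 25/8, 1 / (1/4 + 25/8), 1} = {1/4 + 121/540, 1 / (1/4 + 121/540), 1 :: real}"
      using orbit_b(3) orbit_c(3) by simp
    \<comment> \<open>The squared moduli are 27/8, 8/27, 1 for one orbit and 64/135, 135/64, 1 for
      the other.\<close>
    then have "1/4 + 25/8 \<in> {1/4 + 121/540, 1 / (1/4 + 121/540), 1 :: real}" by blast
    then show False by simp
  qed
qed

end
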